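(* Let $X$ be a complex Banach space, $1\le p\le\infty$, and let $p^\ast$ be the conjugate exponent of $p$. The Bohr transform, which sends $T\in\Lambda^+(E_{p^\ast}(\mathbb{T}^{\mathbb{N}}),X)$ to the Dirichlet series $\sum_n a_nn^{-s}$ with $a_n=T(\omega^{-\alpha})$ for $n=\mathfrak{p}^\alpha$, $\alpha\in\mathbb{N}_0^{(\mathbb{N})}$, defines a linear isometry of $\left(\Lambda^+(E_{p^\ast}(\mathbb{T}^{\mathbb{N}}),X),\|\cdot\|_\Lambda\right)$ onto $\left(\mathcal{H}_p^+(X),\|\cdot\|_{\mathcal{H}_p^+(X)}\right)$.
   Context: $\mathbb{N}_0=\mathbb{N}\cup\{0\}$; $\mathbb{Z}^{(\mathbb{N})}$ (resp. $\mathbb{N}_0^{(\mathbb{N})}$) is the set of eventually zero sequences of integers (resp. of elements of $\mathbb{N}_0$). $\mathfrak{p}=(\mathfrak{p}_1<\mathfrak{p}_2<\dots)$ is the sequence of primes and $\mathfrak{p}^\alpha=\prod_j\mathfrak{p}_j^{\alpha_j}$, so every $n\in\mathbb{N}$ equals $\mathfrak{p}^\alpha$ for a unique $\alpha\in\mathbb{N}_0^{(\mathbb{N})}$. $\mathbb{T}^{\mathbb{N}}$ is the infinite-dimensional torus with normalized Haar measure $d\omega$; $L_p(\mathbb{T}^{\mathbb{N}},X)$ is the Bochner space of $p$-integrable functions ($p<\infty$), resp. of essentially bounded (strongly) measurable functions ($p=\infty$). For $\alpha\in\mathbb{Z}^{(\mathbb{N})}$ put $\omega^\alpha=\prod_j\omega_j^{\alpha_j}$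 and $\widehat f(\alpha)=\int_{\mathbb{T}^{\mathbb{N}}}f(\omega)\omega^{-\alpha}\,d\omega$. $H_p(\mathbb{T}^{\mathbb{N}},X)$ is the closed subspace of those $f\in L_p(\mathbb{T}^{\mathbb{N}},X)$ with $\widehat f(\alpha)=0$ for all $\alpha\in\mathbb{Z}^{(\mathbb{N})}\setminus\mathbb{N}_0^{(\mathbb{N})}$. A Dirichlet series in $X$ is a formal series $D=\sum_n a_n n^{-s}$ with $a_n\in X$, identified with its coefficient sequence. $\mathcal{H}_p(X)$ is the space of Dirichlet series $D=\sum_n a_nn^{-s}$ for which there is a (unique) $f\in H_p(\mathbb{T}^{\mathbb{N}},X)$ with $\widehat f(\alpha)=a_{\mathfrak{p}^\alpha}$ for all $\alpha\in\mathbb{N}_0^{(\mathbb{N})}$, with norm $\|D\|_{\mathcal{H}_p(X)}=\|f\|_{L_p}$. For $\varepsilon>0$, $D_\varepsilon=\sum_n \frac{a_n}{n^\varepsilon}n^{-s}$. $\mathcal{H}_p^+(X)$ is the space of Dirichlet series $D$ in $X$ such that $D_\varepsilon\in\mathcal{H}_p(X)$ for every $\varepsilon>0$ and $\|D\|_{\mathcal{H}_p^+(X)}:=\sup_{\varepsilon>0}\|D_\varepsilon\|_{\mathcal{H}_p(X)}<\infty$. For $1\le q<\infty$, $E_q(\mathbb{T}^{\mathbb{N}})=L_q(\mathbb{T}^{\mathbb{N}},\mathbb{C})$, and $E_\infty(\mathbb{T}^{\mathbb{N}})=C(\mathbb{T}^{\mathbb{N}},\mathbb{C})$, with their natural norms;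 these are Banach lattices. $1/p+1/p^\ast=1$ with $1/\infty=0$. For a Banach lattice $E$, a bounded linear operator $T:E\to X$ is cone absolutely summing if there is $C>0$ such that for every finite choice of positive elements $f_1,\dots,f_n\in E$, $$\sum_{i=1}^n\|Tf_i\|\le C\sup_{\xi^\ast\in B_{E^\ast}}\sum_{i=1}^n|\xi^\ast f_i|,$$ where $B_{E^\ast}$ is the closed unit ball of the dual $E^\ast$. $\Lambda(E,X)$ is the space of all such operators, and $\|T\|_\Lambda$ is the infimum of all such constants $C$. $\Lambda^+(E_{p^\ast}(\mathbb{T}^{\mathbb{N}}),X)$ is the subspace of those $T\in\Lambda(E_{p^\ast}(\mathbb{T}^{\mathbb{N}}),X)$ with $T(\omega^{-\alpha})=0$ for all $\alpha\in\mathbb{Z}^{(\mathbb{N})}\setminus\mathbb{N}_0^{(\mathbb{N})}$, where $T(\omega^{-\alpha})$ is $T$ applied to the function $\omega\mapsto\omega^{-\alpha}$. *)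

theory Defs
  imports
    "HOL-Probability.Probability"
    "HOL-Library.Poly_Mapping"
    "HOL-Library.Nonpos_Ints"
    "HOL-Computational_Algebra.Primes"
begin

class complex_banach = banach +
  fixes scaleC :: "complex \<Rightarrow> 'a \<Rightarrow> 'a"  (infixr \<open>*\<^sub>C\<close> 75)
  assumes scaleC_add_right: "c *\<^sub>C (x + y) = c *\<^sub>C x + c *\<^sub>C y"
    and scaleC_add_left: "(c + d) *\<^sub>C x = c *\<^sub>C x + d *\<^sub>C x"
    and scaleC_scaleC: "c *\<^sub>C (d *\<^sub>C x) = (c * d) *\<^sub>C x"
    and scaleC_of_real: "complex_of_real r *\<^sub>C x = r *\<^sub>R x"
    and norm_scaleC: "norm (c *\<^sub>C x) = cmod c * norm x"

instantiation complex :: complex_banach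
begin

definition scaleC_complex :: "complex \<Rightarrow> complex \<Rightarrow> complex"
  where "scaleC_complex c z = c * z"

instance
  by standard (simp_all add: scaleC_complex_def algebra_simps norm_mult scaleR_conv_of_real)

end

text \<open>
  Normed spaces occur below as sets of functions into a complex Banach space, with
  pointwise operations, together with a norm given as a function.
\<close>

definition complex_subspace :: "('i \<Rightarrow> 'x::complex_banach) set \<Rightarrow> bool"
  where "complex_subspace V \<longleftrightarrow>
    (\<lambda>i. 0) \<in> V \<and>
    (\<forall>u\<in>V. \<forall>v\<in>V. (\<lambda>i. u i + v i) \<in> V) \<and>
    (\<forall>c. \<forall>u\<in>V. (\<lambda>i. c *\<^sub>C u i) \<in> V)"

definition linear_isometry_onto ::
  "(('i \<Rightarrow> 'x) \<Rightarrow> ('j \<Rightarrow> 'x)) \<Rightarrow> ('i \<Rightarrow> 'x) set \<Rightarrow> (('i \<Rightarrow> 'x) \<Rightarrow> real)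
    \<Rightarrow> ('j \<Rightarrow> 'x::complex_banach) set \<Rightarrow> (('j \<Rightarrow> 'x) \<Rightarrow> real) \<Rightarrow> bool"
  where "linear_isometry_onto B V normV W normW \<longleftrightarrow>
    complex_subspace V \<and> complex_subspace W \<and>
    (\<forall>u\<in>V. \<forall>v\<in>V. B (\<lambda>i. u i + v i) = (\<lambda>j. B u j + B v j)) \<and>
    (\<forall>c. \<forall>u\<in>V. B (\<lambda>i. c *\<^sub>C u i) = (\<lambda>j. c *\<^sub>C B u j)) \<and>
    bij_betw B V W \<and>
    (\<forall>u\<in>V. normW (B u) = normV u)"

text \<open>
  The library integral requires a second countable codomain. The following is the same
  definition, with Borel measurability replaced by strong measurability. Being a
  limit at every point, rather than almost everywhere, costs nothing: every almost everywhere
  limit of simple functions agrees almost everywhere with an everywhere limit.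
\<close>

definition strongly_measurable :: "'a measure \<Rightarrow> ('a \<Rightarrow> 'b::real_normed_vector) \<Rightarrow> bool"
  where "strongly_measurable M f \<longleftrightarrow>
    (\<exists>s. (\<forall>i::nat. simple_function M (s i)) \<and> (\<forall>x\<in>space M. (\<lambda>i. s i x) \<longlonglongrightarrow> f x))"

definition has_strong_integral :: "'a measure \<Rightarrow> ('a \<Rightarrow> 'b::real_normed_vector) \<Rightarrow> 'b \<Rightarrow> bool"
  where "has_strong_integral M f y \<longleftrightarrow>
    strongly_measurable M f \<and>
    (\<exists>s. (\<forall>i::nat. Bochner_Integration.simple_bochner_integrable M (s i)) \<and>
      (\<lambda>i. \<integral>\<^sup>+x. ennreal (norm (f x - s i x)) \<partial>M) \<longlonglongrightarrow> 0 \<and>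
      (\<lambda>i. Bochner_Integration.simple_bochner_integral M (s i)) \<longlonglongrightarrow> y)"

definition strong_integral :: "'a measure \<Rightarrow> ('a \<Rightarrow> 'b::real_normed_vector) \<Rightarrow> 'b"
  where "strong_integral M f = (THE y. has_strong_integral M f y)"

text \<open>
  Elements of the Bochner spaces are represented by functions; equality almost everywhere
  plays the role of equality.
\<close>

definition Lp_norm :: "'a measure \<Rightarrow> ennreal \<Rightarrow> ('a \<Rightarrow> 'b::real_normed_vector) \<Rightarrow> real"
  where "Lp_norm M p f =
    (if p = \<infinity> then enn2real (esssup M (\<lambda>x. ennreal (norm (f x))))
     else enn2real (\<integral>\<^sup>+x. ennreal (norm (f x) powr enn2real p) \<partial>M) powr (1 / enn2real p))"

definition Lp_space :: "'a measure \<Rightarrow> ennreal \<Rightarrow> ('a \<Rightarrow> 'b::real_normed_vector) set"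
  where "Lp_space M p = {f. strongly_measurable M f \<and>
    (if p = \<infinity> then esssup M (\<lambda>x. ennreal (norm (f x))) < \<infinity>
     else (\<integral>\<^sup>+x. ennreal (norm (f x) powr enn2real p) \<partial>M) < \<infinity>)}"

text \<open>Coordinates are indexed from \<open>0\<close>.\<close>

definition torus :: "(nat \<Rightarrow> complex) set"
  where "torus = {\<omega>. \<forall>j. cmod (\<omega> j) = 1}"

definition circle_measure :: "complex measure"
  where "circle_measure =
    distr (uniform_measure lborel {0..<2*pi}) (restrict_space borel (sphere 0 1)) cis"

text \<open>
  The Haar measure of a countable product of circles is the product of the normalized arc
  length measures; rotation invariance is \<open>haar_rotate\<close> below.
\<close>

definition haar :: "(nat \<Rightarrow> complex) measure"
  where "haar = (\<Pi>\<^sub>M j\<in>UNIV. circle_measure)"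

text \<open>
  The eventually zero integer sequences are the elements of \<open>nat \<Rightarrow>\<^sub>0 int\<close>.
\<close>

definition nonneg_exponents :: "(nat \<Rightarrow>\<^sub>0 int) set"
  where "nonneg_exponents = {\<alpha>. \<forall>j. 0 \<le> Poly_Mapping.lookup \<alpha> j}"

definition monomial :: "(nat \<Rightarrow>\<^sub>0 int) \<Rightarrow> (nat \<Rightarrow> complex) \<Rightarrow> complex"
  where "monomial \<alpha> \<omega> = (\<Prod>j\<in>Poly_Mapping.keys \<alpha>. \<omega> j powi Poly_Mapping.lookup \<alpha> j)"

definition fourier_coeff :: "((nat \<Rightarrow> complex) \<Rightarrow> 'x::complex_banach) \<Rightarrow> (nat \<Rightarrow>\<^sub>0 int) \<Rightarrow> 'x"
  where "fourier_coeff f \<alpha> = strong_integral haar (\<lambda>\<omega>. monomial (- \<alpha>) \<omega> *\<^sub>C f \<omega>)"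

definition hardy_torus :: "ennreal \<Rightarrow> ((nat \<Rightarrow> complex) \<Rightarrow> 'x::complex_banach) set"
  where "hardy_torus p = {f \<in> Lp_space haar p. \<forall>\<alpha>. \<alpha> \<notin> nonneg_exponents \<longrightarrow> fourier_coeff f \<alpha> = 0}"

text \<open>
  A Dirichlet series is identified with its coefficient sequence \<open>a\<close>. The unused entry
  \<open>a 0\<close> is required to be \<open>0\<close>, so that distinct functions are distinct series.
\<close>

definition prime_seq :: "nat \<Rightarrow> nat"
  where "prime_seq j = enumerate {p. prime p} j"

definition prime_pow :: "(nat \<Rightarrow>\<^sub>0 int) \<Rightarrow> nat"
  where "prime_pow \<alpha> = (\<Prod>j\<in>Poly_Mapping.keys \<alpha>. prime_seq j ^ nat (Poly_Mapping.lookup \<alpha> j))"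

definition is_lift :: "ennreal \<Rightarrow> (nat \<Rightarrow> 'x) \<Rightarrow> ((nat \<Rightarrow> complex) \<Rightarrow> 'x::complex_banach) \<Rightarrow> bool"
  where "is_lift p a f \<longleftrightarrow>
    f \<in> hardy_torus p \<and> (\<forall>\<alpha>\<in>nonneg_exponents. fourier_coeff f \<alpha> = a (prime_pow \<alpha>))"

definition hardy_dirichlet :: "ennreal \<Rightarrow> (nat \<Rightarrow> 'x::complex_banach) set"
  where "hardy_dirichlet p = {a. a 0 = 0 \<and> (\<exists>f. is_lift p a f)}"

text \<open>The lift is unique up to equality almost everywhere, so its norm is unique.\<close>

definition hardy_dirichlet_norm :: "ennreal \<Rightarrow> (nat \<Rightarrow> 'x::complex_banach) \<Rightarrow> real"
  where "hardy_dirichlet_norm p a = (THE r. \<exists>f. is_lift p a f \<and> r = Lp_norm haar p f)"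

definition dirichlet_shift :: "real \<Rightarrow> (nat \<Rightarrow> 'x::complex_banach) \<Rightarrow> (nat \<Rightarrow> 'x)"
  where "dirichlet_shift \<epsilon> a n = (1 / real n powr \<epsilon>) *\<^sub>R a n"

definition hardy_dirichlet_plus :: "ennreal \<Rightarrow> (nat \<Rightarrow> 'x::complex_banach) set"
  where "hardy_dirichlet_plus p = {a. a 0 = 0 \<and>
    (\<forall>\<epsilon>>0. dirichlet_shift \<epsilon> a \<in> hardy_dirichlet p) \<and>
    bdd_above ((\<lambda>\<epsilon>. hardy_dirichlet_norm p (dirichlet_shift \<epsilon> a)) ` {0<..})}"

definition hardy_dirichlet_plus_norm :: "ennreal \<Rightarrow> (nat \<Rightarrow> 'x::complex_banach) \<Rightarrow> real"
  where "hardy_dirichlet_plus_norm p a =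
    (SUP \<epsilon>\<in>{0<..}. hardy_dirichlet_norm p (dirichlet_shift \<epsilon> a))"

text \<open>
  A Banach lattice of (classes of) complex functions is given by its elements, its norm and its
  positive cone. Functions at distance \<open>0\<close> represent the same element; a bounded
  linear operator cannot distinguish them (\<open>bounded_operator_cong\<close> below).
\<close>

record 'a function_lattice =
  elements :: "('a \<Rightarrow> complex) set"
  lattice_norm :: "('a \<Rightarrow> complex) \<Rightarrow> real"
  positives :: "('a \<Rightarrow> complex) set"

text \<open>
  Operators are total functions; the value \<open>0\<close> outside \<open>elements E\<close> is a
  normalization that makes equal operators equal as functions.
\<close>

definition bounded_operators :: "'a function_lattice \<Rightarrow> (('a \<Rightarrow> complex) \<Rightarrow> 'x::complex_banach) set"
  where "bounded_operators E = {T.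
    (\<forall>f\<in>elements E. \<forall>g\<in>elements E. T (\<lambda>x. f x + g x) = T f + T g) \<and>
    (\<forall>c. \<forall>f\<in>elements E. T (\<lambda>x. c * f x) = c *\<^sub>C T f) \<and>
    (\<exists>K. \<forall>f\<in>elements E. norm (T f) \<le> K * lattice_norm E f) \<and>
    (\<forall>f. f \<notin> elements E \<longrightarrow> T f = 0)}"

definition dual_ball :: "'a function_lattice \<Rightarrow> (('a \<Rightarrow> complex) \<Rightarrow> complex) set"
  where "dual_ball E = {\<xi> \<in> bounded_operators E. \<forall>f\<in>elements E. cmod (\<xi> f) \<le> lattice_norm E f}"

definition cas_bound :: "'a function_lattice \<Rightarrow> (('a \<Rightarrow> complex) \<Rightarrow> 'x::complex_banach) \<Rightarrow> real \<Rightarrow> bool"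
  where "cas_bound E T C \<longleftrightarrow>
    (\<forall>(n::nat) f. (\<forall>i<n. f i \<in> positives E) \<longrightarrow>
      (\<Sum>i<n. norm (T (f i))) \<le> C * (SUP \<xi>\<in>dual_ball E. \<Sum>i<n. cmod (\<xi> (f i))))"

definition cas_operators :: "'a function_lattice \<Rightarrow> (('a \<Rightarrow> complex) \<Rightarrow> 'x::complex_banach) set"
  where "cas_operators E = {T \<in> bounded_operators E. \<exists>C>0. cas_bound E T C}"

definition cas_norm :: "'a function_lattice \<Rightarrow> (('a \<Rightarrow> complex) \<Rightarrow> 'x::complex_banach) \<Rightarrow> real"
  where "cas_norm E T = Inf {C. C > 0 \<and> cas_bound E T C}"

definition torus_lattice :: "ennreal \<Rightarrow> (nat \<Rightarrow> complex) function_lattice"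
  where "torus_lattice q =
    (if q = \<infinity> then
       \<lparr>elements = {f. continuous_on torus f},
        lattice_norm = (\<lambda>f. SUP \<omega>\<in>torus. cmod (f \<omega>)),
        positives = {f. continuous_on torus f \<and> (\<forall>\<omega>\<in>torus. f \<omega> \<in> \<real>\<^sub>\<ge>\<^sub>0)}\<rparr>
     else
       \<lparr>elements = Lp_space haar q,
        lattice_norm = Lp_norm haar q,
        positives = {f \<in> Lp_space haar q. AE \<omega> in haar. f \<omega> \<in> \<real>\<^sub>\<ge>\<^sub>0}\<rparr>)"

definition cas_plus :: "ennreal \<Rightarrow> (((nat \<Rightarrow> complex) \<Rightarrow> complex) \<Rightarrow> 'x::complex_banach) set"
  where "cas_plus q =
    {T \<in> cas_operators (torus_lattice q). \<forall>\<alpha>. \<alpha> \<notin> nonneg_exponents \<longrightarrow> T (monomial (- \<alpha>)) = 0}"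

text \<open>Inverse to \<open>prime_pow\<close> on positive \<open>n\<close>: \<open>exponents_prime_pow\<close> and \<open>prime_pow_exponents\<close> below.\<close>

definition exponents :: "nat \<Rightarrow> (nat \<Rightarrow>\<^sub>0 int)"
  where "exponents n = Abs_poly_mapping (\<lambda>j. int (multiplicity (prime_seq j) n))"

definition bohr_transform ::
  "(((nat \<Rightarrow> complex) \<Rightarrow> complex) \<Rightarrow> 'x::complex_banach) \<Rightarrow> (nat \<Rightarrow> 'x)"
  where "bohr_transform T n = (if n = 0 then 0 else T (monomial (- exponents n)))"

lemma bounded_operator_cong:
  assumes T: "T \<in> bounded_operators E" and f: "f \<in> elements E" and g: "g \<in> elements E"
    and g': "(\<lambda>x. - 1 * g x) \<in> elements E" and d: "(\<lambda>x. f x + - 1 * g x) \<in> elements E"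
    and 0: "lattice_norm E (\<lambda>x. f x + - 1 * g x) = 0"
  shows "T f = T g"
proof -
  have add: "\<forall>f\<in>elements E. \<forall>g\<in>elements E. T (\<lambda>x. f x + g x) = T f + T g"
    and scale: "\<forall>c. \<forall>f\<in>elements E. T (\<lambda>x. c * f x) = c *\<^sub>C T f"
    and bound: "\<exists>K. \<forall>f\<in>elements E. norm (T f) \<le> K * lattice_norm E f"
    using T by (simp_all add: bounded_operators_def)
  obtain K where K: "\<forall>f\<in>elements E. norm (T f) \<le> K * lattice_norm E f"
    using bound ..
  have "norm (T (\<lambda>x. f x + - 1 * g x)) \<le> 0"
    using bspec[OF K d] 0 by simp
  moreover have "T (\<lambda>x. f x + - 1 * g x) = T f + T (\<lambda>x. - 1 * g x)"
    by (rule bspec[OF bspec[OF add f] g'])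
  moreover have "T (\<lambda>x. - 1 * g x) = (- 1) *\<^sub>C T g"
    by (rule bspec[OF spec[OF scale] g])
  moreover have "(- 1) *\<^sub>C T g = - T g"
    using scaleC_of_real[of "- 1" "T g"] by simp
  ultimately show ?thesis by simp
qed

lemma prime_prime_seq: "prime (prime_seq j)"
  using enumerate_in_set[OF primes_infinite, of j] by (simp add: prime_seq_def)

lemma prime_seq_neq_0: "prime_seq j \<noteq> 0"
  using prime_prime_seq[of j] by auto

lemma inj_prime_seq: "inj prime_seq"
  using inj_enumerate[OF primes_infinite] by (simp add: prime_seq_def[abs_def])

lemma range_prime_seq: "range prime_seq = {p. prime p}"
  using range_enumerate[OF primes_infinite] by (simp add: prime_seq_def[abs_def])

lemma lookup_exponents: "Poly_Mapping.lookup (exponents n) j = int (multiplicity (prime_seq j) n)"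
proof -
  have "finite {j. int (multiplicity (prime_seq j) n) \<noteq> 0}"
  proof (cases "n = 0")
    case False
    have "prime_seq ` {j. int (multiplicity (prime_seq j) n) \<noteq> 0} \<subseteq> {d. d dvd n}"
      using not_dvd_imp_multiplicity_0 by fastforce
    moreover have "finite {d. d dvd n}"
      using False by simp
    ultimately show ?thesis
      by (meson finite_imageD finite_subset inj_on_subset[OF inj_prime_seq subset_UNIV])
  qed simp
  then show ?thesis
    by (simp add: exponents_def)
qed

lemma exponents_nonneg: "exponents n \<in> nonneg_exponents"
  by (simp add: nonneg_exponents_def lookup_exponents)

lemma exponents_prime_pow:
  assumes "\<alpha> \<in> nonneg_exponents"
  shows "exponents (prime_pow \<alpha>) = \<alpha>"
proof (rule poly_mapping_eqI)
  fix j
  have "multiplicity (prime_seq j) (prime_pow \<alpha>)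
    = (\<Sum>i\<in>Poly_Mapping.keys \<alpha>. multiplicity (prime_seq j) (prime_seq i ^ nat (Poly_Mapping.lookup \<alpha> i)))"
    unfolding prime_pow_def
    by (rule prime_elem_multiplicity_prod_distrib)
      (use prime_prime_seq in \<open>auto simp: prime_seq_neq_0\<close>)
  also have "\<dots> = (\<Sum>i\<in>Poly_Mapping.keys \<alpha>. if i = j then nat (Poly_Mapping.lookup \<alpha> i) else 0)"
    using prime_prime_seq inj_prime_seq
    by (intro sum.cong) (auto simp: multiplicity_distinct_prime_power inj_eq)
  also have "\<dots> = nat (Poly_Mapping.lookup \<alpha> j)"
    by (simp add: in_keys_iff)
  finally show "Poly_Mapping.lookup (exponents (prime_pow \<alpha>)) j = Poly_Mapping.lookup \<alpha> j"
    using assms by (simp add: lookup_exponents nonneg_exponents_def)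
qed

lemma prime_pow_pos: "prime_pow \<alpha> > 0"
  unfolding prime_pow_def using prime_prime_seq by (auto intro!: prod_pos simp: prime_gt_0_nat)

lemma prime_pow_exponents:
  assumes "n > 0"
  shows "prime_pow (exponents n) = n"
proof (rule multiplicity_eq_nat)
  fix p :: nat
  assume "prime p"
  then obtain j where p: "p = prime_seq j"
    using range_prime_seq by blast
  show "multiplicity p (prime_pow (exponents n)) = multiplicity p n"
    using arg_cong[OF exponents_prime_pow[OF exponents_nonneg, of n], of "\<lambda>\<beta>. Poly_Mapping.lookup \<beta> j"]
    by (simp add: lookup_exponents p)
qed (use assms prime_pow_pos in auto)

lemma bohr_transform_prime_pow:
  "\<alpha> \<in> nonneg_exponents \<Longrightarrow> bohr_transform T (prime_pow \<alpha>) = T (monomial (- \<alpha>))"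
  using prime_pow_pos[of \<alpha>] by (simp add: bohr_transform_def exponents_prime_pow)

lemma measurable_cis_circle:
  "cis \<in> uniform_measure lborel {0..<2*pi} \<rightarrow>\<^sub>M restrict_space borel (sphere 0 1)"
proof (rule measurable_restrict_space2)
  have "cis \<in> borel_measurable borel"
    by (auto intro!: borel_measurable_continuous_onI continuous_intros)
  then show "cis \<in> borel_measurable (uniform_measure lborel {0..<2*pi})"
    by (simp cong: measurable_cong_sets)
qed auto

lemma prob_space_circle: "prob_space circle_measure"
  unfolding circle_measure_def
  by (rule prob_space.prob_space_distr[OF prob_space_uniform_measure measurable_cis_circle]) auto

lemma space_circle: "space circle_measure = sphere 0 1"
  by (simp add: circle_measure_def space_restrict_space)

lemma sets_circle: "sets circle_measure = sets (restrict_space borel (sphere 0 1))"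
  by (simp add: circle_measure_def)

lemma prob_space_haar: "prob_space haar"
  unfolding haar_def by (rule prob_space_PiM) (rule prob_space_circle)

lemma space_haar: "space haar = torus"
  by (auto simp: haar_def space_PiM space_circle torus_def PiE_UNIV_domain)

lemma emeasure_lborel_translate:
  fixes a :: real
  assumes "B \<in> sets borel"
  shows "emeasure lborel ((\<lambda>t. a + t) -` B) = emeasure lborel B"
proof -
  have "emeasure lborel B = emeasure (distr lborel borel ((+) a)) B"
    by (simp only: lborel_distr_plus)
  also have "\<dots> = emeasure lborel ((\<lambda>t. a + t) -` B)"
    using assms by (simp add: emeasure_distr)
  finally show ?thesis ..
qed

lemma emeasure_lborel_periodic:
  fixes P :: "real set"
  assumes P: "P \<in> sets borel" and per: "\<And>t. 2*pi + t \<in> P \<longleftrightarrow> t \<in> P"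
    and a: "0 \<le> a" "a < 2*pi"
  shows "emeasure lborel ({0..<2*pi} \<inter> {t. a + t \<in> P}) = emeasure lborel ({0..<2*pi} \<inter> P)"
proof -
  have "{0..<2*pi} \<inter> {t. a + t \<in> P} = (\<lambda>t. a + t) -` (P \<inter> {a..<a + 2*pi})"
    by auto
  then have "emeasure lborel ({0..<2*pi} \<inter> {t. a + t \<in> P}) = emeasure lborel (P \<inter> {a..<a + 2*pi})"
    using P by (simp only:) (rule emeasure_lborel_translate, auto)
  also have "P \<inter> {a..<a + 2*pi} = (P \<inter> {a..<2*pi}) \<union> (P \<inter> {2*pi..<2*pi + a})"
    using a by auto
  also have "emeasure lborel \<dots> = emeasure lborel (P \<inter> {a..<2*pi}) + emeasure lborel (P \<inter> {2*pi..<2*pi + a})"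
    using P by (intro plus_emeasure[symmetric]) auto
  also have "emeasure lborel (P \<inter> {2*pi..<2*pi + a}) =
    emeasure lborel ((\<lambda>t. 2*pi + t) -` (P \<inter> {2*pi..<2*pi + a}))"
    using P by (intro emeasure_lborel_translate[symmetric]) auto
  also have "(\<lambda>t. 2*pi + t) -` (P \<inter> {2*pi..<2*pi + a}) = P \<inter> {0..<a}"
    using per by auto
  also have "emeasure lborel (P \<inter> {a..<2*pi}) + emeasure lborel (P \<inter> {0..<a}) =
    emeasure lborel ((P \<inter> {a..<2*pi}) \<union> (P \<inter> {0..<a}))"
    using P by (intro plus_emeasure) auto
  also have "(P \<inter> {a..<2*pi}) \<union> (P \<inter> {0..<a}) = {0..<2*pi} \<inter> P"
    using a by auto
  finally show ?thesis .
qed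

lemma measurable_mult_circle:
  assumes "cmod \<eta> = 1"
  shows "(\<lambda>z. \<eta> * z) \<in> circle_measure \<rightarrow>\<^sub>M circle_measure"
proof -
  have "(\<lambda>z. \<eta> * z) \<in> restrict_space borel (sphere 0 1) \<rightarrow>\<^sub>M restrict_space borel (sphere 0 1)"
    using assms
    by (intro measurable_restrict_space2 measurable_restrict_space1)
      (auto simp: space_restrict_space norm_mult)
  then show ?thesis
    by (simp add: sets_circle cong: measurable_cong_sets)
qed

lemma circle_rotate:
  assumes \<eta>: "cmod \<eta> = 1"
  shows "distr circle_measure circle_measure (\<lambda>z. \<eta> * z) = circle_measure"
proof (rule measure_eqI)
  fix A
  assume "A \<in> sets (distr circle_measure circle_measure (\<lambda>z. \<eta> * z))"
  then have A: "A \<in> sets (restrict_space borel (sphere 0 1))"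
    by (simp add: sets_circle)
  then have A': "A \<in> sets borel" and sub: "A \<subseteq> sphere 0 1"
    by (auto simp: sets_restrict_space_iff)
  have cis: "cis \<in> lborel \<rightarrow>\<^sub>M borel"
    by (auto intro!: borel_measurable_continuous_onI continuous_intros)
  define P where "P = {t. cis t \<in> A}"
  have P: "P \<in> sets borel"
    using measurable_sets[OF cis A'] by (simp add: P_def vimage_def)
  have circle: "emeasure circle_measure B = emeasure lborel ({0..<2*pi} \<inter> {t. cis t \<in> B}) / ennreal (2*pi)"
    if B: "B \<in> sets circle_measure" for B
  proof -
    have "B \<in> sets borel"
      using B by (auto simp: sets_circle sets_restrict_space_iff)
    then have "{t. cis t \<in> B} \<in> sets borel"
      using measurable_sets[OF cis] by (simp add: vimage_def)
    then show ?thesis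
      using B emeasure_distr[OF measurable_cis_circle, of B]
      by (simp add: circle_measure_def vimage_def)
  qed
  obtain a where a: "0 \<le> a" "a < 2*pi" "\<eta> = cis a"
    using cis_Arg_unique \<eta>
    by (metis Arg2pi_ge_0 Arg2pi_lt_2pi Arg2pi_eq cis_conv_exp mult.left_neutral of_real_1)
  have pre: "(\<lambda>z. \<eta> * z) -` A \<inter> space circle_measure \<in> sets circle_measure"
    using measurable_sets[OF measurable_mult_circle[OF \<eta>]] A by (simp add: sets_circle)
  have "emeasure (distr circle_measure circle_measure (\<lambda>z. \<eta> * z)) A
      = emeasure circle_measure ((\<lambda>z. \<eta> * z) -` A \<inter> space circle_measure)"
    using A by (intro emeasure_distr measurable_mult_circle \<eta>) (simp add: sets_circle)
  also have "\<dots> = emeasure lborel ({0..<2*pi} \<inter> {t. a + t \<in> P}) / ennreal (2*pi)"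
    by (subst circle[OF pre]) (simp add: space_circle P_def a(3) cis_mult)
  also have "\<dots> = emeasure lborel ({0..<2*pi} \<inter> P) / ennreal (2*pi)"
    using a P by (subst emeasure_lborel_periodic) (auto simp: P_def cis_mult[symmetric])
  also have "\<dots> = emeasure circle_measure A"
    using A by (simp add: circle sets_circle P_def)
  finally show "emeasure (distr circle_measure circle_measure (\<lambda>z. \<eta> * z)) A = emeasure circle_measure A" .
qed simp

lemma haar_rotate:
  assumes "\<eta> \<in> torus"
  shows "distr haar haar (\<lambda>\<omega> j. \<eta> j * \<omega> j) = haar"
proof -
  have \<eta>: "cmod (\<eta> j) = 1" for j
    using assms by (simp add: torus_def)
  interpret C: prob_space "circle_measure"
    by (rule prob_space_circle)
  interpret product_prob_space "\<lambda>_::nat. circle_measure" UNIV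
    by unfold_locales
  have meas: "(\<lambda>\<omega> j. \<eta> j * \<omega> j) \<in> haar \<rightarrow>\<^sub>M haar"
    unfolding haar_def
  proof (rule measurable_PiM_single')
    fix i :: nat
    show "(\<lambda>\<omega>. \<eta> i * \<omega> i) \<in> Pi\<^sub>M UNIV (\<lambda>_. circle_measure) \<rightarrow>\<^sub>M circle_measure"
      by (rule measurable_compose[where f = "\<lambda>\<omega>. \<omega> i", OF _ measurable_mult_circle[OF \<eta>]])
        (rule measurable_component_singleton, simp)
  qed (auto simp: space_PiM space_circle norm_mult \<eta> PiE_UNIV_domain)
  show ?thesis
    unfolding haar_def
  proof (rule PiM_eq)
    fix J :: "nat set" and F
    assume J: "finite J" and F: "\<And>j. j \<in> J \<Longrightarrow> F j \<in> sets circle_measure"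
    let ?G = "\<lambda>j. (\<lambda>z. \<eta> j * z) -` F j \<inter> space circle_measure"
    let ?E = "prod_emb UNIV (\<lambda>_. circle_measure) J"
    have G: "?G j \<in> sets circle_measure" if "j \<in> J" for j
      using that by (intro measurable_sets[OF measurable_mult_circle[OF \<eta>]] F)
    have "emeasure (distr haar haar (\<lambda>\<omega> j. \<eta> j * \<omega> j)) (?E (Pi\<^sub>E J F))
      = emeasure haar ((\<lambda>\<omega> j. \<eta> j * \<omega> j) -` ?E (Pi\<^sub>E J F) \<inter> space haar)"
      using J F by (intro emeasure_distr meas) (auto simp: haar_def intro!: sets_PiM_I)
    also have "(\<lambda>\<omega> j. \<eta> j * \<omega> j) -` ?E (Pi\<^sub>E J F) \<inter> space haar = ?E (Pi\<^sub>E J ?G)"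
      by (auto simp: prod_emb_def haar_def space_PiM PiE_iff space_circle norm_mult \<eta>)
    also have "emeasure haar \<dots> = (\<Prod>j\<in>J. emeasure circle_measure (?G j))"
      unfolding haar_def using J G by (intro emeasure_PiM_emb) auto
    also have "\<dots> = (\<Prod>j\<in>J. emeasure circle_measure (F j))"
    proof (rule prod.cong[OF refl])
      fix j
      assume "j \<in> J"
      then have "emeasure circle_measure (?G j)
        = emeasure (distr circle_measure circle_measure (\<lambda>z. \<eta> j * z)) (F j)"
        by (intro emeasure_distr[symmetric] measurable_mult_circle \<eta> F)
      then show "emeasure circle_measure (?G j) = emeasure circle_measure (F j)"
        by (simp add: circle_rotate[OF \<eta>])
    qed
    finally show "emeasure (distr (Pi\<^sub>M UNIV (\<lambda>_. circle_measure)) (Pi\<^sub>M UNIV (\<lambda>_. circle_measure))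
        (\<lambda>\<omega> j. \<eta> j * \<omega> j)) (?E (Pi\<^sub>E J F)) = (\<Prod>j\<in>J. emeasure circle_measure (F j))"
      by (simp add: haar_def)
  qed simp
qed

end

theory Submission
  imports Defs
begin

text \<open>
  Two passages, from an operator to its Dirichlet series and back, each preserve the norm bound. They are
  inverse to each other because the trigonometric polynomials are dense in the lattices
  (\<open>trig_polynomial_dense_lattice\<close>) and because Fourier coefficients determine a function
  (\<open>fourier_coeff_unique\<close>).

  From \<open>T\<close> to \<open>D\<close>: let \<open>C\<close> be a summing constant of \<open>T\<close>. For a trigonometric polynomial
  \<open>K \<ge> 0\<close> with mean \<open>c\<^sub>0\<close>, the function \<open>\<omega> \<mapsto> T (\<eta> \<mapsto> K (\<omega> / \<eta>))\<close> is a trigonometric polynomial with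
  values in \<open>X\<close>; its coefficient at \<open>\<alpha>\<close> is that of \<open>K\<close> times \<open>T (\<omega>\<^sup>-\<^sup>\<alpha>)\<close>. Its norm in \<open>L\<^sub>p\<close> is at most
  \<open>C c\<^sub>0\<close> (\<open>Lp_le_operator_trig_kernel\<close>): on a finite set of rotations over which \<open>K\<close> averages to \<open>c\<^sub>0\<close>
  this is the duality of \<open>l\<^sub>p\<close> and \<open>l\<^sub>q\<close> norms of finite sequences, with \<open>q\<close> conjugate to \<open>p\<close>,
  and the Haar measure is invariant under these rotations.
  The product over \<open>j\<close> of the Poisson kernels with radii \<open>\<pp>\<^sub>j\<^sup>-\<^sup>\<epsilon>\<close>, which would give \<open>D\<^sub>\<epsilon>\<close>, is for \<open>\<epsilon> \<le> 1/2\<close> a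
  singular measure and not a function on which \<open>T\<close> can be tested. However, \<open>T\<close> annihilates the nonanalytic
  characters, and only finitely many analytic ones have \<open>log \<pp>\<^sup>\<alpha> < M\<close>. Hence an even function \<open>c\<close> of positive type with support
  in \<open>[-M, M]\<close> yields, through kernels of Fejer type on large boxes of exponents, the Dirichlet polynomial
  \<open>\<Sum>\<^sub>n c (log n) a\<^sub>n n\<^sup>-\<^sup>s\<close> with norm at most \<open>C c(0)\<close> (\<open>Lp_le_dirichlet_lift\<close>). By convexity
  \<open>exp (- \<epsilon> \<bar>u\<bar>)\<close> is a mixture of triangle functions, that is, a sum of such functions \<open>c\<close> whose values at \<open>0\<close>
  add up to \<open>1\<close>. So \<open>D\<^sub>\<epsilon>\<close> is the sum of an absolutely convergent series and has norm at most \<open>C\<close>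
  (\<open>operator_shift_lift\<close>).

  From \<open>D\<close> to \<open>T\<close>: if \<open>f\<^sub>\<epsilon>\<close> is the lift of \<open>D\<^sub>\<epsilon>\<close>, then \<open>h \<mapsto> \<integral> h f\<^sub>\<epsilon>\<close> has summing constant \<open>\<parallel>f\<^sub>\<epsilon>\<parallel>\<^sub>p\<close> by
  Hoelder's inequality (\<open>pairing_operator_cas_bound\<close>). These operators are uniformly bounded and converge on the
  characters as \<open>\<epsilon>\<close> tends to \<open>0\<close>; the limit is the required operator (\<open>hardy_dirichlet_plus_operator\<close>).
\<close>

section \<open>Complex Banach spaces and strong measurability\<close>

lemma bounded_linear_scaleC_right: "bounded_linear (\<lambda>x::'x::complex_banach. c *\<^sub>C x)"
proof (rule bounded_linear_intro[where K = "cmod c"])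
  fix r :: real and x :: 'x
  show "c *\<^sub>C (r *\<^sub>R x) = r *\<^sub>R (c *\<^sub>C x)"
    by (simp add: scaleC_of_real[symmetric] scaleC_scaleC mult.commute)
qed (simp_all add: scaleC_add_right norm_scaleC)

lemma bounded_linear_scaleC_left: "bounded_linear (\<lambda>c. c *\<^sub>C (x::'x::complex_banach))"
proof (rule bounded_linear_intro[where K = "norm x"])
  fix r :: real and c
  show "(r *\<^sub>R c) *\<^sub>C x = r *\<^sub>R (c *\<^sub>C x)"
    by (simp only: scaleC_of_real[symmetric, of r "c *\<^sub>C x"] scaleC_scaleC scaleR_conv_of_real)
qed (simp_all add: scaleC_add_left norm_scaleC)

lemmas scaleC_zero_right [simp] = linear_0[OF bounded_linear.linear, OF bounded_linear_scaleC_right]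
lemmas scaleC_zero_left [simp] = linear_0[OF bounded_linear.linear, OF bounded_linear_scaleC_left]
lemmas scaleC_sum_right = linear_sum[OF bounded_linear.linear, OF bounded_linear_scaleC_right]
lemmas scaleC_sum_left = linear_sum[OF bounded_linear.linear, OF bounded_linear_scaleC_left]
lemmas scaleC_diff_right = linear_diff[OF bounded_linear.linear, OF bounded_linear_scaleC_right]

lemma scaleC_one [simp]: "1 *\<^sub>C (x::'x::complex_banach) = x"
  using scaleC_of_real[of 1 x] by simp

lemma scaleC_minus_one: "(- 1) *\<^sub>C (x::'x::complex_banach) = - x"
  using scaleC_of_real[of "- 1" x] by simp

lemma tendsto_scaleC:
  fixes g :: "'a \<Rightarrow> 'x::complex_banach"
  assumes "(c \<longlongrightarrow> a) F" and "(g \<longlongrightarrow> b) F"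
  shows "((\<lambda>i. c i *\<^sub>C g i) \<longlongrightarrow> a *\<^sub>C b) F"
proof (rule Lim_transform)
  have "((\<lambda>i. cmod (c i - a) * norm (g i) ) \<longlongrightarrow> 0 * norm b) F"
    using assms by (intro tendsto_mult tendsto_norm tendsto_norm_zero) (simp_all add: LIM_zero)
  moreover have "cmod (c i - a) * norm (g i) = norm (c i *\<^sub>C g i - a *\<^sub>C g i)" for i
  proof -
    have "c i *\<^sub>C g i - a *\<^sub>C g i = (c i - a) *\<^sub>C g i"
      by (rule linear_diff[OF bounded_linear.linear, OF bounded_linear_scaleC_left, symmetric])
    then show ?thesis by (simp add: norm_scaleC)
  qed
  ultimately have "((\<lambda>i. norm (c i *\<^sub>C g i - a *\<^sub>C g i)) \<longlongrightarrow> 0) F"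
    by simp
  then show "((\<lambda>i. c i *\<^sub>C g i - a *\<^sub>C g i) \<longlongrightarrow> 0) F"
    by (rule tendsto_norm_zero_cancel)
  show "((\<lambda>i. a *\<^sub>C g i) \<longlongrightarrow> a *\<^sub>C b) F"
    by (rule bounded_linear.tendsto[OF bounded_linear_scaleC_right assms(2)])
qed

lemma strongly_measurable_compose2:
  assumes "strongly_measurable M f" "strongly_measurable M g"
    and p: "\<And>F G a b. F \<longlonglongrightarrow> a \<Longrightarrow> G \<longlonglongrightarrow> b \<Longrightarrow> (\<lambda>i. p (F i) (G i)) \<longlonglongrightarrow> p a b"
  shows "strongly_measurable M (\<lambda>x. p (f x) (g x))"
proof -
  obtain s t where "\<forall>i. simple_function M (s i)" "\<forall>x\<in>space M. (\<lambda>i. s i x) \<longlonglongrightarrow> f x"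
    "\<forall>i. simple_function M (t i)" "\<forall>x\<in>space M. (\<lambda>i. t i x) \<longlonglongrightarrow> g x"
    using assms by (auto simp: strongly_measurable_def)
  then show ?thesis
    unfolding strongly_measurable_def
    by (intro exI[of _ "\<lambda>i x. p (s i x) (t i x)"] conjI allI ballI simple_function_compose2[where h = p] p)
      auto
qed

lemma strongly_measurable_const: "strongly_measurable M (\<lambda>x. c)"
  unfolding strongly_measurable_def by (intro exI[of _ "\<lambda>_ _. c"]) auto

lemma strongly_measurable_add:
  "strongly_measurable M f \<Longrightarrow> strongly_measurable M g \<Longrightarrow> strongly_measurable M (\<lambda>x. f x + g x)"
  by (rule strongly_measurable_compose2) (auto intro: tendsto_add)

lemma strongly_measurable_diff:
  "strongly_measurable M f \<Longrightarrow> strongly_measurable M g \<Longrightarrow> strongly_measurable M (\<lambda>x. f x - g x)"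
  by (rule strongly_measurable_compose2) (auto intro: tendsto_diff)

lemma strongly_measurable_scaleC:
  fixes f :: "'a \<Rightarrow> 'x::complex_banach"
  shows "strongly_measurable M c \<Longrightarrow> strongly_measurable M f \<Longrightarrow> strongly_measurable M (\<lambda>x. c x *\<^sub>C f x)"
  by (rule strongly_measurable_compose2) (auto intro: tendsto_scaleC)

lemma strongly_measurable_sum:
  "(\<And>i. i \<in> I \<Longrightarrow> strongly_measurable M (f i)) \<Longrightarrow> strongly_measurable M (\<lambda>x. \<Sum>i\<in>I. f i x)"
  by (induction I rule: infinite_finite_induct)
    (auto intro: strongly_measurable_add strongly_measurable_const)

lemma strongly_measurable_norm:
  assumes "strongly_measurable M f"
  shows "(\<lambda>x. norm (f x)) \<in> borel_measurable M"
proof -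
  obtain s where s: "\<And>i. simple_function M (s i)" "\<And>x. x \<in> space M \<Longrightarrow> (\<lambda>i. s i x) \<longlonglongrightarrow> f x"
    using assms by (auto simp: strongly_measurable_def)
  show ?thesis
  proof (rule borel_measurable_LIMSEQ_real)
    show "(\<lambda>x. norm (s i x)) \<in> borel_measurable M" for i
      by (rule borel_measurable_simple_function[OF simple_function_compose1[OF s(1)]])
  qed (rule tendsto_norm[OF s(2)])
qed

lemma strongly_measurable_iff_borel_measurable:
  fixes f :: "'a \<Rightarrow> 'b::{real_normed_vector, second_countable_topology}"
  shows "strongly_measurable M f \<longleftrightarrow> f \<in> borel_measurable M"
proof
  assume "strongly_measurable M f"
  then obtain s where s: "\<And>i. simple_function M (s i)" "\<And>x. x \<in> space M \<Longrightarrow> (\<lambda>i. s i x) \<longlonglongrightarrow> f x"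
    by (auto simp: strongly_measurable_def)
  then show "f \<in> borel_measurable M"
    by (rule borel_measurable_LIMSEQ_metric[OF borel_measurable_simple_function])
next
  assume "f \<in> borel_measurable M"
  from borel_measurable_implies_sequence_metric[OF this, of 0]
  show "strongly_measurable M f"
    by (auto simp: strongly_measurable_def)
qed

text \<open>The values of all the approximating simple functions form a countable set whose closure
  contains the range of the limit, and the nearest of its first \<open>k\<close> elements is a simple function.\<close>

lemma strongly_measurable_LIMSEQ:
  fixes f :: "'a \<Rightarrow> 'b::real_normed_vector"
  assumes F: "\<And>n. strongly_measurable M (F n)"
    and lim: "\<And>x. x \<in> space M \<Longrightarrow> (\<lambda>n. F n x) \<longlonglongrightarrow> f x"
  shows "strongly_measurable M f"
proof -
  obtain s where s: "\<And>n i. simple_function M (s n i)"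
      "\<And>n x. x \<in> space M \<Longrightarrow> (\<lambda>i. s n i x) \<longlonglongrightarrow> F n x"
    using F unfolding strongly_measurable_def by metis
  define D where "D = insert 0 (\<Union>n i. s n i ` space M)"
  have "countable D"
    unfolding D_def using simple_functionD(1)[OF s(1)]
    by (intro countable_insert countable_UN) (auto intro: countable_finite)
  define d where "d = from_nat_into D"
  have range_d: "range d = D"
    unfolding d_def using \<open>countable D\<close> by (intro range_from_nat_into) (auto simp: D_def)
  have meas: "(\<lambda>x. norm (f x - d j)) \<in> borel_measurable M" for j
  proof (rule borel_measurable_LIMSEQ_real)
    show "(\<lambda>x. norm (F n x - d j)) \<in> borel_measurable M" for n
      by (intro strongly_measurable_norm strongly_measurable_diff F strongly_measurable_const)
    show "x \<in> space M \<Longrightarrow> (\<lambda>n. norm (F n x - d j)) \<longlonglongrightarrow> norm (f x - d j)" for x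
      by (intro tendsto_intros lim)
  qed
  define near where "near k x j \<longleftrightarrow> j \<le> k \<and> (\<forall>l\<le>k. norm (f x - d j) \<le> norm (f x - d l))" for k x j
  define idx where "idx k x = (LEAST j. near k x j)" for k x
  have near: "near k x (idx k x)" for k x
  proof -
    have "\<exists>j. is_arg_min (\<lambda>j. norm (f x - d j)) (\<lambda>j. j \<in> {..k}) j"
      by (rule ex_is_arg_min_if_finite) auto
    then have "\<exists>j. near k x j"
      by (auto simp: is_arg_min_linorder near_def)
    then show ?thesis
      unfolding idx_def by (rule LeastI_ex)
  qed
  have "simple_function M (idx k)" for k
    unfolding simple_function_def
  proof (intro conjI ballI)
    show "finite (idx k ` space M)"
    proof (rule finite_subset)
      show "idx k ` space M \<subseteq> {..k}"
        using near[of k, unfolded near_def] by blast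
    qed simp
    fix j
    note [measurable] = meas
    have [measurable]: "Measurable.pred M (\<lambda>x. near k x j)" for j
      unfolding near_def by measurable
    have "idx k \<in> measurable M (count_space UNIV)"
      unfolding idx_def by measurable
    then show "idx k -` {j} \<inter> space M \<in> sets M"
      by (rule measurable_sets) simp
  qed
  then have "simple_function M (\<lambda>x. d (idx k x))" for k
    by (rule simple_function_compose1)
  moreover have "(\<lambda>k. d (idx k x)) \<longlonglongrightarrow> f x" if x: "x \<in> space M" for x
  proof (rule metric_LIMSEQ_I)
    fix e :: real assume e: "e > 0"
    obtain n where n: "dist (F n x) (f x) < e / 2"
      using metric_LIMSEQ_D[OF lim[OF x], of "e/2"] e by auto
    obtain i where "dist (s n i x) (F n x) < e / 2"
      using metric_LIMSEQ_D[OF s(2)[OF x, of n], of "e/2"] e by auto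
    with n have i: "dist (s n i x) (f x) < e"
      by (metis dist_triangle_half_l dist_commute)
    have "s n i x \<in> D" using x by (auto simp: D_def)
    then obtain j where j: "d j = s n i x"
      using range_d by (metis rangeE)
    show "\<exists>no. \<forall>k\<ge>no. dist (d (idx k x)) (f x) < e"
    proof (intro exI allI impI)
      fix k assume "j \<le> k"
      then have "norm (f x - d (idx k x)) \<le> norm (f x - d j)"
        using near[of k x] by (simp add: near_def)
      then show "dist (d (idx k x)) (f x) < e"
        using i by (simp add: j dist_norm norm_minus_commute)
    qed
  qed
  ultimately show ?thesis
    unfolding strongly_measurable_def by (intro exI[of _ "\<lambda>k x. d (idx k x)"]) auto
qed

text \<open>The approximating functions are set to \<open>0\<close> where they exceed twice the norm of the limit, which preserves
  convergence at each point.\<close>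

lemma strongly_measurable_dominated_simple:
  assumes "strongly_measurable M f"
  obtains s where "\<And>i::nat. simple_function M (s i)"
    "\<And>x. x \<in> space M \<Longrightarrow> (\<lambda>i. s i x) \<longlonglongrightarrow> f x"
    "\<And>i x. x \<in> space M \<Longrightarrow> norm (s i x) \<le> 2 * norm (f x)"
proof -
  obtain t where t: "\<And>i. simple_function M (t i)" "\<And>x. x \<in> space M \<Longrightarrow> (\<lambda>i. t i x) \<longlonglongrightarrow> f x"
    using assms by (auto simp: strongly_measurable_def)
  define s where "s i x = (if norm (t i x) \<le> 2 * norm (f x) then t i x else 0)" for i x
  have [measurable]: "(\<lambda>x. norm (t i x)) \<in> borel_measurable M" for i
    by (rule borel_measurable_simple_function[OF simple_function_compose1[OF t(1)]])
  note [measurable] = strongly_measurable_norm[OF assms]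
  have "simple_function M (s i)" for i
    unfolding s_def by (intro simple_function_If t simple_function_const) measurable
  moreover have "(\<lambda>i. s i x) \<longlonglongrightarrow> f x" if x: "x \<in> space M" for x
  proof (cases "f x = 0")
    case True
    then have "s i x = 0" for i by (simp add: s_def)
    then show ?thesis using True by simp
  next
    case False
    then have "norm (f x) < 2 * norm (f x)" by simp
    with tendsto_norm[OF t(2)[OF x]] have "\<forall>\<^sub>F i in sequentially. norm (t i x) < 2 * norm (f x)"
      by (rule order_tendstoD)
    then have "\<forall>\<^sub>F i in sequentially. t i x = s i x"
      by eventually_elim (simp add: s_def)
    then show ?thesis
      using t(2)[OF x] by (simp add: tendsto_cong)
  qed
  moreover have "norm (s i x) \<le> 2 * norm (f x)" for i x
    by (simp add: s_def)
  ultimately show ?thesis using that by blast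
qed

section \<open>The strong integral\<close>

definition strongly_integrable :: "'a measure \<Rightarrow> ('a \<Rightarrow> 'b::real_normed_vector) \<Rightarrow> bool"
  where "strongly_integrable M f \<longleftrightarrow> strongly_measurable M f \<and> (\<integral>\<^sup>+x. ennreal (norm (f x)) \<partial>M) < \<infinity>"

lemma strongly_integrableI:
  assumes "strongly_measurable M f" and "(\<integral>\<^sup>+x. ennreal (norm (f x)) \<partial>M) \<le> ennreal C"
  shows "strongly_integrable M f"
  using assms le_less_trans[OF assms(2) ennreal_less_top] by (simp add: strongly_integrable_def)

lemma norm_simple_bochner_integral_le:
  assumes s: "Bochner_Integration.simple_bochner_integrable M s"
  shows "ennreal (norm (Bochner_Integration.simple_bochner_integral M s)) \<le> (\<integral>\<^sup>+x. ennreal (norm (s x)) \<partial>M)"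
proof -
  have "Bochner_Integration.simple_bochner_integrable M (\<lambda>x. norm (s x))"
    using simple_bochner_integrable_compose2[of "\<lambda>x y. norm x" M s s] s by simp
  then show ?thesis
    using simple_bochner_integral_norm_bound[OF s]
    by (subst simple_bochner_integral_eq_nn_integral[symmetric]) (auto intro!: ennreal_leI)
qed

lemma simple_bochner_integrable_strongly_measurable:
  "Bochner_Integration.simple_bochner_integrable M s \<Longrightarrow> strongly_measurable M s"
  by (auto simp: strongly_measurable_def elim!: simple_bochner_integrable.cases intro!: exI[of _ "\<lambda>_. s"])

lemma nn_integral_norm_triangle:
  assumes "strongly_measurable M f" "strongly_measurable M g"
    and "\<And>x. x \<in> space M \<Longrightarrow> norm (h x) \<le> norm (f x) + norm (g x)"
  shows "(\<integral>\<^sup>+x. ennreal (norm (h x)) \<partial>M)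
    \<le> (\<integral>\<^sup>+x. ennreal (norm (f x)) \<partial>M) + (\<integral>\<^sup>+x. ennreal (norm (g x)) \<partial>M)"
proof -
  have "(\<integral>\<^sup>+x. ennreal (norm (h x)) \<partial>M) \<le> (\<integral>\<^sup>+x. ennreal (norm (f x)) + ennreal (norm (g x)) \<partial>M)"
    using assms(3) by (intro nn_integral_mono) (simp flip: ennreal_plus)
  also have "\<dots> = (\<integral>\<^sup>+x. ennreal (norm (f x)) \<partial>M) + (\<integral>\<^sup>+x. ennreal (norm (g x)) \<partial>M)"
    using assms(1,2)[THEN strongly_measurable_norm] by (intro nn_integral_add) auto
  finally show ?thesis .
qed

lemma has_strong_integral_norm_le:
  assumes "has_strong_integral M f y"
  shows "ennreal (norm y) \<le> (\<integral>\<^sup>+x. ennreal (norm (f x)) \<partial>M)"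
proof -
  obtain s where f: "strongly_measurable M f"
    and s: "\<And>i. Bochner_Integration.simple_bochner_integrable M (s i)"
      "(\<lambda>i. \<integral>\<^sup>+x. ennreal (norm (f x - s i x)) \<partial>M) \<longlonglongrightarrow> 0"
      "(\<lambda>i. Bochner_Integration.simple_bochner_integral M (s i)) \<longlonglongrightarrow> y"
    using assms by (auto simp: has_strong_integral_def)
  let ?I = "\<lambda>f. \<integral>\<^sup>+x. ennreal (norm (f x)) \<partial>M"
  have "ennreal (norm (Bochner_Integration.simple_bochner_integral M (s i))) \<le> ?I f + ?I (\<lambda>x. f x - s i x)" for i
  proof -
    have "?I (s i) \<le> ?I f + ?I (\<lambda>x. f x - s i x)"
    proof (rule nn_integral_norm_triangle[OF f])
      show "strongly_measurable M (\<lambda>x. f x - s i x)"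
        by (rule strongly_measurable_diff[OF f simple_bochner_integrable_strongly_measurable[OF s(1)]])
      show "norm (s i x) \<le> norm (f x) + norm (f x - s i x)" for x
        using norm_triangle_sub[of "s i x" "f x"] by (simp add: norm_minus_commute)
    qed
    then show ?thesis by (rule order_trans[OF norm_simple_bochner_integral_le[OF s(1)]])
  qed
  moreover have "(\<lambda>i. ennreal (norm (Bochner_Integration.simple_bochner_integral M (s i)))) \<longlonglongrightarrow> ennreal (norm y)"
    by (intro tendsto_ennrealI tendsto_norm s)
  moreover have "(\<lambda>i. ?I f + ?I (\<lambda>x. f x - s i x)) \<longlonglongrightarrow> ?I f + 0"
    by (intro tendsto_add tendsto_const s)
  ultimately show ?thesis
    by (metis (no_types, lifting) LIMSEQ_le add.right_neutral)
qed

lemma has_strong_integral_add: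
  assumes "has_strong_integral M f y" "has_strong_integral M g z"
  shows "has_strong_integral M (\<lambda>x. f x + g x) (y + z)"
proof -
  obtain s t where f: "strongly_measurable M f" and g: "strongly_measurable M g"
    and s: "\<And>i. Bochner_Integration.simple_bochner_integrable M (s i)"
      "(\<lambda>i. \<integral>\<^sup>+x. ennreal (norm (f x - s i x)) \<partial>M) \<longlonglongrightarrow> 0"
      "(\<lambda>i. Bochner_Integration.simple_bochner_integral M (s i)) \<longlonglongrightarrow> y"
    and t: "\<And>i. Bochner_Integration.simple_bochner_integrable M (t i)"
      "(\<lambda>i. \<integral>\<^sup>+x. ennreal (norm (g x - t i x)) \<partial>M) \<longlonglongrightarrow> 0"
      "(\<lambda>i. Bochner_Integration.simple_bochner_integral M (t i)) \<longlonglongrightarrow> z"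
    using assms by (auto simp: has_strong_integral_def)
  let ?J = "\<lambda>i. \<integral>\<^sup>+x. ennreal (norm (f x + g x - (s i x + t i x))) \<partial>M"
  have "?J \<longlonglongrightarrow> 0"
  proof (rule tendsto_sandwich[OF _ _ tendsto_const])
    show "(\<lambda>i. (\<integral>\<^sup>+x. ennreal (norm (f x - s i x)) \<partial>M) + (\<integral>\<^sup>+x. ennreal (norm (g x - t i x)) \<partial>M)) \<longlonglongrightarrow> 0"
      using tendsto_add[OF s(2) t(2)] by simp
    show "\<forall>\<^sub>F i in sequentially. ?J i
        \<le> (\<integral>\<^sup>+x. ennreal (norm (f x - s i x)) \<partial>M) + (\<integral>\<^sup>+x. ennreal (norm (g x - t i x)) \<partial>M)"
      using s(1) t(1)
      by (intro always_eventually allI nn_integral_norm_triangle strongly_measurable_diff f g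
          simple_bochner_integrable_strongly_measurable) (auto intro: norm_diff_triangle_ineq)
  qed simp
  moreover have "(\<lambda>i. Bochner_Integration.simple_bochner_integral M (\<lambda>x. s i x + t i x)) \<longlonglongrightarrow> y + z"
    using tendsto_add[OF s(3) t(3)] s(1) t(1) by (simp add: simple_bochner_integral_add)
  ultimately show ?thesis
    unfolding has_strong_integral_def using s(1) t(1)
    by (intro conjI strongly_measurable_add f g exI[of _ "\<lambda>i x. s i x + t i x"])
      (auto intro: simple_bochner_integrable_compose2)
qed

text \<open>Both \<open>has_strong_integral\<close> and \<open>has_bochner_integral\<close> provide approximating simple functions, and the image
  under \<open>L\<close> of these is all that a strong integral of the composition needs. The second case gives vector-valued integrals from
  scalar ones.\<close>

lemma has_strong_integral_linear_image:
  assumes L: "bounded_linear L"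
    and s: "\<And>i. Bochner_Integration.simple_bochner_integrable M (s i)"
    and f: "strongly_measurable M f"
    and lim: "(\<lambda>i. \<integral>\<^sup>+x. ennreal (norm (f x - s i x)) \<partial>M) \<longlonglongrightarrow> 0"
      "(\<lambda>i. Bochner_Integration.simple_bochner_integral M (s i)) \<longlonglongrightarrow> y"
  shows "has_strong_integral M (\<lambda>x. L (f x)) (L y)"
proof -
  interpret L: bounded_linear L by fact
  obtain K where K: "K > 0" "\<And>x. norm (L x) \<le> norm x * K"
    using L.pos_bounded by auto
  have Ls: "Bochner_Integration.simple_bochner_integrable M (\<lambda>x. L (s i x))" for i
    using simple_bochner_integrable_compose2[of "\<lambda>x y. L x" M "s i" "s i"] s by (simp add: L.zero)
  have Lf: "strongly_measurable M (\<lambda>x. L (f x))"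
    using strongly_measurable_compose2[of M f f "\<lambda>x y. L x"] f by (simp add: L.tendsto)
  let ?J = "\<lambda>i. \<integral>\<^sup>+x. ennreal (norm (L (f x) - L (s i x))) \<partial>M"
  have "?J i \<le> ennreal K * (\<integral>\<^sup>+x. ennreal (norm (f x - s i x)) \<partial>M)" for i
  proof -
    have "?J i \<le> (\<integral>\<^sup>+x. ennreal K * ennreal (norm (f x - s i x)) \<partial>M)"
      using K by (intro nn_integral_mono) (auto simp: L.diff[symmetric] mult.commute simp flip: ennreal_mult)
    also have "\<dots> = ennreal K * (\<integral>\<^sup>+x. ennreal (norm (f x - s i x)) \<partial>M)"
      using strongly_measurable_norm[OF strongly_measurable_diff[OF f
            simple_bochner_integrable_strongly_measurable[OF s]]]
      by (intro nn_integral_cmult) auto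
    finally show ?thesis .
  qed
  moreover have "(\<lambda>i. ennreal K * (\<integral>\<^sup>+x. ennreal (norm (f x - s i x)) \<partial>M)) \<longlonglongrightarrow> ennreal K * 0"
    by (intro ennreal_tendsto_cmult lim) simp
  ultimately have "?J \<longlonglongrightarrow> 0"
    by (intro tendsto_sandwich[OF _ _ tendsto_const, of _ ?J]) (auto intro!: always_eventually)
  moreover have "(\<lambda>i. Bochner_Integration.simple_bochner_integral M (\<lambda>x. L (s i x))) \<longlonglongrightarrow> L y"
    using L.tendsto[OF lim(2)] s by (simp add: simple_bochner_integral_linear L.linear_axioms)
  ultimately show ?thesis
    unfolding has_strong_integral_def using Ls Lf by (intro conjI exI[of _ "\<lambda>i x. L (s i x)"]) auto
qed

lemma has_strong_integral_bounded_linear: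
  "bounded_linear L \<Longrightarrow> has_strong_integral M f y \<Longrightarrow> has_strong_integral M (\<lambda>x. L (f x)) (L y)"
  by (auto simp: has_strong_integral_def[of M f y] intro: has_strong_integral_linear_image)

lemma has_strong_integral_bochner_linear:
  assumes "bounded_linear L" "has_bochner_integral M f y"
  shows "has_strong_integral M (\<lambda>x. L (f x)) (L y)"
  using assms(2)
proof cases
  case (1 s)
  from 1(1) have "strongly_measurable M f"
    by (simp only: strongly_measurable_iff_borel_measurable)
  with 1 show ?thesis
    by (intro has_strong_integral_linear_image[OF assms(1)])
qed

lemma has_strong_integral_unique:
  assumes "has_strong_integral M f y" "has_strong_integral M f z"
  shows "y = z"
proof -
  have "has_strong_integral M (\<lambda>x. f x + - f x) (y + - z)"
    by (intro has_strong_integral_add has_strong_integral_bounded_linear[of uminus] assms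
        bounded_linear_minus bounded_linear_ident)
  from has_strong_integral_norm_le[OF this] show ?thesis by simp
qed

lemma strong_integral_eq: "has_strong_integral M f y \<Longrightarrow> strong_integral M f = y"
  unfolding strong_integral_def using has_strong_integral_unique by blast

lemma strongly_integrable_approx:
  assumes f: "strongly_integrable M f"
  obtains s where "\<And>i::nat. Bochner_Integration.simple_bochner_integrable M (s i)"
    "(\<lambda>i. \<integral>\<^sup>+x. ennreal (norm (f x - s i x)) \<partial>M) \<longlonglongrightarrow> 0"
proof -
  have fm: "strongly_measurable M f" and fin: "(\<integral>\<^sup>+x. ennreal (norm (f x)) \<partial>M) < \<infinity>"
    using f by (auto simp: strongly_integrable_def)
  obtain s where s: "\<And>i::nat. simple_function M (s i)"
    "\<And>x. x \<in> space M \<Longrightarrow> (\<lambda>i. s i x) \<longlonglongrightarrow> f x"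
    "\<And>i x. x \<in> space M \<Longrightarrow> norm (s i x) \<le> 2 * norm (f x)"
    by (rule strongly_measurable_dominated_simple[OF fm]) blast
  note [measurable] = strongly_measurable_norm[OF fm]
  have sm: "strongly_measurable M (s i)" for i
    unfolding strongly_measurable_def using s(1) by (intro exI[of _ "\<lambda>_. s i"]) auto
  have "(\<integral>\<^sup>+x. ennreal (norm (s i x)) \<partial>M) < \<infinity>" for i
  proof -
    have "(\<integral>\<^sup>+x. ennreal (norm (s i x)) \<partial>M) \<le> (\<integral>\<^sup>+x. 2 * ennreal (norm (f x)) \<partial>M)"
      using s(3) by (intro nn_integral_mono) (auto simp: ennreal_mult'[symmetric] intro!: ennreal_leI
          simp flip: ennreal_numeral)
    also have "\<dots> = 2 * (\<integral>\<^sup>+x. ennreal (norm (f x)) \<partial>M)"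
      by (intro nn_integral_cmult) auto
    also have "\<dots> < \<infinity>" using fin by (simp add: ennreal_mult_less_top)
    finally show ?thesis .
  qed
  then have "Bochner_Integration.simple_bochner_integrable M (s i)" for i
    by (intro simple_bochner_integrableI_bounded s)
  moreover have "(\<lambda>i. \<integral>\<^sup>+x. ennreal (norm (f x - s i x)) \<partial>M) \<longlonglongrightarrow> (\<integral>\<^sup>+x. 0 \<partial>M)"
  proof (rule nn_integral_dominated_convergence[where w = "\<lambda>x. 3 * ennreal (norm (f x))"])
    show "(\<lambda>x. ennreal (norm (f x - s i x))) \<in> borel_measurable M" for i
      using strongly_measurable_norm[OF strongly_measurable_diff[OF fm sm]] by simp
    have "(\<integral>\<^sup>+x. 3 * ennreal (norm (f x)) \<partial>M) = 3 * (\<integral>\<^sup>+x. ennreal (norm (f x)) \<partial>M)"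
      by (intro nn_integral_cmult) auto
    then show "(\<integral>\<^sup>+x. 3 * ennreal (norm (f x)) \<partial>M) < \<infinity>"
      using fin by (simp add: ennreal_mult_less_top)
    have "norm (f x - s i x) \<le> 3 * norm (f x)" if "x \<in> space M" for i x
      using norm_triangle_ineq4[of "f x" "s i x"] s(3)[OF that, of i] by linarith
    then show "AE x in M. ennreal (norm (f x - s i x)) \<le> 3 * ennreal (norm (f x))" for i
      by (intro AE_I2) (auto simp: ennreal_mult'[symmetric] intro!: ennreal_leI simp flip: ennreal_numeral)
    have "(\<lambda>i. ennreal (norm (f x - s i x))) \<longlonglongrightarrow> 0" if "x \<in> space M" for x
    proof -
      have "(\<lambda>i. norm (f x - s i x)) \<longlonglongrightarrow> norm (f x - f x)"
        by (intro tendsto_intros s that)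
      then show ?thesis using tendsto_ennrealI by fastforce
    qed
    then show "AE x in M. (\<lambda>i. ennreal (norm (f x - s i x))) \<longlonglongrightarrow> 0"
      by (intro AE_I2) auto
  qed auto
  ultimately show ?thesis using that[of s] by simp
qed

lemma has_strong_integral_strong_integral:
  fixes f :: "'a \<Rightarrow> 'b::banach"
  assumes f: "strongly_integrable M f"
  shows "has_strong_integral M f (strong_integral M f)"
proof -
  obtain s where s: "\<And>i::nat. Bochner_Integration.simple_bochner_integrable M (s i)"
    "(\<lambda>i. \<integral>\<^sup>+x. ennreal (norm (f x - s i x)) \<partial>M) \<longlonglongrightarrow> 0"
    by (rule strongly_integrable_approx[OF f]) blast
  have fm: "strongly_measurable M f"
    using f by (auto simp: strongly_integrable_def)
  note sm = simple_bochner_integrable_strongly_measurable[OF s(1)]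
  have "Cauchy (\<lambda>i. Bochner_Integration.simple_bochner_integral M (s i))"
  proof (rule metric_CauchyI)
    fix e :: real assume e: "e > 0"
    then have "\<forall>\<^sub>F i in sequentially. (\<integral>\<^sup>+x. ennreal (norm (f x - s i x)) \<partial>M) < ennreal (e / 2)"
      by (intro order_tendstoD[OF s(2)]) simp
    then obtain N where N: "\<And>i. i \<ge> N \<Longrightarrow> (\<integral>\<^sup>+x. ennreal (norm (f x - s i x)) \<partial>M) < ennreal (e / 2)"
      by (auto simp: eventually_sequentially)
    show "\<exists>N. \<forall>i\<ge>N. \<forall>j\<ge>N. dist (Bochner_Integration.simple_bochner_integral M (s i)) (Bochner_Integration.simple_bochner_integral M (s j)) < e"
    proof (intro exI allI impI)
      fix i j assume ij: "i \<ge> N" "j \<ge> N"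
      have "ennreal (norm (Bochner_Integration.simple_bochner_integral M (s i) - Bochner_Integration.simple_bochner_integral M (s j)))
        = ennreal (norm (Bochner_Integration.simple_bochner_integral M (\<lambda>x. s i x - s j x)))"
        by (simp add: simple_bochner_integral_diff s)
      also have "\<dots> \<le> (\<integral>\<^sup>+x. ennreal (norm (s i x - s j x)) \<partial>M)"
        by (intro norm_simple_bochner_integral_le simple_bochner_integrable_compose2[where p = "(-)"] s) simp
      also have "\<dots> \<le> (\<integral>\<^sup>+x. ennreal (norm (f x - s i x)) \<partial>M) + (\<integral>\<^sup>+x. ennreal (norm (f x - s j x)) \<partial>M)"
      proof (intro nn_integral_norm_triangle strongly_measurable_diff fm sm)
        show "norm (s i x - s j x) \<le> norm (f x - s i x) + norm (f x - s j x)" for x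
          using norm_triangle_ineq4[of "f x - s j x" "f x - s i x"] by simp
      qed
      also have "\<dots> < ennreal (e / 2) + ennreal (e / 2)"
        using N ij by (intro add_strict_mono) auto
      also have "\<dots> = ennreal e" using e by (simp flip: ennreal_plus)
      finally show "dist (Bochner_Integration.simple_bochner_integral M (s i)) (Bochner_Integration.simple_bochner_integral M (s j)) < e"
        using e by (simp add: dist_norm ennreal_less_iff)
    qed
  qed
  then obtain y where "(\<lambda>i. Bochner_Integration.simple_bochner_integral M (s i)) \<longlonglongrightarrow> y"
    by (auto simp: Cauchy_convergent_iff convergent_def)
  then have "has_strong_integral M f y"
    unfolding has_strong_integral_def using fm s by blast
  then show ?thesis using strong_integral_eq by metis
qed

lemma norm_strong_integral_le:
  fixes f :: "'a \<Rightarrow> 'b::banach"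
  assumes "strongly_integrable M f"
  shows "ennreal (norm (strong_integral M f)) \<le> (\<integral>\<^sup>+x. ennreal (norm (f x)) \<partial>M)"
  by (rule has_strong_integral_norm_le[OF has_strong_integral_strong_integral[OF assms]])

lemma strong_integral_add:
  fixes f :: "'a \<Rightarrow> 'b::banach"
  assumes "strongly_integrable M f" "strongly_integrable M g"
  shows "strong_integral M (\<lambda>x. f x + g x) = strong_integral M f + strong_integral M g"
  by (intro strong_integral_eq has_strong_integral_add has_strong_integral_strong_integral assms)

lemma strong_integral_diff:
  fixes f :: "'a \<Rightarrow> 'b::banach"
  assumes "strongly_integrable M f" "strongly_integrable M g"
  shows "strong_integral M (\<lambda>x. f x - g x) = strong_integral M f - strong_integral M g"
  using strong_integral_eq[OF has_strong_integral_add[OF has_strong_integral_strong_integral[OF assms(1)]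
      has_strong_integral_bounded_linear[of uminus, OF bounded_linear_minus[OF bounded_linear_ident]
        has_strong_integral_strong_integral[OF assms(2)]]]]
  by simp

lemma strong_integral_scaleC:
  fixes f :: "'a \<Rightarrow> 'b::complex_banach"
  assumes "strongly_integrable M f"
  shows "strong_integral M (\<lambda>x. c *\<^sub>C f x) = c *\<^sub>C strong_integral M f"
  by (intro strong_integral_eq has_strong_integral_bounded_linear[OF bounded_linear_scaleC_right]
      has_strong_integral_strong_integral assms)

section \<open>Monomials on the torus\<close>

lemma torus_norm: "\<omega> \<in> torus \<Longrightarrow> cmod (\<omega> j) = 1"
  by (simp add: torus_def)

lemma torus_nonzero: "\<omega> \<in> torus \<Longrightarrow> \<omega> j \<noteq> 0"
  using torus_norm[of \<omega> j] by auto

lemma one_in_torus: "(\<lambda>j. 1) \<in> torus"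
  by (simp add: torus_def)

lemma torus_mult: "\<eta> \<in> torus \<Longrightarrow> \<omega> \<in> torus \<Longrightarrow> (\<lambda>j. \<eta> j * \<omega> j) \<in> torus"
  by (simp add: torus_def norm_mult)

lemma monomial_eq_prod:
  assumes "finite J" "Poly_Mapping.keys \<alpha> \<subseteq> J"
  shows "monomial \<alpha> \<omega> = (\<Prod>j\<in>J. \<omega> j powi Poly_Mapping.lookup \<alpha> j)"
  unfolding monomial_def
  by (rule prod.mono_neutral_left) (use assms in \<open>auto simp: in_keys_iff\<close>)

lemma monomial_0 [simp]: "monomial 0 \<omega> = 1"
  by (simp add: monomial_def)

lemma monomial_add:
  assumes "\<omega> \<in> torus"
  shows "monomial (\<alpha> + \<beta>) \<omega> = monomial \<alpha> \<omega> * monomial \<beta> \<omega>"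
proof -
  define J where "J = Poly_Mapping.keys \<alpha> \<union> Poly_Mapping.keys \<beta>"
  have J: "finite J" "Poly_Mapping.keys \<alpha> \<subseteq> J" "Poly_Mapping.keys \<beta> \<subseteq> J" "Poly_Mapping.keys (\<alpha> + \<beta>) \<subseteq> J"
    using Poly_Mapping.keys_add[of \<alpha> \<beta>] by (auto simp: J_def)
  show ?thesis
    using torus_nonzero[OF assms]
    by (simp add: monomial_eq_prod[OF J(1)] J prod.distrib[symmetric] lookup_add power_int_add)
qed

lemma norm_monomial: "\<omega> \<in> torus \<Longrightarrow> cmod (monomial \<alpha> \<omega>) = 1"
  by (simp add: monomial_def prod_norm[symmetric] norm_power_int torus_norm)

lemma monomial_minus:
  assumes "\<omega> \<in> torus"
  shows "monomial (- \<alpha>) \<omega> = cnj (monomial \<alpha> \<omega>)"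
proof -
  have "monomial \<alpha> \<omega> * monomial (- \<alpha>) \<omega> = 1"
    using monomial_add[OF assms, of \<alpha> "- \<alpha>"] by simp
  moreover have "monomial \<alpha> \<omega> * cnj (monomial \<alpha> \<omega>) = 1"
    using norm_monomial[OF assms, of \<alpha>] by (simp add: complex_mult_cnj cmod_def)
  moreover have "monomial \<alpha> \<omega> \<noteq> 0"
    using norm_monomial[OF assms, of \<alpha>] by auto
  ultimately show ?thesis by (metis mult_left_cancel)
qed

lemma monomial_diff:
  "\<omega> \<in> torus \<Longrightarrow> monomial (\<alpha> - \<beta>) \<omega> = monomial \<alpha> \<omega> * cnj (monomial \<beta> \<omega>)"
  using monomial_add[of \<omega> \<alpha> "- \<beta>"] by (simp add: monomial_minus)

lemma monomial_mult: "monomial \<alpha> (\<lambda>j. \<eta> j * \<omega> j) = monomial \<alpha> \<eta> * monomial \<alpha> \<omega>"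
  by (simp add: monomial_def power_int_mult_distrib prod.distrib)

lemma monomial_single: "monomial (Poly_Mapping.single j n) \<omega> = \<omega> j powi n"
  by (cases "n = 0") (simp_all add: monomial_def)

lemma continuous_on_coordinate: "continuous_on S (\<lambda>\<omega>::nat \<Rightarrow> complex. \<omega> j)"
  by (rule continuous_on_subset[OF continuous_on_product_coordinates subset_UNIV])

lemma continuous_on_monomial: "continuous_on torus (monomial \<alpha>)"
  unfolding monomial_def[abs_def]
  by (intro continuous_on_prod continuous_on_power_int continuous_on_coordinate)
    (use torus_nonzero in blast)

lemma compact_torus: "compact torus"
proof -
  have "compactin (product_topology (\<lambda>_::nat. euclidean :: complex topology) UNIV) (Pi\<^sub>E UNIV (\<lambda>_. sphere 0 1))"
    unfolding compactin_PiE by (simp add: compactin_euclidean_iff)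
  moreover have "Pi\<^sub>E UNIV (\<lambda>_. sphere 0 1) = torus"
    by (auto simp: torus_def PiE_UNIV_domain)
  ultimately show ?thesis
    by (simp add: euclidean_product_topology compactin_euclidean_iff)
qed

lemma torus_nonempty: "torus \<noteq> {}"
  using one_in_torus by blast

lemma measurable_haar_coordinate: "(\<lambda>\<omega>. \<omega> j) \<in> haar \<rightarrow>\<^sub>M circle_measure"
  unfolding haar_def by (rule measurable_component_singleton) simp

lemma measurable_haar_borel: "(\<lambda>\<omega>. \<omega>) \<in> haar \<rightarrow>\<^sub>M borel"
proof -
  have circle: "(\<lambda>z. z) \<in> circle_measure \<rightarrow>\<^sub>M borel"
    by (subst measurable_cong_sets[OF sets_circle refl]) (rule measurable_restrict_space1, simp)
  have "(\<lambda>\<omega>. \<omega>) \<in> haar \<rightarrow>\<^sub>M (\<Pi>\<^sub>M j\<in>UNIV::nat set. (borel :: complex measure))"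
  proof (rule measurable_PiM_single')
    fix j :: nat
    show "(\<lambda>\<omega>. \<omega> j) \<in> haar \<rightarrow>\<^sub>M borel"
      by (rule measurable_compose[OF measurable_haar_coordinate circle])
  qed (auto simp: space_PiM)
  then show ?thesis
    by (subst (asm) measurable_cong_sets[OF refl sets_PiM_equal_borel])
qed

lemma sets_haar_borel:
  assumes "A \<in> sets haar"
  shows "A \<in> sets borel"
proof -
  have "(\<lambda>\<omega>. \<omega>) \<in> restrict_space borel torus \<rightarrow>\<^sub>M haar"
    unfolding haar_def
  proof (rule measurable_PiM_single')
    fix j :: nat
    have "(\<lambda>\<omega>::nat \<Rightarrow> complex. \<omega> j) \<in> restrict_space borel torus \<rightarrow>\<^sub>M restrict_space borel (sphere 0 1)"
    proof (rule measurable_restrict_space2)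
      show "(\<lambda>\<omega>::nat \<Rightarrow> complex. \<omega> j) \<in> borel_measurable (restrict_space borel torus)"
        by (intro measurable_restrict_space1 borel_measurable_continuous_onI continuous_on_coordinate)
    qed (auto simp: space_restrict_space torus_def)
    then show "(\<lambda>\<omega>::nat \<Rightarrow> complex. \<omega> j) \<in> restrict_space borel torus \<rightarrow>\<^sub>M circle_measure"
      by (subst measurable_cong_sets[OF refl sets_circle])
  qed (auto simp: space_restrict_space torus_def space_PiM space_circle)
  from measurable_sets[OF this assms]
  have "A \<inter> torus \<in> sets (restrict_space borel torus)"
    by (simp add: space_restrict_space vimage_def Int_def)
  moreover have "A \<inter> torus = A"
    using sets.sets_into_space[OF assms] by (auto simp: space_haar)
  moreover have "torus \<in> sets borel"
    using compact_torus by (simp add: borel_compact)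
  ultimately show ?thesis
    by (auto simp: sets_restrict_space)
qed

lemma borel_measurable_haar_continuous:
  fixes f :: "(nat \<Rightarrow> complex) \<Rightarrow> 'b::topological_space"
  assumes "continuous_on torus f"
  shows "f \<in> borel_measurable haar"
proof -
  have "f \<in> borel_measurable (restrict_space borel torus)"
    by (rule borel_measurable_continuous_on_restrict[OF assms])
  moreover have "(\<lambda>\<omega>. \<omega>) \<in> haar \<rightarrow>\<^sub>M restrict_space borel torus"
    by (intro measurable_restrict_space2 measurable_haar_borel) (simp add: space_haar)
  ultimately show ?thesis
    using measurable_compose by blast
qed

lemma borel_measurable_monomial: "monomial \<alpha> \<in> borel_measurable haar"
  by (rule borel_measurable_haar_continuous[OF continuous_on_monomial])

lemma emeasure_haar_space [simp]: "emeasure haar (space haar) = 1"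
  by (rule prob_space.emeasure_space_1[OF prob_space_haar])

section \<open>Rotation invariance and orthogonality\<close>

lemma measurable_haar_rotate:
  assumes "\<eta> \<in> torus"
  shows "(\<lambda>\<omega> j. \<eta> j * \<omega> j) \<in> haar \<rightarrow>\<^sub>M haar"
proof -
  have "(\<lambda>\<omega> j. \<eta> j * \<omega> j) \<in> haar \<rightarrow>\<^sub>M Pi\<^sub>M UNIV (\<lambda>_. circle_measure)"
  proof (rule measurable_PiM_single')
    fix j :: nat
    show "(\<lambda>\<omega>. \<eta> j * \<omega> j) \<in> haar \<rightarrow>\<^sub>M circle_measure"
      by (rule measurable_compose[OF measurable_haar_coordinate measurable_mult_circle])
        (rule torus_norm[OF assms])
  qed (use assms in \<open>auto simp: space_haar space_PiM space_circle torus_def norm_mult\<close>)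
  then show ?thesis by (simp add: haar_def)
qed

lemma nn_integral_haar_rotate:
  assumes "\<eta> \<in> torus" "f \<in> borel_measurable haar"
  shows "(\<integral>\<^sup>+\<omega>. f (\<lambda>j. \<eta> j * \<omega> j) \<partial>haar) = (\<integral>\<^sup>+\<omega>. f \<omega> \<partial>haar)"
proof -
  have "(\<integral>\<^sup>+\<omega>. f \<omega> \<partial>haar) = (\<integral>\<^sup>+\<omega>. f \<omega> \<partial>distr haar haar (\<lambda>\<omega> j. \<eta> j * \<omega> j))"
    by (simp add: haar_rotate[OF assms(1)])
  also have "\<dots> = (\<integral>\<^sup>+\<omega>. f (\<lambda>j. \<eta> j * \<omega> j) \<partial>haar)"
    by (rule nn_integral_distr[OF measurable_haar_rotate[OF assms(1)]]) (use assms(2) in simp)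
  finally show ?thesis ..
qed

lemma integrable_monomial: "integrable haar (monomial \<alpha>)"
proof -
  interpret prob_space haar by (rule prob_space_haar)
  show ?thesis
    by (rule integrable_const_bound[where B = 1])
      (auto intro!: AE_I2 simp: space_haar norm_monomial borel_measurable_monomial)
qed

text \<open>Some rotation multiplies a nontrivial character by a constant other than \<open>1\<close>.\<close>

lemma integral_monomial:
  "integral\<^sup>L haar (monomial \<alpha>) = (if \<alpha> = 0 then 1 else 0)"
proof (cases "\<alpha> = 0")
  case True
  have "monomial 0 = (\<lambda>\<omega>. 1)" by (rule ext) simp
  then show ?thesis
    using True prob_space.prob_space[OF prob_space_haar] by simp
next
  case False
  then obtain j where j: "Poly_Mapping.lookup \<alpha> j \<noteq> 0"
    by (metis lookup_zero poly_mapping_eqI)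
  define n where "n = Poly_Mapping.lookup \<alpha> j"
  define \<eta> :: "nat \<Rightarrow> complex" where "\<eta> = (\<lambda>i. if i = j then cis (pi / of_int n) else 1)"
  have \<eta>: "\<eta> \<in> torus" by (auto simp: torus_def \<eta>_def)
  have "monomial \<alpha> \<eta> = (\<Prod>i\<in>Poly_Mapping.keys \<alpha>. if i = j then cis (pi / of_int n) powi n else 1)"
    unfolding monomial_def by (rule prod.cong) (auto simp: \<eta>_def n_def)
  also have "\<dots> = cis (pi / of_int n) powi n"
    using j by (simp add: in_keys_iff)
  also have "\<dots> = - 1"
    using j by (simp add: cis_power_int n_def)
  finally have m: "monomial \<alpha> \<eta> = - 1" .
  have "integral\<^sup>L haar (monomial \<alpha>) = integral\<^sup>L (distr haar haar (\<lambda>\<omega> j. \<eta> j * \<omega> j)) (monomial \<alpha>)"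
    by (simp add: haar_rotate[OF \<eta>])
  also have "\<dots> = (\<integral>\<omega>. monomial \<alpha> (\<lambda>j. \<eta> j * \<omega> j) \<partial>haar)"
    by (rule integral_distr[OF measurable_haar_rotate[OF \<eta>] borel_measurable_monomial])
  also have "\<dots> = - integral\<^sup>L haar (monomial \<alpha>)"
    by (simp add: monomial_mult m)
  finally show ?thesis using False by simp
qed

lemma has_strong_integral_monomial_scaleC:
  "has_strong_integral haar (\<lambda>\<omega>. monomial \<alpha> \<omega> *\<^sub>C x) (if \<alpha> = 0 then x else (0::'x::complex_banach))"
proof -
  have "has_bochner_integral haar (monomial \<alpha>) (if \<alpha> = 0 then 1 else 0)"
    using integrable_monomial[of \<alpha>] integral_monomial[of \<alpha>] by (metis has_bochner_integral_integrable)
  from has_strong_integral_bochner_linear[OF bounded_linear_scaleC_left this, of x]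
  show ?thesis by (simp split: if_splits)
qed

section \<open>Density of the trigonometric polynomials\<close>

definition trig_polynomial :: "((nat \<Rightarrow> complex) \<Rightarrow> complex) \<Rightarrow> bool"
  where "trig_polynomial P \<longleftrightarrow>
    (\<exists>A c. finite A \<and> (\<forall>\<omega>\<in>torus. P \<omega> = (\<Sum>\<alpha>\<in>A. c \<alpha> * monomial \<alpha> \<omega>)))"

lemma trig_polynomial_monomial: "trig_polynomial (\<lambda>\<omega>. c * monomial \<alpha> \<omega>)"
  unfolding trig_polynomial_def by (intro exI[of _ "{\<alpha>}"] exI[of _ "\<lambda>_. c"]) simp

lemma trig_polynomial_cong:
  "trig_polynomial P \<Longrightarrow> (\<And>\<omega>. \<omega> \<in> torus \<Longrightarrow> P \<omega> = Q \<omega>) \<Longrightarrow> trig_polynomial Q"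
  by (simp add: trig_polynomial_def)

lemma trig_polynomial_add:
  assumes "trig_polynomial P" "trig_polynomial Q"
  shows "trig_polynomial (\<lambda>\<omega>. P \<omega> + Q \<omega>)"
proof -
  obtain A c B d where A: "finite A" "\<And>\<omega>. \<omega> \<in> torus \<Longrightarrow> P \<omega> = (\<Sum>\<alpha>\<in>A. c \<alpha> * monomial \<alpha> \<omega>)"
    and B: "finite B" "\<And>\<omega>. \<omega> \<in> torus \<Longrightarrow> Q \<omega> = (\<Sum>\<alpha>\<in>B. d \<alpha> * monomial \<alpha> \<omega>)"
    using assms by (auto simp: trig_polynomial_def)
  define e where "e \<alpha> = (if \<alpha> \<in> A then c \<alpha> else 0) + (if \<alpha> \<in> B then d \<alpha> else 0)" for \<alpha>
  have "P \<omega> + Q \<omega> = (\<Sum>\<alpha>\<in>A \<union> B. e \<alpha> * monomial \<alpha> \<omega>)" if \<omega>: "\<omega> \<in> torus" for \<omega>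
  proof -
    have "P \<omega> = (\<Sum>\<alpha>\<in>A \<union> B. (if \<alpha> \<in> A then c \<alpha> else 0) * monomial \<alpha> \<omega>)"
      unfolding A(2)[OF \<omega>] by (rule sum.mono_neutral_cong_left) (use A B in auto)
    moreover have "Q \<omega> = (\<Sum>\<alpha>\<in>A \<union> B. (if \<alpha> \<in> B then d \<alpha> else 0) * monomial \<alpha> \<omega>)"
      unfolding B(2)[OF \<omega>] by (rule sum.mono_neutral_cong_left) (use A B in auto)
    ultimately show ?thesis
      by (simp add: e_def sum.distrib distrib_right)
  qed
  then show ?thesis
    unfolding trig_polynomial_def using A B by blast
qed

lemma trig_polynomial_sum:
  "finite I \<Longrightarrow> (\<And>i. i \<in> I \<Longrightarrow> trig_polynomial (P i)) \<Longrightarrow> trig_polynomial (\<lambda>\<omega>. \<Sum>i\<in>I. P i \<omega>)"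
proof (induction I rule: finite_induct)
  case empty
  then show ?case using trig_polynomial_monomial[of 0 0] by simp
qed (simp add: trig_polynomial_add)

lemma trig_polynomial_mult:
  assumes "trig_polynomial P" "trig_polynomial Q"
  shows "trig_polynomial (\<lambda>\<omega>. P \<omega> * Q \<omega>)"
proof -
  obtain A c B d where A: "finite A" "\<And>\<omega>. \<omega> \<in> torus \<Longrightarrow> P \<omega> = (\<Sum>\<alpha>\<in>A. c \<alpha> * monomial \<alpha> \<omega>)"
    and B: "finite B" "\<And>\<omega>. \<omega> \<in> torus \<Longrightarrow> Q \<omega> = (\<Sum>\<alpha>\<in>B. d \<alpha> * monomial \<alpha> \<omega>)"
    using assms by (auto simp: trig_polynomial_def)
  have "trig_polynomial (\<lambda>\<omega>. \<Sum>\<alpha>\<in>A. \<Sum>\<beta>\<in>B. (c \<alpha> * d \<beta>) * monomial (\<alpha> + \<beta>) \<omega>)"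
    by (intro trig_polynomial_sum trig_polynomial_monomial A B)
  then show ?thesis
    by (rule trig_polynomial_cong)
      (simp add: A B sum_product monomial_add mult.assoc mult.left_commute)
qed

lemma trig_polynomial_const: "trig_polynomial (\<lambda>_. c)"
  using trig_polynomial_monomial[of c 0] by simp

lemma trig_polynomial_cmult: "trig_polynomial P \<Longrightarrow> trig_polynomial (\<lambda>\<omega>. c * P \<omega>)"
  by (rule trig_polynomial_mult[OF trig_polynomial_const])

lemma continuous_on_trig_polynomial:
  assumes "trig_polynomial P"
  shows "continuous_on torus P"
proof -
  obtain A c where A: "\<And>\<omega>. \<omega> \<in> torus \<Longrightarrow> P \<omega> = (\<Sum>\<alpha>\<in>A. c \<alpha> * monomial \<alpha> \<omega>)"
    using assms by (auto simp: trig_polynomial_def)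
  have "continuous_on torus (\<lambda>\<omega>. \<Sum>\<alpha>\<in>A. c \<alpha> * monomial \<alpha> \<omega>)"
    by (intro continuous_on_sum continuous_on_mult continuous_on_const continuous_on_monomial)
  then show ?thesis
    by (rule continuous_on_eq) (simp add: A)
qed

text \<open>The real trigonometric polynomials separate points through the real and imaginary parts
  of the coordinates.\<close>

lemma trig_polynomial_dense_real:
  fixes f :: "(nat \<Rightarrow> complex) \<Rightarrow> real"
  assumes "continuous_on torus f" "e > 0"
  shows "\<exists>g. trig_polynomial (\<lambda>\<omega>. complex_of_real (g \<omega>)) \<and> (\<forall>\<omega>\<in>torus. \<bar>f \<omega> - g \<omega>\<bar> < e)"
proof (rule Stone_Weierstrass_HOL[OF compact_torus])
  show "trig_polynomial (\<lambda>\<omega>. complex_of_real c)" for c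
    by (rule trig_polynomial_const)
  show "continuous_on torus f" if "trig_polynomial (\<lambda>\<omega>. complex_of_real (f \<omega>))" for f
    using continuous_on_Re[OF continuous_on_trig_polynomial[OF that]] by simp
  show "trig_polynomial (\<lambda>\<omega>. complex_of_real (f \<omega> + g \<omega>))"
    if "trig_polynomial (\<lambda>\<omega>. complex_of_real (f \<omega>)) \<and> trig_polynomial (\<lambda>\<omega>. complex_of_real (g \<omega>))" for f g
    using trig_polynomial_add that by fastforce
  show "trig_polynomial (\<lambda>\<omega>. complex_of_real (f \<omega> * g \<omega>))"
    if "trig_polynomial (\<lambda>\<omega>. complex_of_real (f \<omega>)) \<and> trig_polynomial (\<lambda>\<omega>. complex_of_real (g \<omega>))" for f g
    using trig_polynomial_mult that by fastforce
  show "\<exists>g. trig_polynomial (\<lambda>\<omega>. complex_of_real (g \<omega>)) \<and> g x \<noteq> g y"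
    if xy: "x \<in> torus \<and> y \<in> torus \<and> x \<noteq> y" for x y
  proof -
    obtain j where j: "x j \<noteq> y j" using xy by auto
    let ?e = "Poly_Mapping.single j (1::int)"
    have tp: "trig_polynomial (\<lambda>\<omega>. c * monomial ?e \<omega> + d * monomial (- ?e) \<omega>)" for c d
      by (intro trig_polynomial_add trig_polynomial_monomial)
    have "trig_polynomial (\<lambda>\<omega>. complex_of_real (Re (\<omega> j)))"
      by (rule trig_polynomial_cong[OF tp[of "1/2" "1/2"]])
        (simp add: monomial_minus monomial_single complex_eq_iff)
    moreover have "trig_polynomial (\<lambda>\<omega>. complex_of_real (Im (\<omega> j)))"
      by (rule trig_polynomial_cong[OF tp[of "- \<i> / 2" "\<i> / 2"]])
        (simp add: monomial_minus monomial_single complex_eq_iff)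
    moreover have "Re (x j) \<noteq> Re (y j) \<or> Im (x j) \<noteq> Im (y j)"
      using j by (simp add: complex_eq_iff)
    ultimately show ?thesis by (elim disjE) (rule exI, erule (1) conjI)+
  qed
qed (use assms in auto)

lemma trig_polynomial_dense:
  fixes f :: "(nat \<Rightarrow> complex) \<Rightarrow> complex"
  assumes "continuous_on torus f" "e > 0"
  obtains P where "trig_polynomial P" "\<And>\<omega>. \<omega> \<in> torus \<Longrightarrow> cmod (f \<omega> - P \<omega>) < e"
proof -
  obtain g where g: "trig_polynomial (\<lambda>\<omega>. complex_of_real (g \<omega>))" "\<forall>\<omega>\<in>torus. \<bar>Re (f \<omega>) - g \<omega>\<bar> < e / 2"
    using trig_polynomial_dense_real[OF continuous_on_Re[OF assms(1)], of "e / 2"] assms(2) by auto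
  obtain h where h: "trig_polynomial (\<lambda>\<omega>. complex_of_real (h \<omega>))" "\<forall>\<omega>\<in>torus. \<bar>Im (f \<omega>) - h \<omega>\<bar> < e / 2"
    using trig_polynomial_dense_real[OF continuous_on_Im[OF assms(1)], of "e / 2"] assms(2) by auto
  show ?thesis
  proof (rule that)
    show "trig_polynomial (\<lambda>\<omega>. complex_of_real (g \<omega>) + \<i> * complex_of_real (h \<omega>))"
      by (intro trig_polynomial_add trig_polynomial_cmult g h)
    fix \<omega> :: "nat \<Rightarrow> complex" assume "\<omega> \<in> torus"
    then have "\<bar>Re (f \<omega>) - g \<omega>\<bar> < e / 2" "\<bar>Im (f \<omega>) - h \<omega>\<bar> < e / 2" using g h by auto
    moreover have "cmod (f \<omega> - (complex_of_real (g \<omega>) + \<i> * complex_of_real (h \<omega>)))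
      \<le> \<bar>Re (f \<omega>) - g \<omega>\<bar> + \<bar>Im (f \<omega>) - h \<omega>\<bar>"
      by (rule order_trans[OF cmod_le]) simp
    ultimately show "cmod (f \<omega> - (complex_of_real (g \<omega>) + \<i> * complex_of_real (h \<omega>))) < e"
      by linarith
  qed
qed

text \<open>By inner regularity a Borel set is filled up to small measure by a compact set, whose
  indicator is the decreasing limit of the functions \<open>max 0 (1 - n * infdist \<omega> K)\<close>.\<close>

lemma indicator_approx_continuous:
  assumes M: "finite_measure M" "sets M = sets haar" and A: "A \<in> sets haar" and e: "(e::real) > 0"
  obtains \<phi> :: "(nat \<Rightarrow> complex) \<Rightarrow> real" where "continuous_on torus \<phi>" "\<And>\<omega>. 0 \<le> \<phi> \<omega>" "\<And>\<omega>. \<phi> \<omega> \<le> 1"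
    "(\<integral>\<^sup>+\<omega>. ennreal \<bar>indicator A \<omega> - \<phi> \<omega>\<bar> \<partial>M) < e"
proof -
  interpret finite_measure M by (rule M)
  have id: "(\<lambda>\<omega>. \<omega>) \<in> M \<rightarrow>\<^sub>M borel"
    using measurable_haar_borel by (subst measurable_cong_sets[OF M(2) refl])
  have space: "space M = torus"
    using sets_eq_imp_space_eq[OF M(2)] by (simp add: space_haar)
  define N where "N = distr M borel (\<lambda>\<omega>. \<omega>)"
  have N: "emeasure N B = emeasure M (B \<inter> torus)" if "B \<in> sets borel" for B
    using emeasure_distr[OF id that] by (simp add: N_def space vimage_def Int_def)
  have A': "A \<subseteq> torus" "A \<in> sets borel"
    using sets.sets_into_space[OF A] sets_haar_borel[OF A] by (auto simp: space_haar)
  have fin: "emeasure N (space N) \<noteq> \<infinity>"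
    using N[of UNIV] by (simp add: N_def)
  have reg: "emeasure N A = (SUP K\<in>{K. K \<subseteq> A \<and> compact K}. emeasure N K)"
    by (rule inner_regular[OF _ fin A'(2)]) (simp add: N_def)
  have finN: "emeasure N B \<noteq> \<infinity>" if "B \<in> sets borel" for B
    using N[OF that] by simp
  have "\<exists>K. K \<subseteq> A \<and> compact K \<and> emeasure N A < emeasure N K + ennreal (e / 2)"
  proof (rule ccontr)
    assume neg: "\<not> ?thesis"
    have Ne: "emeasure N B = ennreal (measure N B)" if "B \<in> sets borel" for B
      by (rule emeasure_eq_ennreal_measure) (use finN[OF that] in simp)
    have K: "measure N K \<le> measure N A - e / 2" if "K \<subseteq> A" "compact K" for K
    proof -
      have "ennreal (measure N K + e / 2) \<le> ennreal (measure N A)"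
        using neg that e Ne[OF A'(2)] Ne[OF borel_compact[OF that(2)]] by (auto simp: not_less)
      then show ?thesis by simp
    qed
    have "ennreal (measure N A) \<le> ennreal (measure N A - e / 2)"
      unfolding Ne[OF A'(2), symmetric] reg
      by (rule SUP_least) (auto simp: Ne[OF borel_compact] reg[symmetric] intro!: ennreal_leI K)
    moreover have "0 \<le> measure N A - e / 2"
      using K[of "{}"] by simp
    ultimately show False
      using e by simp
  qed
  then obtain K where K: "K \<subseteq> A" "compact K" "emeasure N A < emeasure N K + ennreal (e / 2)"
    by blast
  have KM: "K \<in> sets M" "K \<subseteq> torus"
    using measurable_sets[OF id borel_compact[OF K(2)]] K(1) A'(1)
    by (auto simp: space Int_absorb2)
  have AM: "A \<in> sets M" using A M(2) by simp
  have small: "emeasure M (A - K) < ennreal (e / 2)"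
  proof -
    have "emeasure M K + emeasure M (A - K) = emeasure M A"
      using plus_emeasure[of K M "A - K"] K(1) KM AM by (simp add: Un_absorb1)
    also have "\<dots> < emeasure M K + ennreal (e / 2)"
      using K(3) N[OF A'(2)] N[OF borel_compact[OF K(2)]] A'(1) KM(2) by (simp add: Int_absorb2)
    finally show ?thesis by simp
  qed
  have sp: "(\<integral>\<^sup>+\<omega>. ennreal \<bar>indicator A \<omega> - (indicator K \<omega> :: real)\<bar> \<partial>M) = emeasure M (A - K)"
  proof -
    have "(\<integral>\<^sup>+\<omega>. ennreal \<bar>indicator A \<omega> - (indicator K \<omega> :: real)\<bar> \<partial>M) = (\<integral>\<^sup>+\<omega>. indicator (A - K) \<omega> \<partial>M)"
      using K(1) by (intro nn_integral_cong) (auto simp: indicator_def)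
    then show ?thesis using AM KM by simp
  qed
  show ?thesis
  \<comment> \<open>the distance to the empty set is \<open>0\<close> by convention, so this case needs its own function\<close>
  proof (cases "K = {}")
    case True
    have "(\<integral>\<^sup>+\<omega>. ennreal \<bar>indicator A \<omega> - (0::real)\<bar> \<partial>M) < ennreal (e / 2)"
      using sp small True by simp
    also have "\<dots> \<le> ennreal e" using e by (intro ennreal_leI) simp
    finally show ?thesis
      by (intro that[of "\<lambda>_. 0"]) (auto intro: continuous_on_const)
  next
    case False
    define \<phi> where "\<phi> n \<omega> = max 0 (1 - real n * infdist \<omega> K)" for n and \<omega> :: "nat \<Rightarrow> complex"
    have cont: "continuous_on torus (\<phi> n)" for n
      unfolding \<phi>_def by (intro continuous_intros)
    have [measurable]: "\<phi> n \<in> borel_measurable M" for n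
      using borel_measurable_haar_continuous[OF cont] by (simp add: measurable_cong_sets[OF M(2) refl])
    have [measurable]: "A \<in> sets M" "K \<in> sets M" by fact+
    have "(\<lambda>n. \<integral>\<^sup>+\<omega>. ennreal \<bar>indicator K \<omega> - \<phi> n \<omega>\<bar> \<partial>M) \<longlonglongrightarrow> (\<integral>\<^sup>+\<omega>. 0 \<partial>M)"
    proof (rule nn_integral_dominated_convergence[where w = "\<lambda>_. 1"])
      show "AE \<omega> in M. ennreal \<bar>indicator K \<omega> - \<phi> n \<omega>\<bar> \<le> 1" for n
      proof (rule AE_I2)
        fix \<omega>
        have "\<bar>indicator K \<omega> - \<phi> n \<omega>\<bar> \<le> 1"
          by (auto simp: \<phi>_def indicator_def infdist_nonneg)
        then show "ennreal \<bar>indicator K \<omega> - \<phi> n \<omega>\<bar> \<le> 1"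
          by (metis ennreal_1 ennreal_leI)
      qed
      show "AE \<omega> in M. (\<lambda>n. ennreal \<bar>indicator K \<omega> - \<phi> n \<omega>\<bar>) \<longlonglongrightarrow> 0"
      proof (rule AE_I2)
        fix \<omega>
        show "(\<lambda>n. ennreal \<bar>indicator K \<omega> - \<phi> n \<omega>\<bar>) \<longlonglongrightarrow> 0"
        proof (cases "\<omega> \<in> K")
          case True
          then show ?thesis by (simp add: \<phi>_def)
        next
          case out: False
          have "infdist \<omega> K > 0"
            using out False compact_imp_closed[OF K(2)] by (simp add: infdist_pos_not_in_closed)
          then obtain n0 where "1 < real n0 * infdist \<omega> K"
            using reals_Archimedean3 by blast
          have "\<phi> n \<omega> = 0" if "n \<ge> n0" for n
          proof -
            have "real n0 * infdist \<omega> K \<le> real n * infdist \<omega> K"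
              using that by (intro mult_right_mono infdist_nonneg) simp
            then show ?thesis using \<open>1 < real n0 * infdist \<omega> K\<close> by (simp add: \<phi>_def)
          qed
          then have "\<forall>\<^sub>F n in sequentially. ennreal \<bar>indicator K \<omega> - \<phi> n \<omega>\<bar> = 0"
            using out by (intro eventually_sequentiallyI[of n0]) simp
          then show ?thesis by (rule tendsto_eventually)
        qed
      qed
      show "(\<integral>\<^sup>+\<omega>. 1 \<partial>M) < \<infinity>" by (simp add: less_top[symmetric])
    qed auto
    then have "(\<lambda>n. \<integral>\<^sup>+\<omega>. ennreal \<bar>indicator K \<omega> - \<phi> n \<omega>\<bar> \<partial>M) \<longlonglongrightarrow> 0"
      by (simp only: nn_integral_const mult_zero_left)
    moreover have "0 < ennreal (e / 2)"
      using e by (subst ennreal_less_zero_iff) simp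
    ultimately have "\<forall>\<^sub>F n in sequentially. (\<integral>\<^sup>+\<omega>. ennreal \<bar>indicator K \<omega> - \<phi> n \<omega>\<bar> \<partial>M) < ennreal (e / 2)"
      by (rule order_tendstoD(2))
    then obtain n where n: "(\<integral>\<^sup>+\<omega>. ennreal \<bar>indicator K \<omega> - \<phi> n \<omega>\<bar> \<partial>M) < ennreal (e / 2)"
      using eventually_happens'[OF sequentially_bot] by blast
    have "(\<integral>\<^sup>+\<omega>. ennreal \<bar>indicator A \<omega> - \<phi> n \<omega>\<bar> \<partial>M)
      \<le> (\<integral>\<^sup>+\<omega>. ennreal \<bar>indicator A \<omega> - indicator K \<omega>\<bar> + ennreal \<bar>indicator K \<omega> - \<phi> n \<omega>\<bar> \<partial>M)"
      by (intro nn_integral_mono) (simp flip: ennreal_plus)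
    also have "\<dots> = emeasure M (A - K) + (\<integral>\<^sup>+\<omega>. ennreal \<bar>indicator K \<omega> - \<phi> n \<omega>\<bar> \<partial>M)"
      unfolding sp[symmetric] by (rule nn_integral_add) measurable
    also have "\<dots> < ennreal (e / 2) + ennreal (e / 2)"
      using small n by (rule add_strict_mono)
    also have "\<dots> = ennreal e" using e by (simp flip: ennreal_plus)
    finally show ?thesis
      by (intro that[of "\<phi> n"] cont) (auto simp: \<phi>_def infdist_nonneg)
  qed
qed

section \<open>Lebesgue spaces and Hoelder's inequality\<close>

lemma ennreal_exponent_cases:
  fixes p :: ennreal
  assumes "1 \<le> p"
  obtains "p = \<infinity>" | "p \<noteq> \<infinity>" "1 \<le> enn2real p"
proof (cases "p = \<infinity>")
  case False
  then have "ennreal 1 \<le> ennreal (enn2real p)"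
    using assms by (simp add: less_top)
  then show ?thesis using False that by (simp add: ennreal_le_iff2)
qed (rule that)

lemma conjugate_exponent_cases:
  fixes p p' :: ennreal
  assumes "1 \<le> p" "1 / p + 1 / p' = 1"
  obtains "p = 1" "p' = \<infinity>" | "p = \<infinity>" "p' = 1"
  | "p \<noteq> \<infinity>" "p' \<noteq> \<infinity>" "1 < enn2real p" "1 < enn2real p'" "1 / enn2real p + 1 / enn2real p' = 1"
proof (cases "p = \<infinity>")
  case True
  then have "1 / p' = 1" using assms(2) by (simp add: divide_ennreal_def)
  then have "inverse p' = 1" by (simp add: divide_ennreal_def)
  then have "p' = 1"
    by (cases p') (auto simp: inverse_ennreal_def split: if_splits)
  with True show ?thesis by (rule that(2))
next
  case pfin: False
  then obtain r where r: "p = ennreal r" "1 \<le> r"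
    using assms(1) by (cases p) (auto simp: one_ennreal.rep_eq)
  show ?thesis
  proof (cases "p' = \<infinity>")
    case True
    then have "1 / ennreal r = 1" using assms(2) r by (simp add: divide_ennreal_def)
    then have "r = 1"
      using r by (simp add: divide_ennreal[of 1 r, simplified] ennreal_eq_1)
    with True r show ?thesis by (intro that(1)) simp_all
  next
    case False
    then obtain s where s: "p' = ennreal s" "0 \<le> s" by (cases p') auto
    have "s \<noteq> 0"
    proof
      assume "s = 0"
      then show False using assms(2) s by (simp add: divide_ennreal_def)
    qed
    then have s0: "s > 0" using s by simp
    have "ennreal (1 / r + 1 / s) = 1"
      using assms(2) r s0 by (simp add: s divide_ennreal[of 1, simplified] ennreal_plus)
    then have eq: "1 / r + 1 / s = 1" by (simp add: ennreal_eq_1)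
    have "1 / r < 1" using eq s0 by (smt (verit) divide_pos_pos)
    moreover have "1 / s < 1" using eq r by (smt (verit) divide_pos_pos)
    ultimately have "1 < r" "1 < s" using r s0 by (simp_all add: field_simps)
    with eq r s show ?thesis by (intro that(3)) simp_all
  qed
qed

text \<open>Young's inequality for the functions divided by their norm bounds.\<close>

lemma nn_integral_Hoelder:
  fixes u v :: "'a \<Rightarrow> real"
  assumes [measurable]: "u \<in> borel_measurable M" "v \<in> borel_measurable M"
    and nn: "\<And>x. 0 \<le> u x" "\<And>x. 0 \<le> v x"
    and rs: "1 < r" "1 < s" "1 / r + 1 / s = 1"
    and A: "0 \<le> A" "(\<integral>\<^sup>+x. ennreal (u x powr r) \<partial>M) \<le> ennreal (A powr r)"
    and B: "0 \<le> B" "(\<integral>\<^sup>+x. ennreal (v x powr s) \<partial>M) \<le> ennreal (B powr s)"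
  shows "(\<integral>\<^sup>+x. ennreal (u x * v x) \<partial>M) \<le> ennreal (A * B)"
proof -
  have zero: "AE x in M. w x = 0"
    if [measurable]: "w \<in> borel_measurable M" and "\<And>x. 0 \<le> w x" "(\<integral>\<^sup>+x. ennreal (w x powr t) \<partial>M) \<le> ennreal (0 powr t)"
    for w :: "'a \<Rightarrow> real" and t :: real
  proof -
    have "AE x in M. ennreal (w x powr t) = 0"
      using that(3) by (subst nn_integral_0_iff_AE[symmetric]) simp_all
    then show ?thesis
      by eventually_elim simp
  qed
  consider "A = 0" | "B = 0" | "A > 0" "B > 0" using A(1) B(1) by linarith
  then show ?thesis
  proof cases
    case 1
    then have "AE x in M. u x = 0" using zero[of u r] A nn by simp
    then have "AE x in M. ennreal (u x * v x) = 0" by eventually_elim simp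
    then have "(\<integral>\<^sup>+x. ennreal (u x * v x) \<partial>M) = 0"
      by (subst nn_integral_0_iff_AE) simp_all
    then show ?thesis by simp
  next
    case 2
    then have "AE x in M. v x = 0" using zero[of v s] B nn by simp
    then have "AE x in M. ennreal (u x * v x) = 0" by eventually_elim simp
    then have "(\<integral>\<^sup>+x. ennreal (u x * v x) \<partial>M) = 0"
      by (subst nn_integral_0_iff_AE) simp_all
    then show ?thesis by simp
  next
    case 3
    define a where "a = A * B / (r * A powr r)"
    define b where "b = A * B / (s * B powr s)"
    have ab: "a \<ge> 0" "b \<ge> 0" using 3 rs by (auto simp: a_def b_def)
    have Young: "u x * v x \<le> a * u x powr r + b * v x powr s" for x
    proof -
      have "(u x / A) * (v x / B) \<le> (u x / A) powr r / r + (v x / B) powr s / s"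
        using 3 nn rs by (intro Youngs_inequality) auto
      then have "A * B * ((u x / A) * (v x / B)) \<le> A * B * ((u x / A) powr r / r + (v x / B) powr s / s)"
        using 3 by (intro mult_left_mono) auto
      then show ?thesis
        using 3 nn by (simp add: a_def b_def powr_divide algebra_simps)
    qed
    have "(\<integral>\<^sup>+x. ennreal (u x * v x) \<partial>M)
      \<le> (\<integral>\<^sup>+x. ennreal a * ennreal (u x powr r) + ennreal b * ennreal (v x powr s) \<partial>M)"
      using ab Young by (intro nn_integral_mono) (simp flip: ennreal_mult ennreal_plus)
    also have "\<dots> = ennreal a * (\<integral>\<^sup>+x. ennreal (u x powr r) \<partial>M) + ennreal b * (\<integral>\<^sup>+x. ennreal (v x powr s) \<partial>M)"
      by (subst nn_integral_add) (auto simp: nn_integral_cmult)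
    also have "\<dots> \<le> ennreal a * ennreal (A powr r) + ennreal b * ennreal (B powr s)"
      by (intro add_mono mult_left_mono A B) auto
    also have "\<dots> = ennreal (a * A powr r + b * B powr s)"
      using ab by (simp add: ennreal_mult ennreal_plus)
    also have "a * A powr r + b * B powr s = A * B * (1 / r + 1 / s)"
      using 3 by (simp add: a_def b_def field_simps)
    finally show ?thesis using rs by simp
  qed
qed

text \<open>Bounds on the norm, unlike the norm as a real number, carry finiteness with them and pass to almost everywhere
  limits.\<close>

definition Lp_le :: "ennreal \<Rightarrow> ((nat \<Rightarrow> complex) \<Rightarrow> 'x::real_normed_vector) \<Rightarrow> real \<Rightarrow> bool"
  where "Lp_le p f C \<longleftrightarrow> 0 \<le> C \<and> strongly_measurable haar f \<and>
    (if p = \<infinity> then AE \<omega> in haar. norm (f \<omega>) \<le> C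
     else (\<integral>\<^sup>+\<omega>. ennreal (norm (f \<omega>) powr enn2real p) \<partial>haar) \<le> ennreal (C powr enn2real p))"

lemma Lp_le_measurable: "Lp_le p f C \<Longrightarrow> strongly_measurable haar f"
  by (simp add: Lp_le_def)

lemma Lp_le_nonneg: "Lp_le p f C \<Longrightarrow> 0 \<le> C"
  by (simp add: Lp_le_def)

lemma Lp_norm_nonneg: "0 \<le> Lp_norm M p f"
  by (simp add: Lp_norm_def)

lemma Lp_le_mono: "Lp_le p f C \<Longrightarrow> C \<le> C' \<Longrightarrow> Lp_le p f C'"
proof -
  assume f: "Lp_le p f C" and CC: "C \<le> C'"
  then have "ennreal (C powr enn2real p) \<le> ennreal (C' powr enn2real p)"
    by (intro ennreal_leI powr_mono2) (auto simp: Lp_le_def)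
  with f CC show "Lp_le p f C'"
    unfolding Lp_le_def by (auto elim!: eventually_mono intro: order_trans)
qed

lemma Lp_le_Lp_norm:
  assumes "1 \<le> p" "f \<in> Lp_space haar p"
  shows "Lp_le p f (Lp_norm haar p f)"
  using assms(1)
proof (cases rule: ennreal_exponent_cases)
  case 1
  then have f: "strongly_measurable haar f" "esssup haar (\<lambda>x. ennreal (norm (f x))) < \<infinity>"
    using assms(2) by (auto simp: Lp_space_def)
  have "AE \<omega> in haar. norm (f \<omega>) \<le> Lp_norm haar p f"
    using esssup_AE[of "\<lambda>x. ennreal (norm (f x))" haar]
  proof eventually_elim
    case (elim \<omega>)
    then have "ennreal (norm (f \<omega>)) \<le> ennreal (Lp_norm haar p f)"
      using f 1 by (simp add: Lp_norm_def)
    then show ?case by (simp add: ennreal_le_iff Lp_norm_nonneg)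
  qed
  then show ?thesis using f 1 by (simp add: Lp_le_def Lp_norm_nonneg)
next
  case 2
  let ?I = "\<integral>\<^sup>+\<omega>. ennreal (norm (f \<omega>) powr enn2real p) \<partial>haar"
  have f: "strongly_measurable haar f" "?I < \<infinity>"
    using assms(2) 2 by (auto simp: Lp_space_def)
  have "Lp_norm haar p f powr enn2real p = enn2real ?I"
    using 2 by (simp add: Lp_norm_def powr_powr)
  then show ?thesis using f 2 by (simp add: Lp_le_def Lp_norm_nonneg)
qed

lemma Lp_le_imp_Lp_space:
  assumes "Lp_le p f C"
  shows "f \<in> Lp_space haar p"
proof (cases "p = \<infinity>")
  case True
  have f: "strongly_measurable haar f" "AE \<omega> in haar. norm (f \<omega>) \<le> C"
    using assms True by (auto simp: Lp_le_def)
  have "esssup haar (\<lambda>x. ennreal (norm (f x))) \<le> ennreal C"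
    using f(2) strongly_measurable_norm[OF f(1)] by (intro esssup_I) (auto elim!: eventually_mono intro: ennreal_leI)
  then have "esssup haar (\<lambda>x. ennreal (norm (f x))) < \<infinity>"
    using ennreal_less_top by (auto intro: le_less_trans)
  then show ?thesis using f True by (simp add: Lp_space_def)
next
  case False
  then show ?thesis
    using assms le_less_trans[OF _ ennreal_less_top] by (fastforce simp: Lp_le_def Lp_space_def)
qed

lemma Lp_norm_le:
  assumes "1 \<le> p" "Lp_le p f C"
  shows "Lp_norm haar p f \<le> C"
  using assms(1)
proof (cases rule: ennreal_exponent_cases)
  case 1
  have f: "strongly_measurable haar f" "AE \<omega> in haar. norm (f \<omega>) \<le> C" "0 \<le> C"
    using assms(2) 1 by (auto simp: Lp_le_def)
  have "esssup haar (\<lambda>x. ennreal (norm (f x))) \<le> ennreal C"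
    using f(2) strongly_measurable_norm[OF f(1)] by (intro esssup_I) (auto elim!: eventually_mono intro: ennreal_leI)
  then have "enn2real (esssup haar (\<lambda>x. ennreal (norm (f x)))) \<le> C"
    using f(3) by (intro enn2real_leI)
  then show ?thesis using 1 by (simp add: Lp_norm_def)
next
  case 2
  let ?I = "\<integral>\<^sup>+\<omega>. ennreal (norm (f \<omega>) powr enn2real p) \<partial>haar"
  have "enn2real ?I \<le> C powr enn2real p"
    using assms(2) 2 by (intro enn2real_leI) (auto simp: Lp_le_def)
  then have "enn2real ?I powr (1 / enn2real p) \<le> (C powr enn2real p) powr (1 / enn2real p)"
    using 2 by (intro powr_mono2) auto
  then show ?thesis
    using 2 Lp_le_nonneg[OF assms(2)] by (simp add: Lp_norm_def powr_powr)
qed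

lemma Lp_le_limit:
  assumes F: "\<And>n. Lp_le p (F n) C" and f: "strongly_measurable haar f"
    and lim: "AE \<omega> in haar. (\<lambda>n::nat. F n \<omega>) \<longlonglongrightarrow> f \<omega>"
    and p: "1 \<le> p"
  shows "Lp_le p f C"
  using p
proof (cases rule: ennreal_exponent_cases)
  case 1
  have "AE \<omega> in haar. \<forall>n. norm (F n \<omega>) \<le> C"
    using F 1 by (subst AE_all_countable) (simp add: Lp_le_def)
  then have "AE \<omega> in haar. norm (f \<omega>) \<le> C"
    using lim by eventually_elim (rule LIMSEQ_le_const2[OF tendsto_norm], auto)
  then show ?thesis using 1 f F[of 0] by (simp add: Lp_le_def)
next
  case 2
  define r where "r = enn2real p"
  have r: "r \<ge> 1" using 2 by (simp add: r_def)
  have "(\<integral>\<^sup>+\<omega>. ennreal (norm (f \<omega>) powr r) \<partial>haar)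
    = (\<integral>\<^sup>+\<omega>. liminf (\<lambda>n. ennreal (norm (F n \<omega>) powr r)) \<partial>haar)"
  proof (rule nn_integral_cong_AE)
    show "AE \<omega> in haar. ennreal (norm (f \<omega>) powr r) = liminf (\<lambda>n. ennreal (norm (F n \<omega>) powr r))"
      using lim
    proof eventually_elim
      case (elim \<omega>)
      have "(\<lambda>n. norm (F n \<omega>) powr r) \<longlonglongrightarrow> norm (f \<omega>) powr r"
        using r by (intro tendsto_powr2 tendsto_norm elim tendsto_const) auto
      from tendsto_ennrealI[OF this] show ?case
        by (intro lim_imp_Liminf[symmetric]) simp_all
    qed
  qed
  also have "\<dots> \<le> liminf (\<lambda>n. \<integral>\<^sup>+\<omega>. ennreal (norm (F n \<omega>) powr r) \<partial>haar)"
  proof (rule nn_integral_liminf)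
    fix n
    note [measurable] = strongly_measurable_norm[OF Lp_le_measurable[OF F[of n]]]
    show "(\<lambda>\<omega>. ennreal (norm (F n \<omega>) powr r)) \<in> borel_measurable haar" by measurable
  qed
  also have "\<dots> \<le> ennreal (C powr r)"
  proof -
    have "(\<integral>\<^sup>+\<omega>. ennreal (norm (F n \<omega>) powr r) \<partial>haar) \<le> ennreal (C powr r)" for n
      using F[of n] 2 by (simp add: Lp_le_def r_def)
    then have "liminf (\<lambda>n. \<integral>\<^sup>+\<omega>. ennreal (norm (F n \<omega>) powr r) \<partial>haar) \<le> liminf (\<lambda>n::nat. ennreal (C powr r))"
      by (intro Liminf_mono) simp
    then show ?thesis by (simp add: Liminf_const)
  qed
  finally show ?thesis using 2 f F[of 0] by (simp add: Lp_le_def r_def)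
qed

lemma powr_add_le:
  fixes a b :: real
  assumes "0 \<le> a" "0 \<le> b" "1 \<le> r"
  shows "(a + b) powr r \<le> 2 powr r * (a powr r + b powr r)"
proof -
  have "(a + b) powr r \<le> (2 * max a b) powr r"
    using assms by (intro powr_mono2) auto
  also have "\<dots> = 2 powr r * max a b powr r"
    using assms by (simp add: powr_mult)
  also have "max a b powr r \<le> a powr r + b powr r"
    by (simp add: max_def)
  finally show ?thesis by simp
qed

lemma nn_integral_powr_add_le:
  assumes "strongly_measurable M f" "strongly_measurable M g" "1 \<le> r"
  shows "(\<integral>\<^sup>+x. ennreal (norm (f x + g x) powr r) \<partial>M) \<le> ennreal (2 powr r) *
    ((\<integral>\<^sup>+x. ennreal (norm (f x) powr r) \<partial>M) + (\<integral>\<^sup>+x. ennreal (norm (g x) powr r) \<partial>M))"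
proof -
  note [measurable] = assms(1,2)[THEN strongly_measurable_norm]
  have "norm (f x + g x) powr r \<le> 2 powr r * (norm (f x) powr r + norm (g x) powr r)" for x
    using assms(3) by (intro order_trans[OF powr_mono2[OF _ _ norm_triangle_ineq] powr_add_le]) auto
  then have "(\<integral>\<^sup>+x. ennreal (norm (f x + g x) powr r) \<partial>M)
    \<le> (\<integral>\<^sup>+x. ennreal (2 powr r) * (ennreal (norm (f x) powr r) + ennreal (norm (g x) powr r)) \<partial>M)"
    by (intro nn_integral_mono) (simp flip: ennreal_mult ennreal_plus)
  also have "\<dots> = ennreal (2 powr r) *
    ((\<integral>\<^sup>+x. ennreal (norm (f x) powr r) \<partial>M) + (\<integral>\<^sup>+x. ennreal (norm (g x) powr r) \<partial>M))"
    by (subst nn_integral_cmult) (auto simp: nn_integral_add)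
  finally show ?thesis .
qed

lemma Lp_space_add:
  assumes "1 \<le> p" "f \<in> Lp_space haar p" "g \<in> Lp_space haar p"
  shows "(\<lambda>\<omega>. f \<omega> + g \<omega>) \<in> Lp_space haar p"
proof -
  have m: "strongly_measurable haar f" "strongly_measurable haar g"
    using assms by (auto simp: Lp_space_def)
  from assms(1) show ?thesis
  proof (cases rule: ennreal_exponent_cases)
    case 1
    have "AE \<omega> in haar. norm (f \<omega>) \<le> Lp_norm haar p f" "AE \<omega> in haar. norm (g \<omega>) \<le> Lp_norm haar p g"
      using Lp_le_Lp_norm[OF assms(1,2)] Lp_le_Lp_norm[OF assms(1,3)] 1 by (auto simp: Lp_le_def)
    then have "AE \<omega> in haar. norm (f \<omega> + g \<omega>) \<le> Lp_norm haar p f + Lp_norm haar p g"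
      by eventually_elim (rule norm_triangle_mono)
    then show ?thesis
      using 1 by (intro Lp_le_imp_Lp_space[of _ _ "Lp_norm haar p f + Lp_norm haar p g"])
        (simp add: Lp_le_def Lp_norm_nonneg strongly_measurable_add m)
  next
    case 2
    have "(\<integral>\<^sup>+x. ennreal (norm (f x) powr enn2real p) \<partial>haar) < \<infinity>"
      "(\<integral>\<^sup>+x. ennreal (norm (g x) powr enn2real p) \<partial>haar) < \<infinity>"
      using assms 2 by (auto simp: Lp_space_def)
    then have "(\<integral>\<^sup>+x. ennreal (norm (f x + g x) powr enn2real p) \<partial>haar) < \<infinity>"
      using nn_integral_powr_add_le[OF m 2(2)]
      by (intro le_less_trans[OF nn_integral_powr_add_le[OF m 2(2)]]) (simp add: ennreal_mult_less_top)
    then show ?thesis using 2 strongly_measurable_add[OF m] by (simp add: Lp_space_def)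
  qed
qed

lemma Lp_le_scaleC:
  fixes f :: "(nat \<Rightarrow> complex) \<Rightarrow> 'x::complex_banach"
  assumes "1 \<le> p" "Lp_le p f C"
  shows "Lp_le p (\<lambda>\<omega>. c *\<^sub>C f \<omega>) (cmod c * C)"
proof -
  have m: "strongly_measurable haar f" and C: "0 \<le> C"
    using assms(2) by (auto simp: Lp_le_def)
  have m': "strongly_measurable haar (\<lambda>\<omega>. c *\<^sub>C f \<omega>)"
    by (rule strongly_measurable_scaleC[OF strongly_measurable_const m])
  from assms(1) show ?thesis
  proof (cases rule: ennreal_exponent_cases)
    case 1
    then have "AE \<omega> in haar. norm (f \<omega>) \<le> C"
      using assms by (simp add: Lp_le_def)
    then have "AE \<omega> in haar. norm (c *\<^sub>C f \<omega>) \<le> cmod c * C"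
      by eventually_elim (simp add: norm_scaleC mult_left_mono)
    then show ?thesis using 1 m' C by (simp add: Lp_le_def)
  next
    case 2
    note [measurable] = strongly_measurable_norm[OF m]
    have "(\<integral>\<^sup>+\<omega>. ennreal (norm (c *\<^sub>C f \<omega>) powr enn2real p) \<partial>haar)
      = ennreal (cmod c powr enn2real p) * (\<integral>\<^sup>+\<omega>. ennreal (norm (f \<omega>) powr enn2real p) \<partial>haar)"
      by (subst nn_integral_cmult[symmetric]) (auto simp: norm_scaleC powr_mult ennreal_mult)
    also have "\<dots> \<le> ennreal (cmod c powr enn2real p) * ennreal (C powr enn2real p)"
      using assms(2) 2 by (intro mult_left_mono) (auto simp: Lp_le_def)
    also have "\<dots> = ennreal ((cmod c * C) powr enn2real p)"
      using C by (simp add: powr_mult ennreal_mult)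
    finally show ?thesis using 2 m' C by (simp add: Lp_le_def)
  qed
qed

lemma Lp_space_scaleC:
  fixes f :: "(nat \<Rightarrow> complex) \<Rightarrow> 'x::complex_banach"
  assumes "1 \<le> p" "f \<in> Lp_space haar p"
  shows "(\<lambda>\<omega>. c *\<^sub>C f \<omega>) \<in> Lp_space haar p"
  by (rule Lp_le_imp_Lp_space[OF Lp_le_scaleC[OF assms(1) Lp_le_Lp_norm[OF assms]]])

lemma Lp_le_bounded:
  assumes "1 \<le> p" "strongly_measurable haar f" "0 \<le> C" "\<And>\<omega>. \<omega> \<in> torus \<Longrightarrow> norm (f \<omega>) \<le> C"
  shows "Lp_le p f C"
  using assms(1)
proof (cases rule: ennreal_exponent_cases)
  case 1
  have "AE \<omega> in haar. norm (f \<omega>) \<le> C"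
    by (rule AE_I2) (use assms(4) in \<open>simp add: space_haar\<close>)
  then show ?thesis
    using 1 assms by (simp add: Lp_le_def)
next
  case 2
  have "(\<integral>\<^sup>+\<omega>. ennreal (norm (f \<omega>) powr enn2real p) \<partial>haar) \<le> (\<integral>\<^sup>+\<omega>. ennreal (C powr enn2real p) \<partial>haar)"
    using assms 2 by (intro nn_integral_mono ennreal_leI powr_mono2) (auto simp: space_haar)
  then show ?thesis using 2 assms by (simp add: Lp_le_def)
qed

lemma conjugate_exponent_ge_1:
  fixes p p' :: ennreal
  assumes "1 \<le> p" "1 / p + 1 / p' = 1"
  shows "1 \<le> p'"
  using assms
proof (cases rule: conjugate_exponent_cases)
  case 3
  then have "ennreal 1 \<le> ennreal (enn2real p')" by (intro ennreal_leI) simp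
  moreover have "ennreal (enn2real p') = p'" using 3 by (simp add: less_top)
  ultimately show ?thesis by simp
qed simp_all

section \<open>The Banach lattices on the torus\<close>

lemma continuous_torus_bdd: "continuous_on torus (f :: _ \<Rightarrow> complex) \<Longrightarrow> bdd_above ((\<lambda>\<omega>. cmod (f \<omega>)) ` torus)"
  by (intro bounded_imp_bdd_above compact_imp_bounded compact_continuous_image compact_torus continuous_on_norm)

lemma torus_lattice_infinity_eq:
  "elements (torus_lattice \<infinity>) = {f. continuous_on torus f}"
  "lattice_norm (torus_lattice \<infinity>) = (\<lambda>f. SUP \<omega>\<in>torus. cmod (f \<omega>))"
  "positives (torus_lattice \<infinity>) = {f. continuous_on torus f \<and> (\<forall>\<omega>\<in>torus. f \<omega> \<in> \<real>\<^sub>\<ge>\<^sub>0)}"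
  by (simp_all add: torus_lattice_def)

lemmas torus_lattice_infinity = torus_lattice_infinity_eq torus_lattice_infinity_eq[unfolded infinity_ennreal_def]

lemma torus_lattice_finite:
  assumes "q \<noteq> \<infinity>"
  shows "elements (torus_lattice q) = Lp_space haar q"
    "lattice_norm (torus_lattice q) = Lp_norm haar q"
    "positives (torus_lattice q) = {f \<in> Lp_space haar q. AE \<omega> in haar. f \<omega> \<in> \<real>\<^sub>\<ge>\<^sub>0}"
  using assms by (simp_all add: torus_lattice_def)

lemma cmod_le_lattice_norm_infinity:
  "continuous_on torus f \<Longrightarrow> \<omega> \<in> torus \<Longrightarrow> cmod (f \<omega>) \<le> lattice_norm (torus_lattice \<infinity>) f"
  unfolding torus_lattice_infinity_eq by (rule cSUP_upper[OF _ continuous_torus_bdd])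

lemma torus_lattice_measurable:
  assumes "h \<in> elements (torus_lattice q)"
  shows "h \<in> borel_measurable haar" "strongly_measurable haar h"
proof -
  have "h \<in> borel_measurable haar"
  proof (cases "q = \<infinity>")
    case True
    then show ?thesis using assms by (simp add: torus_lattice_infinity borel_measurable_haar_continuous)
  next
    case False
    then show ?thesis
      using assms by (simp add: torus_lattice_finite Lp_space_def strongly_measurable_iff_borel_measurable)
  qed
  then show "h \<in> borel_measurable haar" "strongly_measurable haar h"
    by (simp_all add: strongly_measurable_iff_borel_measurable)
qed

lemma torus_lattice_add:
  assumes "1 \<le> q" "f \<in> elements (torus_lattice q)" "g \<in> elements (torus_lattice q)"
  shows "(\<lambda>\<omega>. f \<omega> + g \<omega>) \<in> elements (torus_lattice q)"
  using assms
  by (cases "q = \<infinity>") (auto simp: torus_lattice_infinity torus_lattice_finite intro: continuous_on_add Lp_space_add)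

lemma torus_lattice_cmult:
  assumes "1 \<le> q" "f \<in> elements (torus_lattice q)"
  shows "(\<lambda>\<omega>. c * f \<omega>) \<in> elements (torus_lattice q)"
  using assms Lp_space_scaleC[of q f c]
  by (cases "q = \<infinity>") (auto simp: torus_lattice_infinity torus_lattice_finite scaleC_complex_def intro!: continuous_intros)

lemma torus_lattice_diff:
  assumes "1 \<le> q" "f \<in> elements (torus_lattice q)" "g \<in> elements (torus_lattice q)"
  shows "(\<lambda>\<omega>. f \<omega> - g \<omega>) \<in> elements (torus_lattice q)"
  using torus_lattice_add[OF assms(1,2) torus_lattice_cmult[OF assms(1,3), of "- 1"]] by simp

lemma continuous_bounded_lattice:
  assumes "1 \<le> q" "continuous_on torus h" "\<And>\<omega>. \<omega> \<in> torus \<Longrightarrow> cmod (h \<omega>) \<le> B"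
  shows "h \<in> elements (torus_lattice q)" "lattice_norm (torus_lattice q) h \<le> B"
proof -
  have "0 \<le> B"
    using assms(3)[OF one_in_torus] norm_ge_zero order_trans by blast
  have "strongly_measurable haar h"
    by (simp add: strongly_measurable_iff_borel_measurable borel_measurable_haar_continuous assms(2))
  then have L: "Lp_le q h B"
    by (intro Lp_le_bounded assms \<open>0 \<le> B\<close>)
  show "h \<in> elements (torus_lattice q)"
    using Lp_le_imp_Lp_space[OF L] assms(2)
    by (cases "q = \<infinity>") (simp_all add: torus_lattice_infinity torus_lattice_finite)
  show "lattice_norm (torus_lattice q) h \<le> B"
  proof (cases "q = \<infinity>")
    case True
    then show ?thesis
      using assms(3) torus_nonempty by (auto simp: torus_lattice_infinity intro!: cSUP_least)
  next
    case False
    then show ?thesis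
      using Lp_norm_le[OF assms(1) L] by (simp add: torus_lattice_finite)
  qed
qed

lemma continuous_in_lattice:
  assumes "1 \<le> q" "continuous_on torus h"
  shows "h \<in> elements (torus_lattice q)"
  by (rule continuous_bounded_lattice(1)[OF assms]) (rule cmod_le_lattice_norm_infinity[OF assms(2)])

lemma lattice_norm_nonneg:
  assumes "h \<in> elements (torus_lattice q)"
  shows "0 \<le> lattice_norm (torus_lattice q) h"
proof (cases "q = \<infinity>")
  case True
  then have "cmod (h (\<lambda>_. 1)) \<le> lattice_norm (torus_lattice q) h"
    using assms by (simp only: cmod_le_lattice_norm_infinity one_in_torus torus_lattice_infinity(1) mem_Collect_eq)
  then show ?thesis using norm_ge_zero order_trans by blast
qed (simp add: torus_lattice_finite Lp_norm_nonneg)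

lemma trig_polynomial_in_lattice: "1 \<le> q \<Longrightarrow> trig_polynomial P \<Longrightarrow> P \<in> elements (torus_lattice q)"
  by (intro continuous_in_lattice continuous_on_trig_polynomial)

lemma monomial_in_lattice: "1 \<le> q \<Longrightarrow> monomial \<alpha> \<in> elements (torus_lattice q)"
  by (intro continuous_in_lattice continuous_on_monomial)

lemma lattice_pairing:
  fixes f :: "(nat \<Rightarrow> complex) \<Rightarrow> 'x::real_normed_vector"
  assumes p: "1 \<le> p" "1 / p + 1 / p' = 1" and h: "h \<in> elements (torus_lattice p')" and f: "Lp_le p f C"
  shows "(\<integral>\<^sup>+\<omega>. ennreal (cmod (h \<omega>) * norm (f \<omega>)) \<partial>haar) \<le> ennreal (lattice_norm (torus_lattice p') h * C)"
proof -
  note [measurable] = torus_lattice_measurable(1)[OF h] strongly_measurable_norm[OF Lp_le_measurable[OF f]]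
  have C: "0 \<le> C" by (rule Lp_le_nonneg[OF f])
  note N = lattice_norm_nonneg[OF h]
  from p show ?thesis
  proof (cases rule: conjugate_exponent_cases)
    case 1
    have "continuous_on torus h" using h 1 by (simp add: torus_lattice_infinity)
    then have "(\<integral>\<^sup>+\<omega>. ennreal (cmod (h \<omega>) * norm (f \<omega>)) \<partial>haar)
      \<le> (\<integral>\<^sup>+\<omega>. ennreal (lattice_norm (torus_lattice p') h) * ennreal (norm (f \<omega>)) \<partial>haar)"
      using N 1 cmod_le_lattice_norm_infinity
      by (intro nn_integral_mono) (auto simp: space_haar simp flip: ennreal_mult intro!: ennreal_leI mult_right_mono)
    also have "\<dots> = ennreal (lattice_norm (torus_lattice p') h) * (\<integral>\<^sup>+\<omega>. ennreal (norm (f \<omega>)) \<partial>haar)"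
      by (rule nn_integral_cmult) measurable
    also have "\<dots> \<le> ennreal (lattice_norm (torus_lattice p') h) * ennreal C"
      using f 1 C by (intro mult_left_mono) (auto simp: Lp_le_def)
    finally show ?thesis using N C by (simp add: ennreal_mult)
  next
    case 2
    have "Lp_le p' h (lattice_norm (torus_lattice p') h)"
      using h 2 by (simp add: torus_lattice_finite Lp_le_Lp_norm)
    then have H: "(\<integral>\<^sup>+\<omega>. ennreal (cmod (h \<omega>)) \<partial>haar) \<le> ennreal (lattice_norm (torus_lattice p') h)"
      using 2 N by (auto simp: Lp_le_def abs_of_nonneg)
    have "AE \<omega> in haar. norm (f \<omega>) \<le> C" using f 2 by (simp add: Lp_le_def)
    then have "AE \<omega> in haar. ennreal (cmod (h \<omega>) * norm (f \<omega>)) \<le> ennreal C * ennreal (cmod (h \<omega>))"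
      by eventually_elim (use C in \<open>auto simp: mult.commute[of C] simp flip: ennreal_mult intro!: ennreal_leI mult_left_mono\<close>)
    then have "(\<integral>\<^sup>+\<omega>. ennreal (cmod (h \<omega>) * norm (f \<omega>)) \<partial>haar) \<le> (\<integral>\<^sup>+\<omega>. ennreal C * ennreal (cmod (h \<omega>)) \<partial>haar)"
      by (rule nn_integral_mono_AE)
    also have "\<dots> = ennreal C * (\<integral>\<^sup>+\<omega>. ennreal (cmod (h \<omega>)) \<partial>haar)"
      by (rule nn_integral_cmult) measurable
    also have "\<dots> \<le> ennreal C * ennreal (lattice_norm (torus_lattice p') h)"
      by (intro mult_left_mono H) simp
    finally show ?thesis using N C by (simp add: ennreal_mult mult.commute)
  next
    case 3
    have "1 \<le> p'" by (rule conjugate_exponent_ge_1[OF p])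
    then have "Lp_le p' h (lattice_norm (torus_lattice p') h)"
      using h 3 by (simp add: torus_lattice_finite Lp_le_Lp_norm)
    then have "(\<integral>\<^sup>+\<omega>. ennreal (cmod (h \<omega>) powr enn2real p') \<partial>haar)
        \<le> ennreal (lattice_norm (torus_lattice p') h powr enn2real p')"
      using 3 by (simp add: Lp_le_def)
    moreover have "(\<integral>\<^sup>+\<omega>. ennreal (norm (f \<omega>) powr enn2real p) \<partial>haar) \<le> ennreal (C powr enn2real p)"
      using 3 f by (simp add: Lp_le_def)
    ultimately show ?thesis
      using 3 N C by (intro nn_integral_Hoelder[of _ _ _ "enn2real p'" "enn2real p"]) auto
  qed
qed

lemma Lp_le_imp_L1:
  assumes p: "1 \<le> p" "1 / p + 1 / p' = 1" and f: "Lp_le p f C"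
  shows "(\<integral>\<^sup>+\<omega>. ennreal (norm (f \<omega>)) \<partial>haar) \<le> ennreal C"
proof -
  note p' = conjugate_exponent_ge_1[OF p]
  have 1: "(\<lambda>_. 1) \<in> elements (torus_lattice p')" "lattice_norm (torus_lattice p') (\<lambda>_. 1) \<le> 1"
    by (rule continuous_bounded_lattice[OF p', where B = 1]; simp)+
  have "(\<integral>\<^sup>+\<omega>. ennreal (norm (f \<omega>)) \<partial>haar) \<le> ennreal (lattice_norm (torus_lattice p') (\<lambda>_. 1) * C)"
    using lattice_pairing[OF p 1(1) f] by simp
  also have "\<dots> \<le> ennreal C"
    using mult_right_mono[OF 1(2) Lp_le_nonneg[OF f]] by (intro ennreal_leI) simp
  finally show ?thesis .
qed

lemma strongly_integrable_pairing:
  fixes f :: "(nat \<Rightarrow> complex) \<Rightarrow> 'x::complex_banach"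
  assumes p: "1 \<le> p" "1 / p + 1 / p' = 1" and h: "h \<in> elements (torus_lattice p')" and f: "Lp_le p f C"
  shows "strongly_integrable haar (\<lambda>\<omega>. h \<omega> *\<^sub>C f \<omega>)"
proof (rule strongly_integrableI)
  show "strongly_measurable haar (\<lambda>\<omega>. h \<omega> *\<^sub>C f \<omega>)"
    by (rule strongly_measurable_scaleC[OF torus_lattice_measurable(2)[OF h] Lp_le_measurable[OF f]])
  show "(\<integral>\<^sup>+\<omega>. ennreal (norm (h \<omega> *\<^sub>C f \<omega>)) \<partial>haar) \<le> ennreal (lattice_norm (torus_lattice p') h * C)"
    using lattice_pairing[OF p h f] by (simp add: norm_scaleC)
qed

section \<open>Density in the Banach lattices\<close>

text \<open>Closeness is measured by the \<open>r\<close>-th power of the norm: for sums the crude factor \<open>2\<^sup>r\<close> then takes the place of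
  Minkowski's inequality.\<close>

definition trig_approximable :: "real \<Rightarrow> ((nat \<Rightarrow> complex) \<Rightarrow> complex) \<Rightarrow> bool"
  where "trig_approximable r h \<longleftrightarrow> h \<in> borel_measurable haar \<and>
    (\<forall>e>0. \<exists>P. trig_polynomial P \<and> (\<integral>\<^sup>+\<omega>. ennreal (cmod (h \<omega> - P \<omega>) powr r) \<partial>haar) < ennreal e)"

lemma trig_polynomial_measurable: "trig_polynomial P \<Longrightarrow> P \<in> borel_measurable haar"
  by (intro borel_measurable_haar_continuous continuous_on_trig_polynomial)

lemma nn_integral_powr_cmod_add_less:
  assumes "f \<in> borel_measurable M" "g \<in> borel_measurable M" "1 \<le> r" "0 < e"
    and "(\<integral>\<^sup>+x. ennreal (cmod (f x) powr r) \<partial>M) < ennreal (e / 2 powr (r + 1))"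
    and "(\<integral>\<^sup>+x. ennreal (cmod (g x) powr r) \<partial>M) < ennreal (e / 2 powr (r + 1))"
  shows "(\<integral>\<^sup>+x. ennreal (cmod (f x + g x) powr r) \<partial>M) < ennreal e"
proof -
  have "(\<integral>\<^sup>+x. ennreal (cmod (f x + g x) powr r) \<partial>M) \<le> ennreal (2 powr r) *
    ((\<integral>\<^sup>+x. ennreal (cmod (f x) powr r) \<partial>M) + (\<integral>\<^sup>+x. ennreal (cmod (g x) powr r) \<partial>M))"
    by (rule nn_integral_powr_add_le) (use assms in \<open>simp_all add: strongly_measurable_iff_borel_measurable\<close>)
  also have "\<dots> < ennreal (2 powr r) * (ennreal (e / 2 powr (r + 1)) + ennreal (e / 2 powr (r + 1)))"
    by (intro ennreal_mult_strict_left_mono add_strict_mono assms) auto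
  also have "\<dots> = ennreal e"
    using assms(4) by (simp flip: ennreal_mult ennreal_plus add: powr_add)
  finally show ?thesis .
qed

lemma trig_approximable_add:
  assumes "1 \<le> r" "trig_approximable r f" "trig_approximable r g"
  shows "trig_approximable r (\<lambda>\<omega>. f \<omega> + g \<omega>)"
  unfolding trig_approximable_def
proof (intro conjI allI impI)
  show "(\<lambda>\<omega>. f \<omega> + g \<omega>) \<in> borel_measurable haar"
    using assms by (auto simp: trig_approximable_def)
  fix e :: real assume e: "0 < e"
  then have e': "0 < e / 2 powr (r + 1)" by simp
  obtain P where P: "trig_polynomial P" "(\<integral>\<^sup>+\<omega>. ennreal (cmod (f \<omega> - P \<omega>) powr r) \<partial>haar) < ennreal (e / 2 powr (r + 1))"
    using assms(2) e' unfolding trig_approximable_def by blast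
  obtain Q where Q: "trig_polynomial Q" "(\<integral>\<^sup>+\<omega>. ennreal (cmod (g \<omega> - Q \<omega>) powr r) \<partial>haar) < ennreal (e / 2 powr (r + 1))"
    using assms(3) e' unfolding trig_approximable_def by blast
  have "(\<integral>\<^sup>+\<omega>. ennreal (cmod ((f \<omega> - P \<omega>) + (g \<omega> - Q \<omega>)) powr r) \<partial>haar) < ennreal e"
    using assms P Q e trig_polynomial_measurable
    by (intro nn_integral_powr_cmod_add_less) (auto simp: trig_approximable_def intro!: borel_measurable_diff)
  then show "\<exists>P. trig_polynomial P \<and> (\<integral>\<^sup>+\<omega>. ennreal (cmod (f \<omega> + g \<omega> - P \<omega>) powr r) \<partial>haar) < ennreal e"
    using trig_polynomial_add[OF P(1) Q(1)] by (intro exI[of _ "\<lambda>\<omega>. P \<omega> + Q \<omega>"]) (simp add: algebra_simps)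
qed

lemma trig_approximable_cmult:
  assumes "1 \<le> r" "trig_approximable r f"
  shows "trig_approximable r (\<lambda>\<omega>. c * f \<omega>)"
  unfolding trig_approximable_def
proof (intro conjI allI impI)
  show "(\<lambda>\<omega>. c * f \<omega>) \<in> borel_measurable haar"
    using assms by (auto simp: trig_approximable_def)
  fix e :: real assume e: "0 < e"
  define k where "k = cmod c powr r + 1"
  have k: "k > 0" by (simp add: k_def add_nonneg_pos)
  obtain P where P: "trig_polynomial P" "(\<integral>\<^sup>+\<omega>. ennreal (cmod (f \<omega> - P \<omega>) powr r) \<partial>haar) < ennreal (e / k)"
    using assms(2) e k unfolding trig_approximable_def by (meson divide_pos_pos)
  have [measurable]: "f \<in> borel_measurable haar" "P \<in> borel_measurable haar"
    using assms P trig_polynomial_measurable by (auto simp: trig_approximable_def)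
  have "(\<integral>\<^sup>+\<omega>. ennreal (cmod (c * f \<omega> - c * P \<omega>) powr r) \<partial>haar)
    \<le> (\<integral>\<^sup>+\<omega>. ennreal k * ennreal (cmod (f \<omega> - P \<omega>) powr r) \<partial>haar)"
  proof (rule nn_integral_mono)
    fix \<omega>
    have "cmod (c * f \<omega> - c * P \<omega>) powr r \<le> k * cmod (f \<omega> - P \<omega>) powr r"
      by (simp add: right_diff_distrib[symmetric] norm_mult powr_mult k_def mult_right_mono)
    then show "ennreal (cmod (c * f \<omega> - c * P \<omega>) powr r) \<le> ennreal k * ennreal (cmod (f \<omega> - P \<omega>) powr r)"
      using k by (simp flip: ennreal_mult)
  qed
  also have "\<dots> = ennreal k * (\<integral>\<^sup>+\<omega>. ennreal (cmod (f \<omega> - P \<omega>) powr r) \<partial>haar)"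
    by (rule nn_integral_cmult) measurable
  also have "\<dots> < ennreal k * ennreal (e / k)"
    using k by (intro ennreal_mult_strict_left_mono P) auto
  also have "\<dots> = ennreal e" using k e by (simp flip: ennreal_mult)
  finally show "\<exists>P. trig_polynomial P \<and> (\<integral>\<^sup>+\<omega>. ennreal (cmod (c * f \<omega> - P \<omega>) powr r) \<partial>haar) < ennreal e"
    using trig_polynomial_cmult[OF P(1)] by (intro exI[of _ "\<lambda>\<omega>. c * P \<omega>"]) simp
qed

lemma trig_approximable_indicator:
  assumes r: "1 \<le> r" and A: "A \<in> sets haar"
  shows "trig_approximable r (indicator A)"
  unfolding trig_approximable_def
proof (intro conjI allI impI)
  show "indicator A \<in> borel_measurable haar" using A by simp
  fix e :: real assume e: "0 < e"
  define d where "d = e / 2 powr (r + 1)"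
  have d: "d > 0" using e by (simp add: d_def)
  obtain \<phi> where \<phi>: "continuous_on torus \<phi>" "\<And>\<omega>. 0 \<le> \<phi> \<omega>" "\<And>\<omega>. \<phi> \<omega> \<le> (1::real)"
    "(\<integral>\<^sup>+\<omega>. ennreal \<bar>indicator A \<omega> - \<phi> \<omega>\<bar> \<partial>haar) < ennreal d"
    using indicator_approx_continuous[OF prob_space.finite_measure[OF prob_space_haar] refl A d] by blast
  define d' where "d' = min 1 (d / 2)"
  have d': "0 < d'" "d' \<le> 1" "d' < d" using d by (auto simp: d'_def)
  obtain P where P: "trig_polynomial P" "\<And>\<omega>. \<omega> \<in> torus \<Longrightarrow> cmod (complex_of_real (\<phi> \<omega>) - P \<omega>) < d'"
    using trig_polynomial_dense[OF continuous_on_of_real[OF \<phi>(1)] d'(1)] by blast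
  have small: "x powr r \<le> x" if "0 \<le> x" "x \<le> 1" for x :: real
    using powr_mono'[of 1 r x] that r by (cases "x = 0") auto
  note [measurable] = borel_measurable_haar_continuous[OF \<phi>(1)] trig_polynomial_measurable[OF P(1)] A
  have "(\<integral>\<^sup>+\<omega>. ennreal (cmod (indicator A \<omega> - complex_of_real (\<phi> \<omega>)) powr r) \<partial>haar)
    \<le> (\<integral>\<^sup>+\<omega>. ennreal \<bar>indicator A \<omega> - \<phi> \<omega>\<bar> \<partial>haar)"
  proof (intro nn_integral_mono ennreal_leI)
    fix \<omega>
    have "cmod (indicator A \<omega> - complex_of_real (\<phi> \<omega>)) = \<bar>indicator A \<omega> - \<phi> \<omega>\<bar>"
      by (metis norm_of_real of_real_diff of_real_indicator real_norm_def)
    moreover have "\<bar>indicator A \<omega> - \<phi> \<omega>\<bar> \<le> 1"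
      using \<phi>(2,3)[of \<omega>] by (auto simp: indicator_def)
    ultimately show "cmod (indicator A \<omega> - complex_of_real (\<phi> \<omega>)) powr r \<le> \<bar>indicator A \<omega> - \<phi> \<omega>\<bar>"
      using small by simp
  qed
  with \<phi>(4) have 1: "(\<integral>\<^sup>+\<omega>. ennreal (cmod (indicator A \<omega> - complex_of_real (\<phi> \<omega>)) powr r) \<partial>haar) < ennreal d"
    by (rule le_less_trans[rotated])
  have "(\<integral>\<^sup>+\<omega>. ennreal (cmod (complex_of_real (\<phi> \<omega>) - P \<omega>) powr r) \<partial>haar) \<le> (\<integral>\<^sup>+\<omega>. ennreal d' \<partial>haar)"
  proof (intro nn_integral_mono ennreal_leI)
    fix \<omega> assume "\<omega> \<in> space haar"
    then have "cmod (complex_of_real (\<phi> \<omega>) - P \<omega>) \<le> d'"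
      using P(2) by (simp add: space_haar less_imp_le)
    then show "cmod (complex_of_real (\<phi> \<omega>) - P \<omega>) powr r \<le> d'"
      using small[of "cmod (complex_of_real (\<phi> \<omega>) - P \<omega>)"] d' by simp
  qed
  then have 2: "(\<integral>\<^sup>+\<omega>. ennreal (cmod (complex_of_real (\<phi> \<omega>) - P \<omega>) powr r) \<partial>haar) < ennreal d"
    using d' by (auto intro: le_less_trans simp: ennreal_less_iff)
  have "(\<integral>\<^sup>+\<omega>. ennreal (cmod ((indicator A \<omega> - complex_of_real (\<phi> \<omega>)) + (complex_of_real (\<phi> \<omega>) - P \<omega>)) powr r) \<partial>haar) < ennreal e"
    using r e 1 2 by (intro nn_integral_powr_cmod_add_less) (auto simp: d_def)
  then show "\<exists>P. trig_polynomial P \<and> (\<integral>\<^sup>+\<omega>. ennreal (cmod (indicator A \<omega> - P \<omega>) powr r) \<partial>haar) < ennreal e"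
    using P(1) by (intro exI[of _ P]) simp
qed

lemma trig_approximable_simple_function:
  assumes r: "1 \<le> r" and s: "simple_function haar s"
  shows "trig_approximable r s"
proof -
  have sum: "trig_approximable r (\<lambda>\<omega>. \<Sum>y\<in>Y. y * indicator (s -` {y} \<inter> space haar) \<omega>)"
    if "finite Y" "Y \<subseteq> s ` space haar" for Y
    using that
  proof (induction Y rule: finite_induct)
    case empty
    then show ?case
      using trig_approximable_cmult[OF r trig_approximable_indicator[OF r sets.empty_sets], of 0] by simp
  next
    case (insert y Y)
    have "s -` {y} \<inter> space haar \<in> sets haar" using s by (rule simple_functionD(2))
    from trig_approximable_cmult[OF r trig_approximable_indicator[OF r this], of y]
    show ?case
      using trig_approximable_add[OF r _ insert.IH] insert.hyps insert.prems
      by (simp only: sum.insert insert_subset simp_thms)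
  qed
  have eq: "s \<omega> = (\<Sum>y\<in>s ` space haar. y * indicator (s -` {y} \<inter> space haar) \<omega>)" if "\<omega> \<in> space haar" for \<omega>
  proof -
    have "(\<Sum>y\<in>s ` space haar. y * indicator (s -` {y} \<inter> space haar) \<omega>) = (\<Sum>y\<in>s ` space haar. if y = s \<omega> then y else 0)"
      using that by (intro sum.cong) (auto simp: indicator_def)
    then show ?thesis using that simple_functionD(1)[OF s] by simp
  qed
  have "trig_approximable r (\<lambda>\<omega>. \<Sum>y\<in>s ` space haar. y * indicator (s -` {y} \<inter> space haar) \<omega>)"
    by (rule sum) (use simple_functionD(1)[OF s] in auto)
  then show ?thesis
    unfolding trig_approximable_def using borel_measurable_simple_function[OF s]
    by (simp add: eq[symmetric] cong: nn_integral_cong)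
qed

lemma trig_approximable_Lp:
  assumes r: "1 \<le> r" and h: "h \<in> borel_measurable haar"
    and fin: "(\<integral>\<^sup>+\<omega>. ennreal (cmod (h \<omega>) powr r) \<partial>haar) < \<infinity>"
  shows "trig_approximable r h"
  unfolding trig_approximable_def
proof (intro conjI allI impI h)
  fix e :: real assume e: "0 < e"
  then have e': "0 < e / 2 powr (r + 1)" by simp
  obtain s where s: "\<And>i::nat. simple_function haar (s i)"
    "\<And>x. x \<in> space haar \<Longrightarrow> (\<lambda>i. s i x) \<longlonglongrightarrow> h x"
    "\<And>i x. x \<in> space haar \<Longrightarrow> norm (s i x) \<le> 2 * norm (h x)"
    using strongly_measurable_dominated_simple[of haar h] h
    unfolding strongly_measurable_iff_borel_measurable by blast
  note [measurable] = h borel_measurable_simple_function[OF s(1)]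
  have "(\<lambda>i. \<integral>\<^sup>+\<omega>. ennreal (cmod (h \<omega> - s i \<omega>) powr r) \<partial>haar) \<longlonglongrightarrow> (\<integral>\<^sup>+\<omega>. 0 \<partial>haar)"
  proof (rule nn_integral_dominated_convergence[where w = "\<lambda>\<omega>. ennreal (3 powr r) * ennreal (cmod (h \<omega>) powr r)"])
    have "(\<integral>\<^sup>+\<omega>. ennreal (3 powr r) * ennreal (cmod (h \<omega>) powr r) \<partial>haar)
      = ennreal (3 powr r) * (\<integral>\<^sup>+\<omega>. ennreal (cmod (h \<omega>) powr r) \<partial>haar)"
      by (rule nn_integral_cmult) measurable
    then show "(\<integral>\<^sup>+\<omega>. ennreal (3 powr r) * ennreal (cmod (h \<omega>) powr r) \<partial>haar) < \<infinity>"
      using fin by (simp add: ennreal_mult_less_top)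
    show "AE \<omega> in haar. ennreal (cmod (h \<omega> - s i \<omega>) powr r) \<le> ennreal (3 powr r) * ennreal (cmod (h \<omega>) powr r)" for i
    proof (rule AE_I2)
      fix \<omega> assume \<omega>: "\<omega> \<in> space haar"
      have "cmod (h \<omega> - s i \<omega>) \<le> 3 * cmod (h \<omega>)"
        using norm_triangle_ineq4[of "h \<omega>" "s i \<omega>"] s(3)[OF \<omega>, of i] by linarith
      then have "cmod (h \<omega> - s i \<omega>) powr r \<le> (3 * cmod (h \<omega>)) powr r"
        using r by (intro powr_mono2) auto
      then show "ennreal (cmod (h \<omega> - s i \<omega>) powr r) \<le> ennreal (3 powr r) * ennreal (cmod (h \<omega>) powr r)"
        by (simp add: powr_mult flip: ennreal_mult)
    qed
    show "AE \<omega> in haar. (\<lambda>i. ennreal (cmod (h \<omega> - s i \<omega>) powr r)) \<longlonglongrightarrow> 0"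
    proof (rule AE_I2)
      fix \<omega> assume "\<omega> \<in> space haar"
      from s(2)[OF this] have "(\<lambda>i. cmod (h \<omega> - s i \<omega>)) \<longlonglongrightarrow> cmod (h \<omega> - h \<omega>)"
        by (intro tendsto_intros)
      then have "(\<lambda>i. cmod (h \<omega> - s i \<omega>) powr r) \<longlonglongrightarrow> 0 powr r"
        using r by (intro tendsto_powr2) auto
      from tendsto_ennrealI[OF this] show "(\<lambda>i. ennreal (cmod (h \<omega> - s i \<omega>) powr r)) \<longlonglongrightarrow> 0"
        by simp
    qed
  qed measurable
  then have "(\<lambda>i. \<integral>\<^sup>+\<omega>. ennreal (cmod (h \<omega> - s i \<omega>) powr r) \<partial>haar) \<longlonglongrightarrow> 0"
    by (simp only: nn_integral_const mult_zero_left)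
  moreover have "0 < ennreal (e / 2 powr (r + 1))"
    using e' by (subst ennreal_less_zero_iff)
  ultimately have "\<forall>\<^sub>F i in sequentially. (\<integral>\<^sup>+\<omega>. ennreal (cmod (h \<omega> - s i \<omega>) powr r) \<partial>haar) < ennreal (e / 2 powr (r + 1))"
    by (rule order_tendstoD(2))
  then obtain i where i: "(\<integral>\<^sup>+\<omega>. ennreal (cmod (h \<omega> - s i \<omega>) powr r) \<partial>haar) < ennreal (e / 2 powr (r + 1))"
    using eventually_happens'[OF sequentially_bot] by blast
  obtain P where P: "trig_polynomial P" "(\<integral>\<^sup>+\<omega>. ennreal (cmod (s i \<omega> - P \<omega>) powr r) \<partial>haar) < ennreal (e / 2 powr (r + 1))"
    using trig_approximable_simple_function[OF r s(1)[of i]] e' unfolding trig_approximable_def by blast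
  note [measurable] = trig_polynomial_measurable[OF P(1)]
  have "(\<integral>\<^sup>+\<omega>. ennreal (cmod ((h \<omega> - s i \<omega>) + (s i \<omega> - P \<omega>)) powr r) \<partial>haar) < ennreal e"
    by (rule nn_integral_powr_cmod_add_less[OF _ _ r e i P(2)]) measurable
  then show "\<exists>P. trig_polynomial P \<and> (\<integral>\<^sup>+\<omega>. ennreal (cmod (h \<omega> - P \<omega>) powr r) \<partial>haar) < ennreal e"
    using P(1) by (intro exI[of _ P]) simp
qed

lemma trig_polynomial_dense_lattice:
  assumes q: "1 \<le> q" and h: "h \<in> elements (torus_lattice q)" and e: "0 < e"
  obtains P where "trig_polynomial P" "lattice_norm (torus_lattice q) (\<lambda>\<omega>. h \<omega> - P \<omega>) \<le> e"
  using q
proof (cases rule: ennreal_exponent_cases)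
  case 1
  then have c: "continuous_on torus h" using h by (simp add: torus_lattice_infinity)
  obtain P where P: "trig_polynomial P" "\<And>\<omega>. \<omega> \<in> torus \<Longrightarrow> cmod (h \<omega> - P \<omega>) < e"
    using trig_polynomial_dense[OF c e] by blast
  show ?thesis
    by (rule that[OF P(1) continuous_bounded_lattice(2)[OF q continuous_on_diff[OF c continuous_on_trig_polynomial[OF P(1)]]]])
      (use P(2) in \<open>simp add: less_imp_le\<close>)
next
  case 2
  have hm: "h \<in> borel_measurable haar" by (rule torus_lattice_measurable[OF h])
  have "trig_approximable (enn2real q) h"
    using 2 h hm by (intro trig_approximable_Lp) (auto simp: torus_lattice_finite Lp_space_def)
  then obtain P where P: "trig_polynomial P"
    "(\<integral>\<^sup>+\<omega>. ennreal (cmod (h \<omega> - P \<omega>) powr enn2real q) \<partial>haar) < ennreal (e powr enn2real q)"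
    using e unfolding trig_approximable_def by (metis powr_gt_zero less_irrefl)
  have "Lp_le q (\<lambda>\<omega>. h \<omega> - P \<omega>) e"
    using 2 e P hm trig_polynomial_measurable[OF P(1)]
    by (simp add: Lp_le_def strongly_measurable_iff_borel_measurable less_imp_le)
  from Lp_norm_le[OF q this] show ?thesis
    using 2 by (intro that[OF P(1)]) (simp add: torus_lattice_finite)
qed

section \<open>Uniqueness of Fourier coefficients\<close>

text \<open>For a simple function \<open>s\<close> near \<open>g\<close>, the vanishing of the integrals of \<open>g\<close> over the level sets of
  \<open>s\<close> gives \<open>\<integral>\<parallel>s\<parallel> \<le> \<integral>\<parallel>g - s\<parallel>\<close>, and therefore \<open>\<integral>\<parallel>g\<parallel> \<le> 2 \<integral>\<parallel>g - s\<parallel>\<close>.\<close>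

lemma nn_integral_norm_eq_0I:
  fixes g :: "'a \<Rightarrow> 'x::banach"
  assumes M: "finite_measure M" and g: "strongly_integrable M g"
    and zero: "\<And>A. A \<in> sets M \<Longrightarrow> strong_integral M (\<lambda>x. indicator A x *\<^sub>R g x) = 0"
  shows "(\<integral>\<^sup>+x. ennreal (norm (g x)) \<partial>M) = 0"
proof -
  interpret finite_measure M by (rule M)
  have gm: "strongly_measurable M g" and fin: "(\<integral>\<^sup>+x. ennreal (norm (g x)) \<partial>M) < \<infinity>"
    using g by (auto simp: strongly_integrable_def)
  have ind: "strongly_measurable M (\<lambda>x. indicator A x *\<^sub>R f x)"
    if "A \<in> sets M" "strongly_measurable M f" for A and f :: "'a \<Rightarrow> 'x"
    by (rule strongly_measurable_compose2[of M "indicator A :: _ \<Rightarrow> real" f "(*\<^sub>R)"])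
      (use that in \<open>auto simp: strongly_measurable_iff_borel_measurable intro!: tendsto_scaleR\<close>)
  have ind_le: "norm (indicator A x *\<^sub>R f x) \<le> norm (f x)" for A x and f :: "'a \<Rightarrow> 'x"
    by (simp add: indicator_def)
  obtain s where s: "\<And>i::nat. Bochner_Integration.simple_bochner_integrable M (s i)"
    "(\<lambda>i. \<integral>\<^sup>+x. ennreal (norm (g x - s i x)) \<partial>M) \<longlonglongrightarrow> 0"
    by (rule strongly_integrable_approx[OF g]) blast
  have bound: "(\<integral>\<^sup>+x. ennreal (norm (g x)) \<partial>M) \<le> 2 * (\<integral>\<^sup>+x. ennreal (norm (g x - s i x)) \<partial>M)" for i
  proof -
    let ?s = "s i" and ?Y = "s i ` space M" and ?I = "\<integral>\<^sup>+x. ennreal (norm (g x - s i x)) \<partial>M"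
    have sf: "simple_function M ?s" using s(1)[of i] by cases
    then have finY: "finite ?Y" and lev: "\<And>y. ?s -` {y} \<inter> space M \<in> sets M"
      by (auto intro: simple_functionD)
    define A where "A y = ?s -` {y} \<inter> space M" for y
    have A[measurable]: "A y \<in> sets M" for y using lev by (simp add: A_def)
    have sm: "strongly_measurable M ?s" by (rule simple_bochner_integrable_strongly_measurable[OF s(1)])
    have dm: "strongly_measurable M (\<lambda>x. g x - ?s x)" by (rule strongly_measurable_diff[OF gm sm])
    note [measurable] = strongly_measurable_norm[OF dm]
    have part: "f x = (\<Sum>y\<in>?Y. f x * indicator (A y) x)" if "x \<in> space M" for x and f :: "'a \<Rightarrow> ennreal"
    proof -
      have "(\<Sum>y\<in>?Y. f x * indicator (A y) x) = (\<Sum>y\<in>?Y. if y = ?s x then f x else 0)"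
        using that by (intro sum.cong) (auto simp: A_def indicator_def)
      then show ?thesis using that finY by simp
    qed
    have piece: "(\<integral>\<^sup>+x. ennreal (norm (?s x)) * indicator (A y) x \<partial>M)
      \<le> (\<integral>\<^sup>+x. ennreal (norm (g x - ?s x)) * indicator (A y) x \<partial>M)" for y
    proof -
      have "has_bochner_integral M (indicator (A y)) (measure M (A y))"
        by (rule has_bochner_integral_real_indicator[OF A]) (simp add: less_top[symmetric])
      then have "has_strong_integral M (\<lambda>x. indicator (A y) x *\<^sub>R y) (measure M (A y) *\<^sub>R y)"
        by (rule has_strong_integral_bochner_linear[OF bounded_linear_scaleR_left])
      moreover have "(\<lambda>x. indicator (A y) x *\<^sub>R y) = (\<lambda>x. indicator (A y) x *\<^sub>R ?s x)"
        by (rule ext) (simp add: indicator_def A_def)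
      ultimately have hs: "has_strong_integral M (\<lambda>x. indicator (A y) x *\<^sub>R ?s x) (measure M (A y) *\<^sub>R y)"
        by simp
      have "strongly_integrable M (\<lambda>x. indicator (A y) x *\<^sub>R g x)"
        unfolding strongly_integrable_def
        by (intro conjI ind A gm le_less_trans[OF nn_integral_mono fin]) (intro ennreal_leI ind_le)
      then have "has_strong_integral M (\<lambda>x. indicator (A y) x *\<^sub>R g x) 0"
        using has_strong_integral_strong_integral zero[OF A] by metis
      from has_strong_integral_add[OF has_strong_integral_bounded_linear[OF bounded_linear_minus[OF bounded_linear_ident] this] hs]
      have "has_strong_integral M (\<lambda>x. indicator (A y) x *\<^sub>R (?s x - g x)) (measure M (A y) *\<^sub>R y)"
        by (simp add: scaleR_diff_right)
      from has_strong_integral_norm_le[OF this]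
      have "ennreal (measure M (A y) * norm y) \<le> (\<integral>\<^sup>+x. ennreal (norm (indicator (A y) x *\<^sub>R (?s x - g x))) \<partial>M)"
        by simp
      also have "\<dots> = (\<integral>\<^sup>+x. ennreal (norm (g x - ?s x)) * indicator (A y) x \<partial>M)"
        by (rule nn_integral_cong) (simp add: indicator_def norm_minus_commute)
      finally have "ennreal (measure M (A y) * norm y) \<le> (\<integral>\<^sup>+x. ennreal (norm (g x - ?s x)) * indicator (A y) x \<partial>M)" .
      moreover have "(\<integral>\<^sup>+x. ennreal (norm (?s x)) * indicator (A y) x \<partial>M)
        = (\<integral>\<^sup>+x. ennreal (norm y) * indicator (A y) x \<partial>M)"
        by (intro nn_integral_cong) (simp add: A_def indicator_def)
      moreover have "\<dots> = ennreal (measure M (A y) * norm y)"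
        by (simp add: nn_integral_cmult emeasure_eq_measure mult.commute flip: ennreal_mult)
      ultimately show ?thesis by simp
    qed
    have [measurable]: "(\<lambda>x. norm (?s x)) \<in> borel_measurable M"
      by (rule strongly_measurable_norm[OF sm])
    have "(\<integral>\<^sup>+x. ennreal (norm (?s x)) \<partial>M) = (\<integral>\<^sup>+x. (\<Sum>y\<in>?Y. ennreal (norm (?s x)) * indicator (A y) x) \<partial>M)"
      by (rule nn_integral_cong) (rule part)
    also have "\<dots> = (\<Sum>y\<in>?Y. \<integral>\<^sup>+x. ennreal (norm (?s x)) * indicator (A y) x \<partial>M)"
      by (rule nn_integral_sum) measurable
    also have "\<dots> \<le> (\<Sum>y\<in>?Y. \<integral>\<^sup>+x. ennreal (norm (g x - ?s x)) * indicator (A y) x \<partial>M)"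
      by (rule sum_mono) (rule piece)
    also have "\<dots> = (\<integral>\<^sup>+x. (\<Sum>y\<in>?Y. ennreal (norm (g x - ?s x)) * indicator (A y) x) \<partial>M)"
      by (rule nn_integral_sum[symmetric]) measurable
    also have "\<dots> = ?I"
      by (rule nn_integral_cong) (rule part[symmetric])
    finally have "(\<integral>\<^sup>+x. ennreal (norm (?s x)) \<partial>M) \<le> ?I" .
    moreover have "(\<integral>\<^sup>+x. ennreal (norm (g x)) \<partial>M) \<le> ?I + (\<integral>\<^sup>+x. ennreal (norm (?s x)) \<partial>M)"
      by (rule nn_integral_norm_triangle[OF dm sm]) (metis diff_add_cancel norm_triangle_ineq)
    ultimately show ?thesis
      by (metis add_left_mono mult_2 order_trans)
  qed
  have "(\<lambda>i. 2 * (\<integral>\<^sup>+x. ennreal (norm (g x - s i x)) \<partial>M)) \<longlonglongrightarrow> 2 * 0"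
    by (intro ennreal_tendsto_cmult s) simp
  then have "(\<integral>\<^sup>+x. ennreal (norm (g x)) \<partial>M) \<le> 2 * 0"
    by (rule LIMSEQ_le_const) (use bound in blast)
  then show ?thesis by simp
qed

lemma strongly_integrable_bounded_mult:
  fixes g :: "'a \<Rightarrow> 'x::complex_banach"
  assumes "h \<in> borel_measurable M" "\<And>x. x \<in> space M \<Longrightarrow> cmod (h x) \<le> B" "strongly_integrable M g"
  shows "strongly_integrable M (\<lambda>x. h x *\<^sub>C g x)"
proof -
  have g: "strongly_measurable M g" "(\<integral>\<^sup>+x. ennreal (norm (g x)) \<partial>M) < \<infinity>"
    using assms(3) by (auto simp: strongly_integrable_def)
  have "(\<integral>\<^sup>+x. ennreal (norm (h x *\<^sub>C g x)) \<partial>M) \<le> (\<integral>\<^sup>+x. ennreal \<bar>B\<bar> * ennreal (norm (g x)) \<partial>M)"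
  proof (rule nn_integral_mono)
    fix x assume "x \<in> space M"
    then have "cmod (h x) * norm (g x) \<le> \<bar>B\<bar> * norm (g x)"
      by (intro mult_right_mono) (use assms(2)[of x] in auto)
    then show "ennreal (norm (h x *\<^sub>C g x)) \<le> ennreal \<bar>B\<bar> * ennreal (norm (g x))"
      by (simp add: norm_scaleC flip: ennreal_mult)
  qed
  also have "\<dots> = ennreal \<bar>B\<bar> * (\<integral>\<^sup>+x. ennreal (norm (g x)) \<partial>M)"
    using strongly_measurable_norm[OF g(1)] by (intro nn_integral_cmult) simp
  also have "\<dots> < \<infinity>" using g(2) by (simp add: ennreal_mult_less_top)
  finally show ?thesis
    using strongly_measurable_scaleC[of M h g] assms(1) g(1)
    by (simp add: strongly_integrable_def strongly_measurable_iff_borel_measurable)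
qed

lemma strongly_integrable_monomial_mult:
  fixes g :: "(nat \<Rightarrow> complex) \<Rightarrow> 'x::complex_banach"
  shows "strongly_integrable haar g \<Longrightarrow> strongly_integrable haar (\<lambda>\<omega>. monomial \<alpha> \<omega> *\<^sub>C g \<omega>)"
  by (rule strongly_integrable_bounded_mult[OF borel_measurable_monomial, where B = 1])
    (simp_all add: space_haar norm_monomial)

lemma has_strong_integral_zero: "has_strong_integral M (\<lambda>x. 0) 0"
  using has_strong_integral_bochner_linear[OF bounded_linear_scaleR_left[of 0] has_bochner_integral_zero]
  by simp

lemma has_strong_integral_sum:
  "(\<And>i. i \<in> I \<Longrightarrow> has_strong_integral M (f i) (y i)) \<Longrightarrow>
    has_strong_integral M (\<lambda>x. \<Sum>i\<in>I. f i x) (\<Sum>i\<in>I. y i)"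
proof (induction I rule: infinite_finite_induct)
  case (insert i I)
  then show ?case by (simp add: has_strong_integral_add)
qed (simp_all add: has_strong_integral_zero)

lemma has_strong_integral_cong:
  assumes "\<And>x. x \<in> space M \<Longrightarrow> f x = g x"
  shows "has_strong_integral M f y \<longleftrightarrow> has_strong_integral M g y"
proof -
  have "(\<integral>\<^sup>+x. ennreal (norm (f x - s x)) \<partial>M) = (\<integral>\<^sup>+x. ennreal (norm (g x - s x)) \<partial>M)" for s
    by (rule nn_integral_cong) (simp add: assms)
  then show ?thesis
    by (simp add: has_strong_integral_def strongly_measurable_def assms)
qed

lemma strong_integral_cong:
  "(\<And>x. x \<in> space M \<Longrightarrow> f x = g x) \<Longrightarrow> strong_integral M f = strong_integral M g"
proof -
  assume "\<And>x. x \<in> space M \<Longrightarrow> f x = g x"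
  then have "has_strong_integral M f = has_strong_integral M g"
    by (intro ext has_strong_integral_cong)
  then show ?thesis by (simp add: strong_integral_def)
qed

lemma strong_integral_trig_polynomial_eq_0:
  fixes g :: "(nat \<Rightarrow> complex) \<Rightarrow> 'x::complex_banach"
  assumes g: "strongly_integrable haar g" and zero: "\<And>\<alpha>. fourier_coeff g \<alpha> = 0" and P: "trig_polynomial P"
  shows "strong_integral haar (\<lambda>\<omega>. P \<omega> *\<^sub>C g \<omega>) = 0"
proof -
  obtain A c where A: "finite A" "\<And>\<omega>. \<omega> \<in> torus \<Longrightarrow> P \<omega> = (\<Sum>\<alpha>\<in>A. c \<alpha> * monomial \<alpha> \<omega>)"
    using P by (auto simp: trig_polynomial_def)
  have "has_strong_integral haar (\<lambda>\<omega>. c \<alpha> *\<^sub>C (monomial \<alpha> \<omega> *\<^sub>C g \<omega>)) (c \<alpha> *\<^sub>C 0)" for \<alpha>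
    using has_strong_integral_strong_integral[OF strongly_integrable_monomial_mult[OF g, of \<alpha>]]
      zero[of "- \<alpha>"]
    by (intro has_strong_integral_bounded_linear[OF bounded_linear_scaleC_right]) (simp add: fourier_coeff_def)
  then have "has_strong_integral haar (\<lambda>\<omega>. \<Sum>\<alpha>\<in>A. c \<alpha> *\<^sub>C (monomial \<alpha> \<omega> *\<^sub>C g \<omega>)) (\<Sum>\<alpha>\<in>A. c \<alpha> *\<^sub>C 0)"
    by (rule has_strong_integral_sum)
  moreover have "P \<omega> *\<^sub>C g \<omega> = (\<Sum>\<alpha>\<in>A. c \<alpha> *\<^sub>C (monomial \<alpha> \<omega> *\<^sub>C g \<omega>))" if "\<omega> \<in> space haar" for \<omega>
    using A(2)[of \<omega>] that by (simp add: space_haar scaleC_sum_left scaleC_scaleC)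
  ultimately have "has_strong_integral haar (\<lambda>\<omega>. P \<omega> *\<^sub>C g \<omega>) 0"
    using has_strong_integral_cong[of haar "\<lambda>\<omega>. P \<omega> *\<^sub>C g \<omega>"] by simp
  then show ?thesis by (rule strong_integral_eq)
qed

text \<open>The integral of \<open>g\<close> against every trigonometric polynomial vanishes. Indicators are approximated by these in mean
  with respect to the finite measure \<open>\<parallel>g\<parallel> d\<omega>\<close>, so \<open>g\<close> has integral \<open>0\<close> over every set.\<close>

lemma fourier_coeff_unique:
  fixes g :: "(nat \<Rightarrow> complex) \<Rightarrow> 'x::complex_banach"
  assumes g: "strongly_integrable haar g" and zero: "\<And>\<alpha>. fourier_coeff g \<alpha> = 0"
  shows "AE \<omega> in haar. g \<omega> = 0"
proof -
  have gm: "strongly_measurable haar g" and fin: "(\<integral>\<^sup>+\<omega>. ennreal (norm (g \<omega>)) \<partial>haar) < \<infinity>"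
    using g by (auto simp: strongly_integrable_def)
  note [measurable] = strongly_measurable_norm[OF gm]
  define I where "I = enn2real (\<integral>\<^sup>+\<omega>. ennreal (norm (g \<omega>)) \<partial>haar)"
  have I: "(\<integral>\<^sup>+\<omega>. ennreal (norm (g \<omega>)) \<partial>haar) = ennreal I" "0 \<le> I"
    using fin by (auto simp: I_def)
  define N where "N = density haar (\<lambda>\<omega>. ennreal (norm (g \<omega>)))"
  have "emeasure N (space N) = (\<integral>\<^sup>+\<omega>. ennreal (norm (g \<omega>)) * indicator (space haar) \<omega> \<partial>haar)"
    unfolding N_def by (simp add: emeasure_density)
  also have "\<dots> = ennreal I"
    unfolding I(1)[symmetric] by (rule nn_integral_cong) simp
  finally have N: "finite_measure N" "sets N = sets haar"
    by (auto intro!: finite_measureI simp: N_def)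
  have "strong_integral haar (\<lambda>\<omega>. indicator A \<omega> *\<^sub>R g \<omega>) = 0" if A: "A \<in> sets haar" for A
  proof (rule ccontr)
    assume "strong_integral haar (\<lambda>\<omega>. indicator A \<omega> *\<^sub>R g \<omega>) \<noteq> 0"
    define y where "y = strong_integral haar (\<lambda>\<omega>. indicator A \<omega> *\<^sub>R g \<omega>)"
    \<comment> \<open>with this \<open>e\<close> the two approximation errors \<open>e\<close> and \<open>e I\<close> add up to less than the norm of \<open>y\<close>\<close>
    define e where "e = norm y / (2 + I)"
    have y: "norm y > 0" using \<open>_ \<noteq> 0\<close> by (simp add: y_def)
    have e: "e > 0" using y I(2) by (simp add: e_def)
    obtain \<phi> where \<phi>: "continuous_on torus \<phi>" "\<And>\<omega>. 0 \<le> \<phi> \<omega>" "\<And>\<omega>. \<phi> \<omega> \<le> (1::real)"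
      "(\<integral>\<^sup>+\<omega>. ennreal \<bar>indicator A \<omega> - \<phi> \<omega>\<bar> \<partial>N) < ennreal e"
      using indicator_approx_continuous[OF N A e] by blast
    obtain P where P: "trig_polynomial P" "\<And>\<omega>. \<omega> \<in> torus \<Longrightarrow> cmod (complex_of_real (\<phi> \<omega>) - P \<omega>) < e"
      using trig_polynomial_dense[OF continuous_on_of_real[OF \<phi>(1)] e] by blast
    note [measurable] = borel_measurable_haar_continuous[OF \<phi>(1)] A trig_polynomial_measurable[OF P(1)]
    have Pb: "cmod (P \<omega>) \<le> 1 + e" if "\<omega> \<in> space haar" for \<omega>
    proof -
      have "cmod (P \<omega>) \<le> cmod (complex_of_real (\<phi> \<omega>)) + cmod (complex_of_real (\<phi> \<omega>) - P \<omega>)"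
        by (metis norm_minus_commute norm_triangle_sub)
      also have "\<dots> \<le> 1 + e"
        using P(2)[of \<omega>] that \<phi>(2,3)[of \<omega>] by (intro add_mono) (auto simp: space_haar)
      finally show ?thesis .
    qed
    have intA: "strongly_integrable haar (\<lambda>\<omega>. indicator A \<omega> *\<^sub>C g \<omega>)"
      by (rule strongly_integrable_bounded_mult[where B = 1, OF _ _ g]) (auto simp: indicator_def)
    have intP: "strongly_integrable haar (\<lambda>\<omega>. P \<omega> *\<^sub>C g \<omega>)"
      by (rule strongly_integrable_bounded_mult[OF _ Pb g]) measurable
    have diff: "strongly_integrable haar (\<lambda>\<omega>. (indicator A \<omega> - P \<omega>) *\<^sub>C g \<omega>)"
    proof (rule strongly_integrable_bounded_mult[OF _ _ g])
      fix \<omega> assume \<omega>: "\<omega> \<in> space haar"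
      have "cmod (indicator A \<omega> - P \<omega>) \<le> cmod (indicator A \<omega>) + cmod (P \<omega>)" by (rule norm_triangle_ineq4)
      also have "\<dots> \<le> 1 + (1 + e)" using Pb[OF \<omega>] by (intro add_mono) (auto simp: indicator_def)
      finally show "cmod (indicator A \<omega> - P \<omega>) \<le> 1 + (1 + e)" .
    qed measurable
    have "y = strong_integral haar (\<lambda>\<omega>. indicator A \<omega> *\<^sub>C g \<omega>)"
      unfolding y_def by (rule strong_integral_cong) (simp add: indicator_def)
    also have "\<dots> = strong_integral haar (\<lambda>\<omega>. indicator A \<omega> *\<^sub>C g \<omega> - P \<omega> *\<^sub>C g \<omega>)"
      by (simp add: strong_integral_diff[OF intA intP] strong_integral_trig_polynomial_eq_0[OF g zero P(1)])
    also have "\<dots> = strong_integral haar (\<lambda>\<omega>. (indicator A \<omega> - P \<omega>) *\<^sub>C g \<omega>)"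
      by (rule strong_integral_cong)
        (rule linear_diff[OF bounded_linear.linear[OF bounded_linear_scaleC_left], symmetric])
    finally have "ennreal (norm y) \<le> (\<integral>\<^sup>+\<omega>. ennreal (norm ((indicator A \<omega> - P \<omega>) *\<^sub>C g \<omega>)) \<partial>haar)"
      using norm_strong_integral_le[OF diff] by simp
    also have "\<dots> \<le> (\<integral>\<^sup>+\<omega>. ennreal (norm (g \<omega>)) * ennreal \<bar>indicator A \<omega> - \<phi> \<omega>\<bar> + ennreal e * ennreal (norm (g \<omega>)) \<partial>haar)"
    proof (rule nn_integral_mono)
      fix \<omega> assume \<omega>: "\<omega> \<in> space haar"
      have "cmod (indicator A \<omega> - P \<omega>) \<le> cmod (indicator A \<omega> - complex_of_real (\<phi> \<omega>)) + cmod (complex_of_real (\<phi> \<omega>) - P \<omega>)"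
        using norm_triangle_ineq[of "indicator A \<omega> - complex_of_real (\<phi> \<omega>)" "complex_of_real (\<phi> \<omega>) - P \<omega>"] by simp
      also have "cmod (indicator A \<omega> - complex_of_real (\<phi> \<omega>)) = \<bar>indicator A \<omega> - \<phi> \<omega>\<bar>"
        by (metis norm_of_real of_real_diff of_real_indicator real_norm_def)
      also have "cmod (complex_of_real (\<phi> \<omega>) - P \<omega>) \<le> e"
        using P(2)[of \<omega>] \<omega> by (simp add: space_haar less_imp_le)
      finally have "cmod (indicator A \<omega> - P \<omega>) * norm (g \<omega>) \<le> (\<bar>indicator A \<omega> - \<phi> \<omega>\<bar> + e) * norm (g \<omega>)"
        by (intro mult_right_mono) auto
      then show "ennreal (norm ((indicator A \<omega> - P \<omega>) *\<^sub>C g \<omega>))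
        \<le> ennreal (norm (g \<omega>)) * ennreal \<bar>indicator A \<omega> - \<phi> \<omega>\<bar> + ennreal e * ennreal (norm (g \<omega>))"
        using e by (simp add: norm_scaleC algebra_simps flip: ennreal_mult ennreal_plus)
    qed
    also have "\<dots> = (\<integral>\<^sup>+\<omega>. ennreal \<bar>indicator A \<omega> - \<phi> \<omega>\<bar> \<partial>N) + ennreal e * ennreal I"
      unfolding N_def I(1)[symmetric]
      by (subst nn_integral_add) (auto simp: nn_integral_density nn_integral_cmult)
    also have "\<dots> \<le> ennreal e + ennreal e * ennreal I"
      using \<phi>(4) by (intro add_right_mono) (rule less_imp_le)
    also have "\<dots> = ennreal (e * (1 + I))"
      using e I(2) by (simp add: algebra_simps flip: ennreal_mult ennreal_plus)
    finally have "norm y \<le> e * (1 + I)"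
      using e I(2) by simp
    moreover have "e * (2 + I) = norm y" using I(2) by (simp add: e_def)
    ultimately show False using e by (simp add: algebra_simps)
  qed
  then have "(\<integral>\<^sup>+\<omega>. ennreal (norm (g \<omega>)) \<partial>haar) = 0"
    by (rule nn_integral_norm_eq_0I[OF prob_space.finite_measure[OF prob_space_haar] g])
  then have "AE \<omega> in haar. ennreal (norm (g \<omega>)) = 0"
    by (subst (asm) nn_integral_0_iff_AE) measurable
  then show ?thesis by eventually_elim simp
qed

lemma Lp_norm_cong_AE:
  fixes f g :: "'a \<Rightarrow> 'x::real_normed_vector"
  assumes "strongly_measurable M f" "strongly_measurable M g" "AE x in M. f x = g x"
  shows "Lp_norm M p f = Lp_norm M p g"
proof -
  note [measurable] = assms(1,2)[THEN strongly_measurable_norm]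
  have "esssup M (\<lambda>x. ennreal (norm (f x))) = esssup M (\<lambda>x. ennreal (norm (g x)))"
    by (rule esssup_AE_cong) (use assms(3) in \<open>auto elim!: eventually_mono\<close>)
  moreover have "(\<integral>\<^sup>+x. ennreal (norm (f x) powr enn2real p) \<partial>M) = (\<integral>\<^sup>+x. ennreal (norm (g x) powr enn2real p) \<partial>M)"
    by (rule nn_integral_cong_AE) (use assms(3) in \<open>auto elim!: eventually_mono\<close>)
  ultimately show ?thesis by (simp add: Lp_norm_def)
qed

lemma Lp_le_imp_strongly_integrable:
  assumes p: "1 \<le> p" "1 / p + 1 / p' = 1" and f: "Lp_le p f C"
  shows "strongly_integrable haar f"
  by (rule strongly_integrableI[OF Lp_le_measurable[OF f] Lp_le_imp_L1[OF p f]])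

lemma is_lift_unique:
  fixes f g :: "(nat \<Rightarrow> complex) \<Rightarrow> 'x::complex_banach"
  assumes p: "1 \<le> p" "1 / p + 1 / p' = 1" and lift: "is_lift p a f" "is_lift p a g"
  shows "AE \<omega> in haar. f \<omega> = g \<omega>"
proof -
  have Lp: "f \<in> Lp_space haar p" "g \<in> Lp_space haar p"
    using lift by (auto simp: is_lift_def hardy_torus_def)
  have coeff: "fourier_coeff f \<alpha> = fourier_coeff g \<alpha>" for \<alpha>
    using lift by (cases "\<alpha> \<in> nonneg_exponents") (auto simp: is_lift_def hardy_torus_def)
  have int: "strongly_integrable haar f" "strongly_integrable haar g"
    using Lp Lp_le_imp_strongly_integrable[OF p Lp_le_Lp_norm[OF p(1)]] by auto
  have neg: "Lp_le p (\<lambda>\<omega>. (- 1) *\<^sub>C g \<omega>) (cmod (- 1) * Lp_norm haar p g)"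
    by (rule Lp_le_scaleC[OF p(1) Lp_le_Lp_norm[OF p(1) Lp(2)]])
  have "(\<lambda>\<omega>. f \<omega> + (- 1) *\<^sub>C g \<omega>) \<in> Lp_space haar p"
    by (rule Lp_space_add[OF p(1) Lp(1) Lp_le_imp_Lp_space[OF neg]])
  then have "strongly_integrable haar (\<lambda>\<omega>. f \<omega> + (- 1) *\<^sub>C g \<omega>)"
    by (rule Lp_le_imp_strongly_integrable[OF p Lp_le_Lp_norm[OF p(1)]])
  then have d: "strongly_integrable haar (\<lambda>\<omega>. f \<omega> - g \<omega>)"
    by (simp add: scaleC_minus_one)
  have "fourier_coeff (\<lambda>\<omega>. f \<omega> - g \<omega>) \<alpha> = 0" for \<alpha>
    using coeff[of \<alpha>] strong_integral_diff[OF int[THEN strongly_integrable_monomial_mult], of "- \<alpha>" "- \<alpha>"]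
    by (simp add: fourier_coeff_def scaleC_diff_right)
  from fourier_coeff_unique[OF d this] show ?thesis
    by eventually_elim simp
qed

lemma hardy_dirichlet_norm_eq:
  fixes f :: "(nat \<Rightarrow> complex) \<Rightarrow> 'x::complex_banach"
  assumes p: "1 \<le> p" "1 / p + 1 / p' = 1" and f: "is_lift p a f"
  shows "hardy_dirichlet_norm p a = Lp_norm haar p f"
  unfolding hardy_dirichlet_norm_def
proof (rule the_equality)
  fix r assume "\<exists>g. is_lift p a g \<and> r = Lp_norm haar p g"
  then obtain g where g: "is_lift p a g" "r = Lp_norm haar p g" by blast
  have "strongly_measurable haar f" "strongly_measurable haar g"
    using f g by (auto simp: is_lift_def hardy_torus_def Lp_space_def)
  from Lp_norm_cong_AE[OF this is_lift_unique[OF p f g(1)]]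
  show "r = Lp_norm haar p f" using g by simp
qed (use f in blast)

section \<open>Functions of positive type and a convex decomposition of the exponential\<close>

text \<open>An even function makes the Hermitian form of the differences real, so its real part is the whole form.\<close>

definition positive_type :: "(real \<Rightarrow> real) \<Rightarrow> bool"
  where "positive_type c \<longleftrightarrow> (\<forall>u. c (- u) = c u) \<and>
    (\<forall>(n::nat) u z. 0 \<le> (\<Sum>i<n. \<Sum>j<n. Re (z i * cnj (z j)) * c (u i - u j)))"

lemma positive_type_even: "positive_type c \<Longrightarrow> c (- u) = c u"
  by (simp add: positive_type_def)

lemma positive_type_sum_nonneg:
  assumes c: "positive_type c" and S: "finite S"
  shows "0 \<le> (\<Sum>i\<in>S. \<Sum>j\<in>S. Re (z i * cnj (z j)) * c (u i - u j))"
proof -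
  obtain h where "bij_betw h {0..<card S} S"
    using ex_bij_betw_nat_finite[OF S] by blast
  then have h: "bij_betw h {..<card S} S" by (simp add: lessThan_atLeast0)
  have "(\<Sum>i\<in>S. \<Sum>j\<in>S. Re (z i * cnj (z j)) * c (u i - u j))
    = (\<Sum>i<card S. \<Sum>j<card S. Re (z (h i) * cnj (z (h j))) * c (u (h i) - u (h j)))"
    by (simp only: sum.reindex_bij_betw[OF h, symmetric])
  also have "\<dots> \<ge> 0"
    using c[unfolded positive_type_def, THEN conjunct2, rule_format, of "\<lambda>i. z (h i)" "\<lambda>i. u (h i)" "card S"] .
  finally show ?thesis .
qed

text \<open>The triangle function is the autocorrelation of the indicator of an interval of length \<open>B\<close>.\<close>

lemma positive_type_triangle:
  assumes B: "0 \<le> B"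
  shows "positive_type (\<lambda>u. max 0 (B - \<bar>u\<bar>))"
  unfolding positive_type_def
proof (intro conjI allI)
  fix n :: nat and u :: "nat \<Rightarrow> real" and z :: "nat \<Rightarrow> complex"
  let ?J = "\<lambda>i. {u i..u i + B}"
  have meas: "(\<integral>x. indicator (?J i \<inter> ?J j) x \<partial>lborel) = max 0 (B - \<bar>u i - u j\<bar>)" for i j
  proof -
    have "?J i \<inter> ?J j = {max (u i) (u j)..min (u i) (u j) + B}" by auto
    then have "(\<integral>x. indicator (?J i \<inter> ?J j) x \<partial>lborel) = measure lborel {max (u i) (u j)..min (u i) (u j) + B}"
      by (simp only: Bochner_Integration.integral_indicator) simp
    also have "\<dots> = max 0 (B - \<bar>u i - u j\<bar>)"
      by (cases "max (u i) (u j) \<le> min (u i) (u j) + B") (simp_all add: max_def min_def split: if_splits)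
    finally show ?thesis .
  qed
  have int: "integrable lborel (\<lambda>x. indicator (?J i \<inter> ?J j) x :: real)" for i j
    by (rule integrable_real_indicator) (auto simp: emeasure_lborel_Icc_eq intro!: le_less_trans[OF emeasure_mono[of _ "?J i"]])
  have "(\<Sum>i<n. \<Sum>j<n. Re (z i * cnj (z j)) * max 0 (B - \<bar>u i - u j\<bar>))
    = (\<Sum>i<n. \<Sum>j<n. (\<integral>x. Re (z i * cnj (z j)) * indicator (?J i \<inter> ?J j) x \<partial>lborel))"
    by (simp only: meas integral_mult_right_zero)
  also have "\<dots> = (\<Sum>i<n. (\<integral>x. (\<Sum>j<n. Re (z i * cnj (z j)) * indicator (?J i \<inter> ?J j) x) \<partial>lborel))"
    by (intro sum.cong refl Bochner_Integration.integral_sum[symmetric] integrable_mult_right int)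
  also have "\<dots> = (\<integral>x. (\<Sum>i<n. \<Sum>j<n. Re (z i * cnj (z j)) * indicator (?J i \<inter> ?J j) x) \<partial>lborel)"
    by (intro Bochner_Integration.integral_sum[symmetric] Bochner_Integration.integrable_sum integrable_mult_right int)
  also have "\<dots> = (\<integral>x. (cmod (\<Sum>i<n. z i * indicator (?J i) x))\<^sup>2 \<partial>lborel)"
  proof (rule Bochner_Integration.integral_cong[OF refl])
    fix x
    have "(cmod (\<Sum>i<n. z i * indicator (?J i) x))\<^sup>2
      = Re ((\<Sum>i<n. z i * indicator (?J i) x) * cnj (\<Sum>i<n. z i * indicator (?J i) x))"
      by (metis Re_complex_of_real complex_norm_square)
    also have "\<dots> = (\<Sum>i<n. \<Sum>j<n. Re (z i * cnj (z j)) * indicator (?J i \<inter> ?J j) x)"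
      unfolding cnj_sum sum_product Re_sum
      by (intro sum.cong refl) (auto simp: indicator_def)
    finally show "(\<Sum>i<n. \<Sum>j<n. Re (z i * cnj (z j)) * indicator (?J i \<inter> ?J j) x)
      = (cmod (\<Sum>i<n. z i * indicator (?J i) x))\<^sup>2" ..
  qed
  also have "\<dots> \<ge> 0" by (rule Bochner_Integration.integral_nonneg) simp
  finally show "0 \<le> (\<Sum>i<n. \<Sum>j<n. Re (z i * cnj (z j)) * max 0 (B - \<bar>u i - u j\<bar>))" .
qed simp

text \<open>The second derivative of \<open>exp (- \<epsilon> u)\<close> distributed over triangle functions, as in Polya's criterion: the integral
  over all \<open>B > 0\<close> is \<open>exp (- \<epsilon> \<bar>u\<bar>)\<close>, and the part with \<open>B \<le> b\<close> is supported in \<open>[-b, b]\<close>.\<close>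

definition polya :: "real \<Rightarrow> real \<Rightarrow> real \<Rightarrow> real \<Rightarrow> real"
  where "polya \<epsilon> a b u = integral {a..b} (\<lambda>B. \<epsilon>\<^sup>2 * exp (- \<epsilon> * B) * max 0 (B - \<bar>u\<bar>))"

lemma polya_integrable: "(\<lambda>B. \<epsilon>\<^sup>2 * exp (- \<epsilon> * B) * max 0 (B - \<bar>u\<bar>)) integrable_on {a..b::real}"
  by (rule integrable_continuous_real) (intro continuous_intros)

lemma positive_type_polya:
  assumes "0 \<le> a"
  shows "positive_type (polya \<epsilon> a b)"
  unfolding positive_type_def
proof (intro conjI allI)
  fix n :: nat and u :: "nat \<Rightarrow> real" and z :: "nat \<Rightarrow> complex"
  let ?w = "\<lambda>B. \<epsilon>\<^sup>2 * exp (- \<epsilon> * B)"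
  have "(\<Sum>i<n. \<Sum>j<n. Re (z i * cnj (z j)) * polya \<epsilon> a b (u i - u j))
    = integral {a..b} (\<lambda>B. \<Sum>i<n. \<Sum>j<n. Re (z i * cnj (z j)) * (?w B * max 0 (B - \<bar>u i - u j\<bar>)))"
    unfolding polya_def
    by (simp only: Henstock_Kurzweil_Integration.integral_sum integral_mult_right[symmetric] finite_lessThan
        integrable_sum integrable_on_mult_right polya_integrable)
  also have "\<dots> = integral {a..b} (\<lambda>B. ?w B * (\<Sum>i<n. \<Sum>j<n. Re (z i * cnj (z j)) * max 0 (B - \<bar>u i - u j\<bar>)))"
    by (simp only: sum_distrib_left mult.left_commute)
  also have "\<dots> \<ge> 0"
  proof (rule Henstock_Kurzweil_Integration.integral_nonneg)
    show "(\<lambda>B. ?w B * (\<Sum>i<n. \<Sum>j<n. Re (z i * cnj (z j)) * max 0 (B - \<bar>u i - u j\<bar>))) integrable_on {a..b}"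
      by (rule integrable_continuous_real) (intro continuous_intros)
    fix B assume "B \<in> {a..b}"
    then have "positive_type (\<lambda>u. max 0 (B - \<bar>u\<bar>))"
      using assms by (intro positive_type_triangle) simp
    then have "0 \<le> (\<Sum>i<n. \<Sum>j<n. Re (z i * cnj (z j)) * max 0 (B - \<bar>u i - u j\<bar>))"
      by (rule positive_type_sum_nonneg) simp
    then show "0 \<le> ?w B * (\<Sum>i<n. \<Sum>j<n. Re (z i * cnj (z j)) * max 0 (B - \<bar>u i - u j\<bar>))"
      by (rule mult_nonneg_nonneg[rotated]) simp
  qed
  finally show "0 \<le> (\<Sum>i<n. \<Sum>j<n. Re (z i * cnj (z j)) * polya \<epsilon> a b (u i - u j))" .
qed (simp add: polya_def)

lemma polya_eq_0: "b \<le> \<bar>u\<bar> \<Longrightarrow> polya \<epsilon> a b u = 0"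
proof -
  assume u: "b \<le> \<bar>u\<bar>"
  have "polya \<epsilon> a b u = integral {a..b} (\<lambda>B. 0)"
    unfolding polya_def
    by (rule Henstock_Kurzweil_Integration.integral_cong) (use u in auto)
  then show ?thesis by simp
qed

lemma polya_combine: "a \<le> b \<Longrightarrow> b \<le> d \<Longrightarrow> polya \<epsilon> a b u + polya \<epsilon> b d u = polya \<epsilon> a d u"
  unfolding polya_def by (rule Henstock_Kurzweil_Integration.integral_combine[OF _ _ polya_integrable])

lemma polya_primitive:
  assumes "\<bar>u\<bar> \<le> a" "a \<le> b"
  shows "polya \<epsilon> a b u = (\<epsilon> * (a - \<bar>u\<bar>) + 1) * exp (- \<epsilon> * a) - (\<epsilon> * (b - \<bar>u\<bar>) + 1) * exp (- \<epsilon> * b)"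
proof -
  let ?g = "\<lambda>B. - ((\<epsilon> * (B - \<bar>u\<bar>) + 1) * exp (- \<epsilon> * B))"
  have "((\<lambda>B. \<epsilon>\<^sup>2 * exp (- \<epsilon> * B) * (B - \<bar>u\<bar>)) has_integral ?g b - ?g a) {a..b}"
  proof (rule fundamental_theorem_of_calculus[OF assms(2)])
    fix B
    have "(?g has_real_derivative \<epsilon>\<^sup>2 * exp (- \<epsilon> * B) * (B - \<bar>u\<bar>)) (at B within {a..b})"
      by (auto intro!: derivative_eq_intros simp: algebra_simps power2_eq_square)
    then show "(?g has_vector_derivative \<epsilon>\<^sup>2 * exp (- \<epsilon> * B) * (B - \<bar>u\<bar>)) (at B within {a..b})"
      by (simp add: has_real_derivative_iff_has_vector_derivative)
  qed
  then have "integral {a..b} (\<lambda>B. \<epsilon>\<^sup>2 * exp (- \<epsilon> * B) * (B - \<bar>u\<bar>)) = ?g b - ?g a"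
    by (rule integral_unique)
  moreover have "polya \<epsilon> a b u = integral {a..b} (\<lambda>B. \<epsilon>\<^sup>2 * exp (- \<epsilon> * B) * (B - \<bar>u\<bar>))"
    unfolding polya_def by (rule Henstock_Kurzweil_Integration.integral_cong) (use assms in auto)
  ultimately show ?thesis by simp
qed

lemma polya_from_0:
  assumes "\<bar>u\<bar> \<le> b"
  shows "polya \<epsilon> 0 b u = exp (- \<epsilon> * \<bar>u\<bar>) - (\<epsilon> * (b - \<bar>u\<bar>) + 1) * exp (- \<epsilon> * b)"
  using polya_combine[of 0 "\<bar>u\<bar>" b \<epsilon> u] polya_eq_0[of "\<bar>u\<bar>" u \<epsilon> 0] polya_primitive[of u "\<bar>u\<bar>" b \<epsilon>] assms
  by simp

lemma polya_tendsto:
  assumes "0 < \<epsilon>"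
  shows "(\<lambda>n. polya \<epsilon> 0 (real n) u) \<longlonglongrightarrow> exp (- \<epsilon> * \<bar>u\<bar>)"
proof -
  have lim: "((\<lambda>x. (x + k) * exp (- x)) \<longlongrightarrow> 0) at_top" for k :: real
  proof -
    have "((\<lambda>x. x ^ 1 / exp x + k * (x ^ 0 / exp x)) \<longlongrightarrow> 0 + k * 0) at_top"
      by (intro tendsto_intros tendsto_power_div_exp_0)
    moreover have "x ^ 1 / exp x + k * (x ^ 0 / exp x) = (x + k) * exp (- x)" for x :: real
      by (simp add: exp_minus divide_inverse distrib_right)
    ultimately show ?thesis by simp
  qed
  have "filterlim (\<lambda>n. \<epsilon> * real n) at_top sequentially"
    by (rule filterlim_tendsto_pos_mult_at_top[OF tendsto_const assms filterlim_real_sequentially])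
  from filterlim_compose[OF lim[of "1 - \<epsilon> * \<bar>u\<bar>"] this]
  have "(\<lambda>n. (\<epsilon> * (real n - \<bar>u\<bar>) + 1) * exp (- \<epsilon> * real n)) \<longlonglongrightarrow> 0"
    by (simp add: algebra_simps)
  then have "(\<lambda>n. exp (- \<epsilon> * \<bar>u\<bar>) - (\<epsilon> * (real n - \<bar>u\<bar>) + 1) * exp (- \<epsilon> * real n)) \<longlonglongrightarrow> exp (- \<epsilon> * \<bar>u\<bar>) - 0"
    by (intro tendsto_diff tendsto_const)
  moreover have "\<forall>\<^sub>F n in sequentially. exp (- \<epsilon> * \<bar>u\<bar>) - (\<epsilon> * (real n - \<bar>u\<bar>) + 1) * exp (- \<epsilon> * real n) = polya \<epsilon> 0 (real n) u"
    by (rule eventually_sequentiallyI[of "nat \<lceil>\<bar>u\<bar>\<rceil>"]) (simp add: polya_from_0 nat_ceiling_le_eq)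
  ultimately show ?thesis
    by (simp add: tendsto_cong)
qed

lemma polya_0_pos:
  assumes "0 < \<epsilon>" "0 \<le> a" "a < b"
  shows "0 < polya \<epsilon> a b 0"
proof -
  define x d where "x = \<epsilon> * a" and "d = \<epsilon> * (b - a)"
  have xd: "0 \<le> x" "0 < d" "\<epsilon> * b = x + d"
    using assms by (auto simp: x_def d_def algebra_simps)
  have "1 + d < exp d"
    using exp_lower_Taylor_quadratic[of d] xd by (smt (verit) divide_pos_pos zero_less_power)
  then have "(1 + x) * (1 + d) < (1 + x) * exp d"
    using xd by (intro mult_strict_left_mono) auto
  moreover have "x + d + 1 \<le> (1 + x) * (1 + d)"
    using xd by (simp add: algebra_simps)
  ultimately have "x + d + 1 < (x + 1) * exp d" by (simp add: algebra_simps)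
  then have "(x + d + 1) * exp (- (x + d)) < (x + 1) * exp d * exp (- (x + d))"
    by (rule mult_strict_right_mono) simp
  also have "\<dots> = (x + 1) * exp (- x)"
    by (simp add: mult.assoc flip: exp_add)
  finally show ?thesis
    using polya_primitive[of 0 a b \<epsilon>] assms xd by (simp add: x_def)
qed

lemma polya_0_le_1: "0 < \<epsilon> \<Longrightarrow> 0 \<le> b \<Longrightarrow> polya \<epsilon> 0 b 0 \<le> 1"
  using polya_from_0[of 0 b \<epsilon>] by simp

lemma polya_sum: "(\<Sum>i<n. polya \<epsilon> (real i) (real (Suc i)) u) = polya \<epsilon> 0 (real n) u"
proof (induction n)
  case 0
  then show ?case by (simp add: polya_eq_0)
next
  case (Suc n)
  then show ?case using polya_combine[of 0 "real n" "real (Suc n)" \<epsilon> u] by simp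
qed

section \<open>Exponents\<close>

text \<open>The additive extension of \<open>log \<pp>\<^sup>\<alpha>\<close> to exponents of both signs.\<close>

definition log_weight :: "(nat \<Rightarrow>\<^sub>0 int) \<Rightarrow> real"
  where "log_weight \<alpha> = (\<Sum>j\<in>Poly_Mapping.keys \<alpha>. of_int (Poly_Mapping.lookup \<alpha> j) * ln (real (prime_seq j)))"

lemma log_weight_eq_sum:
  "finite J \<Longrightarrow> Poly_Mapping.keys \<alpha> \<subseteq> J \<Longrightarrow>
    log_weight \<alpha> = (\<Sum>j\<in>J. of_int (Poly_Mapping.lookup \<alpha> j) * ln (real (prime_seq j)))"
  unfolding log_weight_def by (rule sum.mono_neutral_left) (auto simp: in_keys_iff)

lemma log_weight_diff: "log_weight (\<alpha> - \<beta>) = log_weight \<alpha> - log_weight \<beta>"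
proof -
  define J where "J = Poly_Mapping.keys \<alpha> \<union> Poly_Mapping.keys \<beta>"
  have J: "finite J" "Poly_Mapping.keys \<alpha> \<subseteq> J" "Poly_Mapping.keys \<beta> \<subseteq> J" "Poly_Mapping.keys (\<alpha> - \<beta>) \<subseteq> J"
    by (auto simp: J_def in_keys_iff lookup_minus)
  show ?thesis
    by (simp add: log_weight_eq_sum[OF J(1)] J lookup_minus algebra_simps sum_subtractf)
qed

lemma log_weight_eq_ln:
  assumes "\<alpha> \<in> nonneg_exponents"
  shows "log_weight \<alpha> = ln (real (prime_pow \<alpha>))"
proof -
  have "real (prime_pow \<alpha>) = (\<Prod>j\<in>Poly_Mapping.keys \<alpha>. real (prime_seq j) ^ nat (Poly_Mapping.lookup \<alpha> j))"
    by (simp add: prime_pow_def)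
  then have "ln (real (prime_pow \<alpha>)) = (\<Sum>j\<in>Poly_Mapping.keys \<alpha>. ln (real (prime_seq j) ^ nat (Poly_Mapping.lookup \<alpha> j)))"
    using prime_seq_neq_0 by (simp add: ln_prod)
  also have "\<dots> = log_weight \<alpha>"
    unfolding log_weight_def
    by (rule sum.cong) (use assms prime_seq_neq_0 in \<open>auto simp: ln_realpow nonneg_exponents_def\<close>)
  finally show ?thesis ..
qed

lemma log_weight_nonneg:
  assumes "\<alpha> \<in> nonneg_exponents"
  shows "0 \<le> log_weight \<alpha>"
  using prime_pow_pos[of \<alpha>] by (simp add: log_weight_eq_ln[OF assms])

definition small_exponents :: "real \<Rightarrow> (nat \<Rightarrow>\<^sub>0 int) set"
  where "small_exponents M = {\<alpha> \<in> nonneg_exponents. log_weight \<alpha> < M}"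

lemma finite_small_exponents: "finite (small_exponents M)"
proof (rule finite_imageD)
  show "inj_on prime_pow (small_exponents M)"
    by (rule inj_on_inverseI[where g = exponents]) (simp add: small_exponents_def exponents_prime_pow)
  have "prime_pow ` small_exponents M \<subseteq> {..nat \<lceil>exp M\<rceil>}"
  proof (rule image_subsetI)
    fix \<alpha> assume "\<alpha> \<in> small_exponents M"
    then have "ln (real (prime_pow \<alpha>)) < M"
      by (auto simp: small_exponents_def log_weight_eq_ln)
    then have "exp (ln (real (prime_pow \<alpha>))) < exp M" by simp
    then have "real (prime_pow \<alpha>) < exp M"
      using prime_pow_pos[of \<alpha>] by (subst (asm) exp_ln) auto
    then show "prime_pow \<alpha> \<in> {..nat \<lceil>exp M\<rceil>}" by simp linarith
  qed
  then show "finite (prime_pow ` small_exponents M)"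
    by (rule finite_subset) simp
qed

text \<open>As \<open>d\<close> grows, these boxes are a Foelner sequence for the exponents supported in the first \<open>N\<close> coordinates: the
  translate of a box by a fixed one meets the box in almost all of its points.\<close>

definition exponent_box :: "nat \<Rightarrow> nat \<Rightarrow> (nat \<Rightarrow>\<^sub>0 int) set"
  where "exponent_box N d = {\<beta>. \<forall>j. 0 \<le> Poly_Mapping.lookup \<beta> j \<and>
    Poly_Mapping.lookup \<beta> j < (if j < N then int d else 1)}"

lemma card_exponent_box:
  assumes d: "0 < d"
  shows "finite (exponent_box N d)" "card (exponent_box N d) = d ^ N"
proof -
  define emb where "emb x = Abs_poly_mapping (\<lambda>j. if j < N then int (x j) else 0)" for x :: "nat \<Rightarrow> nat"
  have emb: "Poly_Mapping.lookup (emb x) j = (if j < N then int (x j) else 0)" for x j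
    unfolding emb_def by (subst lookup_Abs_poly_mapping) (auto intro: finite_subset[of _ "{..<N}"])
  let ?X = "Pi\<^sub>E {..<N} (\<lambda>_. {..<d})"
  have "inj_on emb ?X"
  proof (rule inj_onI)
    fix x y assume xy: "x \<in> ?X" "y \<in> ?X" "emb x = emb y"
    show "x = y"
    proof (rule PiE_ext[OF xy(1,2)])
      fix j assume "j \<in> {..<N}"
      then show "x j = y j" using arg_cong[OF xy(3), of "\<lambda>\<beta>. Poly_Mapping.lookup \<beta> j"] by (simp add: emb)
    qed
  qed
  moreover have "emb ` ?X = exponent_box N d"
  proof (intro equalityI subsetI)
    fix \<beta> assume "\<beta> \<in> emb ` ?X"
    then show "\<beta> \<in> exponent_box N d"
      using d unfolding exponent_box_def by (force simp: emb PiE_iff)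
  next
    fix \<beta> assume \<beta>: "\<beta> \<in> exponent_box N d"
    define x where "x = restrict (\<lambda>j. nat (Poly_Mapping.lookup \<beta> j)) {..<N}"
    have b: "0 \<le> Poly_Mapping.lookup \<beta> j" "j < N \<Longrightarrow> Poly_Mapping.lookup \<beta> j < int d"
      "\<not> j < N \<Longrightarrow> Poly_Mapping.lookup \<beta> j = 0" for j
      using \<beta>[unfolded exponent_box_def mem_Collect_eq, rule_format, of j] d by auto
    have "x \<in> ?X" using b(1,2) d by (auto simp: x_def nat_less_iff)
    moreover have "emb x = \<beta>"
      by (rule poly_mapping_eqI) (use b in \<open>simp add: emb x_def\<close>)
    ultimately show "\<beta> \<in> emb ` ?X" by blast
  qed
  ultimately have "bij_betw emb ?X (exponent_box N d)" by (simp add: bij_betw_def)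
  moreover have "finite ?X" by (simp add: finite_PiE)
  ultimately show "finite (exponent_box N d)" "card (exponent_box N d) = d ^ N"
    using bij_betw_same_card[of emb ?X] bij_betw_finite[of emb ?X] by (simp_all add: card_PiE)
qed

definition overlap :: "(nat \<Rightarrow>\<^sub>0 int) set \<Rightarrow> (nat \<Rightarrow>\<^sub>0 int) \<Rightarrow> real"
  where "overlap S \<alpha> = real (card {x \<in> S \<times> S. fst x - snd x = \<alpha>}) / real (card S)"

lemma overlap_exponent_box_tendsto:
  assumes \<alpha>: "\<alpha> \<in> nonneg_exponents" and N: "Poly_Mapping.keys \<alpha> \<subseteq> {..<N}"
  shows "(\<lambda>d. overlap (exponent_box N (Suc d)) \<alpha>) \<longlonglongrightarrow> 1"
proof -
  define D where "D = nat (\<Sum>j\<in>Poly_Mapping.keys \<alpha>. Poly_Mapping.lookup \<alpha> j)"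
  have nn: "0 \<le> Poly_Mapping.lookup \<alpha> j" for j
    using \<alpha> by (simp add: nonneg_exponents_def)
  have D: "Poly_Mapping.lookup \<alpha> j \<le> int D" for j
  proof (cases "j \<in> Poly_Mapping.keys \<alpha>")
    case True
    then show ?thesis
      using nn member_le_sum[of j "Poly_Mapping.keys \<alpha>" "Poly_Mapping.lookup \<alpha>"] by (simp add: D_def sum_nonneg)
  qed (simp add: in_keys_iff)
  have out: "Poly_Mapping.lookup \<alpha> j = 0" if "\<not> j < N" for j
    using N that by (auto simp: in_keys_iff)
  let ?X = "\<lambda>d. {x \<in> exponent_box N (Suc d) \<times> exponent_box N (Suc d). fst x - snd x = \<alpha>}"
  have upper: "card (?X d) \<le> Suc d ^ N" for d
  proof -
    have "card (?X d) \<le> card (exponent_box N (Suc d))"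
    proof (rule card_inj_on_le[of snd])
      show "inj_on snd (?X d)" by (auto simp: inj_on_def algebra_simps)
    qed (auto simp: card_exponent_box)
    then show ?thesis by (simp add: card_exponent_box)
  qed
  have lower: "(Suc d - D) ^ N \<le> card (?X d)" if d: "D \<le> d" for d
  proof -
    have "card (exponent_box N (Suc d - D)) \<le> card (?X d)"
    proof (rule card_inj_on_le[of "\<lambda>\<gamma>. (\<gamma> + \<alpha>, \<gamma>)"])
      show "inj_on (\<lambda>\<gamma>. (\<gamma> + \<alpha>, \<gamma>)) (exponent_box N (Suc d - D))" by (auto simp: inj_on_def)
      show "finite (?X d)"
        by (rule finite_subset[of _ "exponent_box N (Suc d) \<times> exponent_box N (Suc d)"]) (auto simp: card_exponent_box)
      show "(\<lambda>\<gamma>. (\<gamma> + \<alpha>, \<gamma>)) ` exponent_box N (Suc d - D) \<subseteq> ?X d"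
      proof (rule image_subsetI)
        fix \<gamma> assume g: "\<gamma> \<in> exponent_box N (Suc d - D)"
        have g': "0 \<le> Poly_Mapping.lookup \<gamma> j" "j < N \<Longrightarrow> Poly_Mapping.lookup \<gamma> j < int (Suc d - D)"
          "\<not> j < N \<Longrightarrow> Poly_Mapping.lookup \<gamma> j < 1" for j
          using g[unfolded exponent_box_def mem_Collect_eq, rule_format, of j] d by auto
        have "\<gamma> \<in> exponent_box N (Suc d)"
          unfolding exponent_box_def using g' by (fastforce simp: of_nat_diff)
        moreover have "\<gamma> + \<alpha> \<in> exponent_box N (Suc d)"
          unfolding exponent_box_def mem_Collect_eq
        proof (intro allI conjI)
          fix j
          show "0 \<le> Poly_Mapping.lookup (\<gamma> + \<alpha>) j" using g'(1) nn by (simp add: lookup_add)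
          show "Poly_Mapping.lookup (\<gamma> + \<alpha>) j < (if j < N then int (Suc d) else 1)"
          proof (cases "j < N")
            case True
            then show ?thesis using g'(2)[OF True] D[of j] d by (simp add: lookup_add of_nat_diff)
          next
            case False
            then show ?thesis using g'(3)[OF False] out[OF False] by (simp add: lookup_add)
          qed
        qed
        ultimately show "(\<gamma> + \<alpha>, \<gamma>) \<in> ?X d" by simp
      qed
    qed
    then show ?thesis using d by (simp add: card_exponent_box)
  qed
  have ov: "overlap (exponent_box N (Suc d)) \<alpha> = real (card (?X d)) / real (Suc d) ^ N" for d
    by (simp add: overlap_def card_exponent_box)
  show ?thesis
  proof (rule tendsto_sandwich)
    show "\<forall>\<^sub>F d in sequentially. (1 - real D / real (Suc d)) ^ N \<le> overlap (exponent_box N (Suc d)) \<alpha>"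
    proof (rule eventually_sequentiallyI)
      fix d assume d: "D \<le> d"
      have "(1 - real D / real (Suc d)) ^ N = (real (Suc d - D) / real (Suc d)) ^ N"
        using d by (simp add: of_nat_diff field_simps)
      also have "\<dots> = real ((Suc d - D) ^ N) / real (Suc d) ^ N" by (simp add: power_divide)
      also have "\<dots> \<le> overlap (exponent_box N (Suc d)) \<alpha>"
        unfolding ov using lower[OF d] by (intro divide_right_mono of_nat_mono) auto
      finally show "(1 - real D / real (Suc d)) ^ N \<le> overlap (exponent_box N (Suc d)) \<alpha>" .
    qed
    show "\<forall>\<^sub>F d in sequentially. overlap (exponent_box N (Suc d)) \<alpha> \<le> 1"
    proof (rule always_eventually, rule allI)
      fix d
      have "real (card (?X d)) \<le> real (Suc d) ^ N"
        using of_nat_mono[OF upper[of d], where 'a = real] by (simp only: of_nat_power)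
      then show "overlap (exponent_box N (Suc d)) \<alpha> \<le> 1"
        unfolding ov by (simp add: divide_le_eq)
    qed
    have "(\<lambda>d. real D / real (Suc d)) \<longlonglongrightarrow> 0"
      by (rule LIMSEQ_Suc[OF lim_const_over_n])
    then have "(\<lambda>d. (1 - real D / real (Suc d)) ^ N) \<longlonglongrightarrow> (1 - 0) ^ N"
      by (intro tendsto_intros)
    then show "(\<lambda>d. (1 - real D / real (Suc d)) ^ N) \<longlonglongrightarrow> 1" by simp
  qed simp
qed

section \<open>Exact quadrature on a finite cyclic set of rotations\<close>

lemma prod_cis: "(\<Prod>j\<in>J. cis (f j)) = cis (\<Sum>j\<in>J. f j)"
  by (induction J rule: infinite_finite_induct) (auto simp: cis_mult)

text \<open>Finitely many nonzero exponents \<open>\<alpha>\<close> are separated from \<open>0\<close> by one integral evaluation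
  \<open>\<alpha> \<mapsto> \<Sum>j \<alpha>\<^sub>j R\<^sup>j\<close>, since a nonzero polynomial has finitely many roots; the points are then the powers
  of a single element of finite order.\<close>

lemma quadrature_exists:
  assumes A: "finite A" "0 \<notin> A"
  obtains m and G :: "nat \<Rightarrow> nat \<Rightarrow> complex" where "0 < m" "\<And>l. G l \<in> torus"
    "\<And>\<alpha>. \<alpha> \<in> A \<Longrightarrow> (\<Sum>l<m. monomial \<alpha> (G l)) = 0"
proof -
  define Q where "Q \<alpha> = (\<Sum>j\<in>Poly_Mapping.keys \<alpha>. Polynomial.monom (Poly_Mapping.lookup \<alpha> j) j)" for \<alpha> :: "nat \<Rightarrow>\<^sub>0 int"
  have coeff_Q: "poly.coeff (Q \<alpha>) j = Poly_Mapping.lookup \<alpha> j" for \<alpha> j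
    by (simp add: Q_def coeff_sum in_keys_iff)
  have "finite {R. poly (Q \<alpha>) R = 0}" if "\<alpha> \<in> A" for \<alpha>
  proof (rule poly_roots_finite)
    have "\<alpha> \<noteq> 0" using that A by auto
    then show "Q \<alpha> \<noteq> 0" by (metis coeff_Q coeff_0 lookup_zero poly_mapping_eqI)
  qed
  then have "finite (\<Union>\<alpha>\<in>A. {R. poly (Q \<alpha>) R = 0})" using A(1) by blast
  then obtain R :: int where R: "R \<notin> (\<Union>\<alpha>\<in>A. {R. poly (Q \<alpha>) R = 0})"
    using ex_new_if_finite[OF infinite_UNIV_int] by blast
  define \<rho> where "\<rho> \<alpha> = poly (Q \<alpha>) R" for \<alpha>
  have \<rho>_nz: "\<rho> \<alpha> \<noteq> 0" if "\<alpha> \<in> A" for \<alpha> using R that by (auto simp: \<rho>_def)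
  have \<rho>_eq: "\<rho> \<alpha> = (\<Sum>j\<in>Poly_Mapping.keys \<alpha>. Poly_Mapping.lookup \<alpha> j * R ^ j)" for \<alpha>
    by (simp add: \<rho>_def Q_def poly_sum poly_monom)
  define m where "m = nat (1 + (\<Sum>\<alpha>\<in>A. \<bar>\<rho> \<alpha>\<bar>))"
  have m: "0 < m" "\<And>\<alpha>. \<alpha> \<in> A \<Longrightarrow> \<bar>\<rho> \<alpha>\<bar> < int m"
  proof -
    have nn: "0 \<le> (\<Sum>\<alpha>\<in>A. \<bar>\<rho> \<alpha>\<bar>)" by (rule sum_nonneg) simp
    then show "0 < m" unfolding m_def by linarith
    fix \<alpha> assume "\<alpha> \<in> A"
    then have "\<bar>\<rho> \<alpha>\<bar> \<le> (\<Sum>\<alpha>\<in>A. \<bar>\<rho> \<alpha>\<bar>)" using A(1) by (intro member_le_sum) auto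
    then show "\<bar>\<rho> \<alpha>\<bar> < int m" using nn by (simp add: m_def)
  qed
  define G :: "nat \<Rightarrow> nat \<Rightarrow> complex" where "G l j = cis (real l * (2 * pi * real_of_int (R ^ j) / real m))" for l j
  have "G l \<in> torus" for l by (simp add: torus_def G_def)
  moreover have "(\<Sum>l<m. monomial \<alpha> (G l)) = 0" if \<alpha>: "\<alpha> \<in> A" for \<alpha>
  proof -
    define z where "z = cis (2 * pi * real_of_int (\<rho> \<alpha>) / real m)"
    have "monomial \<alpha> (G l) = z ^ l" for l
    proof -
      have "monomial \<alpha> (G l) = cis (\<Sum>j\<in>Poly_Mapping.keys \<alpha>. real_of_int (Poly_Mapping.lookup \<alpha> j) * (real l * (2 * pi * real_of_int (R ^ j) / real m)))"
        by (simp add: monomial_def G_def cis_power_int prod_cis)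
      also have "(\<Sum>j\<in>Poly_Mapping.keys \<alpha>. real_of_int (Poly_Mapping.lookup \<alpha> j) * (real l * (2 * pi * real_of_int (R ^ j) / real m)))
        = real l * (2 * pi * real_of_int (\<rho> \<alpha>) / real m)"
        by (simp add: \<rho>_eq sum_distrib_left sum_divide_distrib mult_ac)
      finally show ?thesis by (simp only: z_def Complex.DeMoivre)
    qed
    moreover have "z \<noteq> 1"
    proof
      assume "z = 1"
      then have "cos (2 * pi * real_of_int (\<rho> \<alpha>) / real m) = 1"
        by (metis z_def cis.sel(1) one_complex.sel(1))
      then obtain k :: int where "2 * pi * real_of_int (\<rho> \<alpha>) / real m = real_of_int k * 2 * pi"
        by (auto simp: cos_one_2pi_int)
      then have "real_of_int (\<rho> \<alpha>) = real_of_int (k * int m)"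
        using m(1) by (simp add: field_simps)
      then have "\<rho> \<alpha> = k * int m" by (simp only: of_int_eq_iff)
      then show False
        using m(2)[OF \<alpha>] \<rho>_nz[OF \<alpha>] by (metis dvd_triv_right zdvd_imp_le abs_dvd_iff dvd_abs_iff not_le zero_less_abs_iff)
    qed
    moreover have "z ^ m = 1"
      using m(1) by (simp add: z_def Complex.DeMoivre)
    ultimately show ?thesis by (simp add: geometric_sum)
  qed
  ultimately show ?thesis using that[OF m(1)] by blast
qed

section \<open>Cone absolutely summing operators on nonnegative kernels\<close>

lemma bounded_operator_sum:
  assumes q: "1 \<le> q" and T: "T \<in> bounded_operators (torus_lattice q)"
    and f: "\<And>i. i \<in> I \<Longrightarrow> f i \<in> elements (torus_lattice q)"
  shows "(\<lambda>\<omega>. \<Sum>i\<in>I. c i * f i \<omega>) \<in> elements (torus_lattice q) \<and>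
    T (\<lambda>\<omega>. \<Sum>i\<in>I. c i * f i \<omega>) = (\<Sum>i\<in>I. c i *\<^sub>C T (f i))"
proof -
  have add: "\<And>f g. f \<in> elements (torus_lattice q) \<Longrightarrow> g \<in> elements (torus_lattice q) \<Longrightarrow> T (\<lambda>x. f x + g x) = T f + T g"
    and scale: "\<And>c f. f \<in> elements (torus_lattice q) \<Longrightarrow> T (\<lambda>x. c * f x) = c *\<^sub>C T f"
    using T by (auto simp: bounded_operators_def)
  have one: "(\<lambda>\<omega>. 1) \<in> elements (torus_lattice q)"
    by (rule continuous_in_lattice[OF q]) simp
  have zero: "(\<lambda>\<omega>. 0) \<in> elements (torus_lattice q)" "T (\<lambda>\<omega>. 0) = 0"
    using torus_lattice_cmult[OF q one, of 0] scale[OF one, of 0] by simp_all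
  show ?thesis
    using f
  proof (induction I rule: infinite_finite_induct)
    case (insert i I)
    have ci: "(\<lambda>\<omega>. c i * f i \<omega>) \<in> elements (torus_lattice q)"
      using insert.prems by (intro torus_lattice_cmult q) simp
    have IH: "(\<lambda>\<omega>. \<Sum>i\<in>I. c i * f i \<omega>) \<in> elements (torus_lattice q)"
      "T (\<lambda>\<omega>. \<Sum>i\<in>I. c i * f i \<omega>) = (\<Sum>i\<in>I. c i *\<^sub>C T (f i))"
      using insert by simp_all
    show ?case
      using insert.hyps torus_lattice_add[OF q ci IH(1)] add[OF ci IH(1)] IH(2) scale[of "f i" "c i"] insert.prems
      by simp
  qed (simp_all add: zero)
qed

lemma zero_in_dual_ball: "(\<lambda>f. 0) \<in> dual_ball (torus_lattice q)"
  using lattice_norm_nonneg by (auto simp: dual_ball_def bounded_operators_def scaleC_complex_def intro!: exI[of _ 0])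

text \<open>Multiplying the functions by unimodular constants (or \<open>0\<close>) turns the sum of moduli into one value of the
  functional.\<close>

lemma dual_ball_sum_le:
  fixes n :: nat
  assumes q: "1 \<le> q" and \<xi>: "\<xi> \<in> dual_ball (torus_lattice q)"
    and F: "\<And>l. l < n \<Longrightarrow> F l \<in> elements (torus_lattice q)"
    and B: "\<And>h. h \<in> elements (torus_lattice q) \<Longrightarrow>
      (\<And>\<omega>. \<omega> \<in> torus \<Longrightarrow> cmod (h \<omega>) \<le> (\<Sum>l<n. cmod (F l \<omega>))) \<Longrightarrow> lattice_norm (torus_lattice q) h \<le> B"
  shows "(\<Sum>l<n. cmod (\<xi> (F l))) \<le> B"
proof -
  define c where "c l = cnj (sgn (\<xi> (F l)))" for l
  have c: "cmod (c l) \<le> 1" "c l * \<xi> (F l) = cmod (\<xi> (F l))" for l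
  proof -
    show "cmod (c l) \<le> 1" by (simp add: c_def norm_sgn)
    show "c l * \<xi> (F l) = cmod (\<xi> (F l))"
    proof (cases "\<xi> (F l) = 0")
      case False
      have "\<xi> (F l) * cnj (\<xi> (F l)) = complex_of_real (cmod (\<xi> (F l))) * complex_of_real (cmod (\<xi> (F l)))"
        by (simp add: complex_norm_square[symmetric] power2_eq_square)
      then show ?thesis
        using False by (simp add: c_def sgn_eq field_simps)
    qed (simp add: c_def)
  qed
  have \<xi>': "\<xi> \<in> bounded_operators (torus_lattice q)"
    "\<And>h. h \<in> elements (torus_lattice q) \<Longrightarrow> cmod (\<xi> h) \<le> lattice_norm (torus_lattice q) h"
    using \<xi> by (auto simp: dual_ball_def)
  let ?h = "\<lambda>\<omega>. \<Sum>l<n. c l * F l \<omega>"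
  have h: "?h \<in> elements (torus_lattice q)" "\<xi> ?h = (\<Sum>l<n. c l *\<^sub>C \<xi> (F l))"
    using bounded_operator_sum[OF q \<xi>'(1), of "{..<n}" F c] F by auto
  have "\<xi> ?h = complex_of_real (\<Sum>l<n. cmod (\<xi> (F l)))"
    using h(2) c(2) by (simp add: scaleC_complex_def)
  then have "(\<Sum>l<n. cmod (\<xi> (F l))) = cmod (\<xi> ?h)"
    by (simp only: norm_of_real abs_of_nonneg[OF sum_nonneg] norm_ge_zero)
  also have "\<dots> \<le> lattice_norm (torus_lattice q) ?h" by (rule \<xi>'(2)[OF h(1)])
  also have "\<dots> \<le> B"
  proof (rule B[OF h(1)])
    fix \<omega> :: "nat \<Rightarrow> complex"
    have "cmod (?h \<omega>) \<le> (\<Sum>l<n. cmod (c l * F l \<omega>))" by (rule norm_sum)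
    also have "\<dots> \<le> (\<Sum>l<n. cmod (F l \<omega>))"
      using c(1) by (intro sum_mono) (simp add: norm_mult mult_left_le_one_le)
    finally show "cmod (?h \<omega>) \<le> (\<Sum>l<n. cmod (F l \<omega>))" .
  qed
  finally show ?thesis .
qed

lemma cas_bound_sum_le:
  fixes n :: nat
  assumes q: "1 \<le> q" and T: "cas_bound (torus_lattice q) T C" "0 \<le> C"
    and F: "\<And>l. l < n \<Longrightarrow> F l \<in> elements (torus_lattice q)" "\<And>l. l < n \<Longrightarrow> F l \<in> positives (torus_lattice q)"
    and B: "\<And>h. h \<in> elements (torus_lattice q) \<Longrightarrow>
      (\<And>\<omega>. \<omega> \<in> torus \<Longrightarrow> cmod (h \<omega>) \<le> (\<Sum>l<n. cmod (F l \<omega>))) \<Longrightarrow> lattice_norm (torus_lattice q) h \<le> B"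
  shows "(\<Sum>l<n. norm (T (F l))) \<le> C * B"
proof -
  have "(\<Sum>l<n. norm (T (F l))) \<le> C * (SUP \<xi>\<in>dual_ball (torus_lattice q). \<Sum>l<n. cmod (\<xi> (F l)))"
    using T(1)[unfolded cas_bound_def, rule_format, of n F] F(2) by simp
  also have "\<dots> \<le> C * B"
  proof (rule mult_left_mono[OF cSUP_least T(2)])
    show "dual_ball (torus_lattice q) \<noteq> {}" using zero_in_dual_ball by blast
    show "(\<Sum>l<n. cmod (\<xi> (F l))) \<le> B" if "\<xi> \<in> dual_ball (torus_lattice q)" for \<xi>
      by (rule dual_ball_sum_le[OF q that F(1) B])
  qed
  finally show ?thesis .
qed

lemma nonneg_continuous_in_positives:
  assumes q: "1 \<le> q" and h: "continuous_on torus h" "\<And>\<omega>. \<omega> \<in> torus \<Longrightarrow> h \<omega> \<in> \<real>\<^sub>\<ge>\<^sub>0"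
  shows "h \<in> positives (torus_lattice q)"
proof (cases "q = \<infinity>")
  case True
  then show ?thesis using h by (simp add: torus_lattice_infinity)
next
  case False
  have "AE \<omega> in haar. h \<omega> \<in> \<real>\<^sub>\<ge>\<^sub>0" by (rule AE_I2) (simp add: space_haar h)
  then show ?thesis
    using False continuous_in_lattice[OF q h(1)] by (simp add: torus_lattice_finite)
qed

text \<open>With \<open>c = 1\<close> and a box \<open>S\<close> this is the Fejer kernel at \<open>\<omega> / \<eta>\<close>. Its Fourier coefficient at \<open>\<alpha>\<close> is the
  overlap of \<open>S\<close> with its translate by \<open>\<alpha>\<close>, times \<open>c\<close> at the weight of \<open>\<alpha>\<close>.\<close>

definition trig_kernel :: "(real \<Rightarrow> real) \<Rightarrow> (nat \<Rightarrow>\<^sub>0 int) set \<Rightarrow> (nat \<Rightarrow> complex) \<Rightarrow> (nat \<Rightarrow> complex) \<Rightarrow> complex"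
  where "trig_kernel c S \<omega> \<eta> = (\<Sum>x\<in>S \<times> S.
    (complex_of_real (c (log_weight (fst x) - log_weight (snd x)) / real (card S)) * monomial (fst x - snd x) \<omega>)
      * monomial (- (fst x - snd x)) \<eta>)"

lemma trig_kernel_nonneg:
  assumes c: "positive_type c" and S: "finite S" and t: "\<omega> \<in> torus" "\<eta> \<in> torus"
  shows "\<exists>k\<ge>0. trig_kernel c S \<omega> \<eta> = complex_of_real k"
proof -
  define z where "z \<beta> = monomial \<beta> \<omega> * cnj (monomial \<beta> \<eta>)" for \<beta>
  define a where "a \<beta> \<gamma> = c (log_weight \<beta> - log_weight \<gamma>)" for \<beta> \<gamma>
  have sym: "a \<beta> \<gamma> = a \<gamma> \<beta>" for \<beta> \<gamma>
    using positive_type_even[OF c, of "log_weight \<beta> - log_weight \<gamma>"] by (simp add: a_def)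
  define k where "k = (\<Sum>\<beta>\<in>S. \<Sum>\<gamma>\<in>S. Re (z \<beta> * cnj (z \<gamma>)) * a \<beta> \<gamma>)"
  have "0 \<le> k" unfolding k_def a_def by (rule positive_type_sum_nonneg[OF c S])
  have "(\<Sum>\<beta>\<in>S. \<Sum>\<gamma>\<in>S. Im (z \<beta> * cnj (z \<gamma>)) * a \<beta> \<gamma>) = (\<Sum>\<gamma>\<in>S. \<Sum>\<beta>\<in>S. Im (z \<beta> * cnj (z \<gamma>)) * a \<beta> \<gamma>)"
    by (rule sum.swap)
  also have "\<dots> = (\<Sum>\<gamma>\<in>S. \<Sum>\<beta>\<in>S. - (Im (z \<gamma> * cnj (z \<beta>)) * a \<gamma> \<beta>))"
    by (intro sum.cong refl) (simp add: sym[of _ "_"] algebra_simps)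
  finally have im: "(\<Sum>\<beta>\<in>S. \<Sum>\<gamma>\<in>S. Im (z \<beta> * cnj (z \<gamma>)) * a \<beta> \<gamma>) = 0"
    by (simp add: sum_negf)
  have "trig_kernel c S \<omega> \<eta> = (\<Sum>\<beta>\<in>S. \<Sum>\<gamma>\<in>S. z \<beta> * cnj (z \<gamma>) * complex_of_real (a \<beta> \<gamma>)) / of_nat (card S)"
    unfolding trig_kernel_def sum_divide_distrib sum.cartesian_product
    by (rule sum.cong) (auto simp: z_def a_def monomial_diff[OF t(1)] monomial_diff[OF t(2)] mult_ac)
  also have "(\<Sum>\<beta>\<in>S. \<Sum>\<gamma>\<in>S. z \<beta> * cnj (z \<gamma>) * complex_of_real (a \<beta> \<gamma>)) = complex_of_real k"
  proof (rule complex_eqI)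
    show "Re (\<Sum>\<beta>\<in>S. \<Sum>\<gamma>\<in>S. z \<beta> * cnj (z \<gamma>) * complex_of_real (a \<beta> \<gamma>)) = Re (complex_of_real k)"
      unfolding k_def Re_sum Re_complex_of_real by (intro sum.cong refl) simp
    show "Im (\<Sum>\<beta>\<in>S. \<Sum>\<gamma>\<in>S. z \<beta> * cnj (z \<gamma>) * complex_of_real (a \<beta> \<gamma>)) = Im (complex_of_real k)"
      unfolding Im_sum Im_complex_of_real im[symmetric] by (intro sum.cong refl) simp
  qed
  finally have "trig_kernel c S \<omega> \<eta> = complex_of_real (k / real (card S))" by simp
  then show ?thesis using \<open>0 \<le> k\<close> by (intro exI[of _ "k / real (card S)"]) simp
qed

lemma continuous_on_trig_kernel: "continuous_on torus (trig_kernel c S \<omega>)"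
  unfolding trig_kernel_def[abs_def]
  by (intro continuous_on_sum continuous_on_mult continuous_on_const continuous_on_monomial)

lemma sum_diagonal:
  fixes g :: "(nat \<Rightarrow>\<^sub>0 int) \<times> (nat \<Rightarrow>\<^sub>0 int) \<Rightarrow> complex"
  assumes "finite S" "\<And>x. x \<in> S \<times> S \<Longrightarrow> fst x \<noteq> snd x \<Longrightarrow> g x = 0" "\<And>\<beta>. \<beta> \<in> S \<Longrightarrow> g (\<beta>, \<beta>) = y"
  shows "(\<Sum>x\<in>S \<times> S. g x) = of_nat (card S) * y"
proof -
  have "(\<Sum>x\<in>S \<times> S. g x) = (\<Sum>x\<in>(\<lambda>\<beta>. (\<beta>, \<beta>)) ` S. g x)"
  proof (rule sum.mono_neutral_right)
    show "\<forall>x\<in>S \<times> S - (\<lambda>\<beta>. (\<beta>, \<beta>)) ` S. g x = 0"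
    proof
      fix x assume x: "x \<in> S \<times> S - (\<lambda>\<beta>. (\<beta>, \<beta>)) ` S"
      then have "fst x \<noteq> snd x" by (cases x) auto
      then show "g x = 0" using x assms(2) by blast
    qed
  qed (use assms(1) in auto)
  also have "\<dots> = (\<Sum>\<beta>\<in>S. g (\<beta>, \<beta>))"
    by (subst sum.reindex) (auto simp: inj_on_def)
  also have "\<dots> = (\<Sum>\<beta>\<in>S. y)" by (rule sum.cong) (use assms in auto)
  finally show ?thesis by simp
qed

text \<open>The quadrature has to annihilate the finitely many nonzero differences of elements of \<open>S\<close>.\<close>

lemma trig_kernel_quadrature:
  assumes S: "finite S" "S \<noteq> {}"
  obtains m and G :: "nat \<Rightarrow> nat \<Rightarrow> complex" where "0 < m" "\<And>l. G l \<in> torus"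
    "\<And>c \<omega> \<eta>. \<omega> \<in> torus \<Longrightarrow> \<eta> \<in> torus \<Longrightarrow>
      (\<Sum>l<m. trig_kernel c S (\<lambda>j. G l j * \<omega> j) \<eta>) = of_nat m * complex_of_real (c 0)"
proof -
  define A where "A = (\<lambda>x. fst x - snd x) ` {x \<in> S \<times> S. fst x \<noteq> snd x}"
  have A: "finite A" "0 \<notin> A" using S by (auto simp: A_def)
  obtain m and G :: "nat \<Rightarrow> nat \<Rightarrow> complex"
    where G: "0 < m" "\<And>l. G l \<in> torus" "\<And>\<alpha>. \<alpha> \<in> A \<Longrightarrow> (\<Sum>l<m. monomial \<alpha> (G l)) = 0"
    using quadrature_exists[OF A] by metis
  have "(\<Sum>l<m. trig_kernel c S (\<lambda>j. G l j * \<omega> j) \<eta>) = of_nat m * complex_of_real (c 0)"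
    if t: "\<omega> \<in> torus" "\<eta> \<in> torus" for c \<omega> \<eta>
  proof -
    define b where "b x = complex_of_real (c (log_weight (fst x) - log_weight (snd x)) / real (card S))
      * monomial (fst x - snd x) \<omega> * monomial (- (fst x - snd x)) \<eta>" for x
    have "(\<Sum>l<m. trig_kernel c S (\<lambda>j. G l j * \<omega> j) \<eta>) = (\<Sum>l<m. \<Sum>x\<in>S \<times> S. b x * monomial (fst x - snd x) (G l))"
      unfolding trig_kernel_def by (intro sum.cong refl) (simp add: b_def monomial_mult mult_ac)
    also have "\<dots> = (\<Sum>x\<in>S \<times> S. b x * (\<Sum>l<m. monomial (fst x - snd x) (G l)))"
      by (subst sum.swap) (simp add: sum_distrib_left)
    also have "\<dots> = of_nat (card S) * (complex_of_real (c 0 / real (card S)) * of_nat m)"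
    proof (rule sum_diagonal[OF S(1)])
      show "b x * (\<Sum>l<m. monomial (fst x - snd x) (G l)) = 0" if "x \<in> S \<times> S" "fst x \<noteq> snd x" for x
      proof -
        have "fst x - snd x \<in> A" unfolding A_def using that by blast
        then show ?thesis by (simp only: G(3) mult_zero_right)
      qed
    qed (simp add: b_def)
    finally show ?thesis using S by (simp add: field_simps)
  qed
  from this show ?thesis by (rule that[OF G(1,2)])
qed

lemma nn_integral_trig_kernel:
  assumes c: "positive_type c" and S: "finite S" "S \<noteq> {}" and t: "\<omega> \<in> torus"
  shows "(\<integral>\<^sup>+\<eta>. ennreal (cmod (trig_kernel c S \<omega> \<eta>)) \<partial>haar) = ennreal (c 0)"
proof -
  have int: "integrable haar (trig_kernel c S \<omega>)"
    unfolding trig_kernel_def[abs_def]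
    by (intro Bochner_Integration.integrable_sum integrable_mult_right integrable_monomial)
  have "integral\<^sup>L haar (trig_kernel c S \<omega>) = (\<Sum>x\<in>S \<times> S.
    complex_of_real (c (log_weight (fst x) - log_weight (snd x)) / real (card S)) * monomial (fst x - snd x) \<omega>
      * integral\<^sup>L haar (monomial (- (fst x - snd x))))"
    unfolding trig_kernel_def[abs_def]
    by (subst Bochner_Integration.integral_sum) (simp_all add: integrable_monomial)
  also have "\<dots> = of_nat (card S) * complex_of_real (c 0 / real (card S))"
    by (rule sum_diagonal[OF S(1)]) (simp_all add: integral_monomial)
  finally have I: "integral\<^sup>L haar (trig_kernel c S \<omega>) = complex_of_real (c 0)" using S by simp
  have pos: "0 \<le> Re (trig_kernel c S \<omega> \<eta>)" "cmod (trig_kernel c S \<omega> \<eta>) = Re (trig_kernel c S \<omega> \<eta>)" if "\<eta> \<in> torus" for \<eta>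
    using trig_kernel_nonneg[OF c S(1) t that] by auto
  have "(\<integral>\<^sup>+\<eta>. ennreal (cmod (trig_kernel c S \<omega> \<eta>)) \<partial>haar) = (\<integral>\<^sup>+\<eta>. ennreal (Re (trig_kernel c S \<omega> \<eta>)) \<partial>haar)"
    by (rule nn_integral_cong) (simp add: space_haar pos)
  also have "\<dots> = ennreal (\<integral>\<eta>. Re (trig_kernel c S \<omega> \<eta>) \<partial>haar)"
    by (rule nn_integral_eq_integral) (use int pos in \<open>auto intro!: AE_I2 simp: space_haar\<close>)
  also have "(\<integral>\<eta>. Re (trig_kernel c S \<omega> \<eta>) \<partial>haar) = c 0"
    using int I by (simp add: integral_Re)
  finally show ?thesis .
qed

text \<open>With \<open>x\<close> the weighted mean of the \<open>h\<^sub>i\<close>, average Young's inequality for \<open>h\<^sub>i\<close> and \<open>x\<^sup>s\<^sup>-\<^sup>1\<close>.\<close>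

lemma weighted_power_mean:
  fixes w h :: "'i \<Rightarrow> real"
  assumes w: "\<And>i. i \<in> I \<Longrightarrow> 0 \<le> w i" and h: "\<And>i. i \<in> I \<Longrightarrow> 0 \<le> h i"
    and W: "0 < (\<Sum>i\<in>I. w i)" and s: "1 < s"
  shows "(\<Sum>i\<in>I. w i * h i) powr s \<le> (\<Sum>i\<in>I. w i) powr (s - 1) * (\<Sum>i\<in>I. w i * h i powr s)"
proof -
  define V where "V = (\<Sum>i\<in>I. w i)"
  define x where "x = (\<Sum>i\<in>I. w i * h i) / V"
  define r where "r = s / (s - 1)"
  have r: "1 < r" "1 / s + 1 / r = 1" "(s - 1) * r = s" using s by (auto simp: r_def field_simps)
  have V: "0 < V" using W by (simp add: V_def)
  have x: "0 \<le> x" unfolding x_def using w h V by (intro divide_nonneg_pos sum_nonneg) auto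
  have xx: "x * x powr (s - 1) = x powr s"
    using x by (cases "x = 0") (auto simp: powr_mult_base)
  have Young: "w i * (h i * x powr (s - 1)) \<le> w i * (h i powr s / s + x powr s / r)" if "i \<in> I" for i
    using Youngs_inequality[of s r "h i" "x powr (s - 1)"] s r h[OF that] w[OF that]
    by (intro mult_left_mono) (auto simp: powr_powr)
  have "V * x powr s = V * x * x powr (s - 1)" by (simp add: xx mult.assoc)
  also have "\<dots> = (\<Sum>i\<in>I. w i * h i) * x powr (s - 1)" using V by (simp add: x_def)
  also have "\<dots> = (\<Sum>i\<in>I. w i * (h i * x powr (s - 1)))" by (simp add: sum_distrib_right mult.assoc)
  also have "\<dots> \<le> (\<Sum>i\<in>I. w i * (h i powr s / s + x powr s / r))" by (rule sum_mono) (rule Young)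
  also have "\<dots> = (\<Sum>i\<in>I. w i * h i powr s) / s + V * x powr s / r"
    by (simp add: V_def distrib_left sum.distrib sum_divide_distrib sum_distrib_right)
  finally have "V * x powr s * (1 - 1 / r) \<le> (\<Sum>i\<in>I. w i * h i powr s) / s"
    by (simp add: algebra_simps)
  moreover have "1 - 1 / r = 1 / s" using r(2) by simp
  ultimately have "V * x powr s \<le> (\<Sum>i\<in>I. w i * h i powr s)"
    using s by (simp add: divide_le_cancel)
  then have "V powr (s - 1) * (V * x powr s) \<le> V powr (s - 1) * (\<Sum>i\<in>I. w i * h i powr s)"
    by (rule mult_left_mono) simp
  moreover have "V powr (s - 1) * (V * x powr s) = (V * x) powr s"
    using V x powr_mult_base[of V "s - 1"] by (simp add: powr_mult mult.left_commute)
  moreover have "V * x = (\<Sum>i\<in>I. w i * h i)" using V by (simp add: x_def)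
  ultimately show ?thesis by (simp add: V_def)
qed

text \<open>For \<open>1 < p < \<infinity>\<close> the average of \<open>\<parallel>f\<parallel>\<^sup>p\<close> over the quadrature points is estimated by testing \<open>T\<close> on the
  kernels weighted by \<open>\<parallel>f\<parallel>\<^sup>p\<^sup>-\<^sup>1\<close>; since the kernels average to a constant, convexity bounds the norm of
  the sum of the test functions.\<close>

lemma average_norm_powr_le:
  fixes T :: "((nat \<Rightarrow> complex) \<Rightarrow> complex) \<Rightarrow> 'x::complex_banach"
  assumes p: "1 \<le> p" "1 / p + 1 / p' = 1" "p \<noteq> \<infinity>"
    and T: "T \<in> bounded_operators (torus_lattice p')" "cas_bound (torus_lattice p') T C" "0 \<le> C"
    and c: "positive_type c" "0 < c 0" and S: "finite S" "S \<noteq> {}"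
    and m: "0 < m" and G: "\<And>l. G l \<in> torus"
    and quad: "\<And>\<eta>. \<eta> \<in> torus \<Longrightarrow> (\<Sum>l<m. trig_kernel c S (G l) \<eta>) = of_nat m * complex_of_real (c 0)"
  shows "(\<Sum>l<m. norm (T (trig_kernel c S (G l))) powr enn2real p) \<le> real m * (C * c 0) powr enn2real p"
proof -
  note p' = conjugate_exponent_ge_1[OF p(1,2)]
  define k where "k l \<eta> = cmod (trig_kernel c S (G l) \<eta>)" for l \<eta>
  have k: "trig_kernel c S (G l) \<eta> = complex_of_real (k l \<eta>)" if "\<eta> \<in> torus" for l \<eta>
    using trig_kernel_nonneg[OF c(1) S(1) G[of l] that] by (auto simp: k_def)
  have k0: "0 \<le> k l \<eta>" for l \<eta> by (simp add: k_def)
  have ksum: "(\<Sum>l<m. k l \<eta>) = real m * c 0" if "\<eta> \<in> torus" for \<eta>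
  proof -
    have "complex_of_real (\<Sum>l<m. k l \<eta>) = complex_of_real (real m * c 0)"
      using quad[OF that] k[OF that] by simp
    then show ?thesis by (simp only: of_real_eq_iff)
  qed
  define b where "b l = norm (T (trig_kernel c S (G l)))" for l
  have b0: "0 \<le> b l" for l by (simp add: b_def)
  have K: "trig_kernel c S (G l) \<in> elements (torus_lattice p')" for l
    by (rule continuous_in_lattice[OF p' continuous_on_trig_kernel])
  have scale: "norm (T (\<lambda>\<eta>. complex_of_real x * trig_kernel c S (G l) \<eta>)) = x * b l" if "0 \<le> x" for x l
  proof -
    have "T (\<lambda>\<eta>. complex_of_real x * trig_kernel c S (G l) \<eta>) = complex_of_real x *\<^sub>C T (trig_kernel c S (G l))"
      using T(1) K by (simp add: bounded_operators_def)
    then show ?thesis using that by (simp add: norm_scaleC b_def)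
  qed
  have test: "(\<Sum>l<m. x l * b l) \<le> C * B"
    if x: "\<And>l. 0 \<le> x l"
      and B: "\<And>h. h \<in> elements (torus_lattice p') \<Longrightarrow>
        (\<And>\<eta>. \<eta> \<in> torus \<Longrightarrow> cmod (h \<eta>) \<le> (\<Sum>l<m. x l * k l \<eta>)) \<Longrightarrow> lattice_norm (torus_lattice p') h \<le> B" for x B
  proof -
    let ?F = "\<lambda>l \<eta>. complex_of_real (x l) * trig_kernel c S (G l) \<eta>"
    have cont: "continuous_on torus (?F l)" for l
      by (intro continuous_on_mult continuous_on_const continuous_on_trig_kernel)
    have "(\<Sum>l<m. norm (T (?F l))) \<le> C * B"
    proof (rule cas_bound_sum_le[OF p' T(2,3)])
      show "?F l \<in> elements (torus_lattice p')" for l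
        by (rule continuous_in_lattice[OF p' cont])
      show "?F l \<in> positives (torus_lattice p')" for l
        by (rule nonneg_continuous_in_positives[OF p' cont]) (simp add: k k0 x flip: of_real_mult)
      show "lattice_norm (torus_lattice p') h \<le> B"
        if "h \<in> elements (torus_lattice p')" "\<And>\<eta>. \<eta> \<in> torus \<Longrightarrow> cmod (h \<eta>) \<le> (\<Sum>l<m. cmod (?F l \<eta>))" for h
        using that x by (intro B) (simp_all add: norm_mult k_def)
    qed
    then show ?thesis by (simp only: scale[OF x])
  qed
  from p(1,2) show ?thesis
  proof (cases rule: conjugate_exponent_cases)
    case 1
    have "(\<Sum>l<m. 1 / real m * b l) \<le> C * c 0"
    proof (rule test)
      fix h assume "h \<in> elements (torus_lattice p')"
        and h: "\<And>\<eta>. \<eta> \<in> torus \<Longrightarrow> cmod (h \<eta>) \<le> (\<Sum>l<m. 1 / real m * k l \<eta>)"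
      then have "continuous_on torus h" using 1 by (simp add: torus_lattice_infinity)
      moreover have "cmod (h \<eta>) \<le> c 0" if "\<eta> \<in> torus" for \<eta>
        using h[OF that] ksum[OF that] m by (simp add: sum_divide_distrib[symmetric])
      ultimately show "lattice_norm (torus_lattice p') h \<le> c 0"
        by (rule continuous_bounded_lattice(2)[OF p'])
    qed simp
    then have "(\<Sum>l<m. b l) \<le> real m * (C * c 0)"
      using m by (simp add: sum_divide_distrib[symmetric] field_simps)
    then show ?thesis using 1 T(3) c(2) by (simp add: b_def)
  next
    case 2
    then show ?thesis using p(3) by simp
  next
    case 3
    define r s where "r = enn2real p" and "s = enn2real p'"
    have rs: "1 < r" "1 < s" "1 / r + 1 / s = 1" using 3 by (auto simp: r_def s_def)
    have rs': "(r - 1) * s = r" using rs by (simp add: field_simps)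
    define A where "A = (\<Sum>l<m. b l powr r) / real m"
    have A0: "0 \<le> A" unfolding A_def by (intro divide_nonneg_nonneg sum_nonneg) auto
    \<comment> \<open>the weights at which Hoelder's inequality for the average of \<open>b\<close> is an equality\<close>
    define x where "x l = b l powr (r - 1) / real m" for l
    have "(\<Sum>l<m. x l * b l) \<le> C * (c 0 * A powr (1 / s))"
    proof (rule test)
      show "0 \<le> x l" for l by (simp add: x_def)
      fix h assume he: "h \<in> elements (torus_lattice p')"
        and h: "\<And>\<eta>. \<eta> \<in> torus \<Longrightarrow> cmod (h \<eta>) \<le> (\<Sum>l<m. x l * k l \<eta>)"
      have pw: "cmod (h \<eta>) powr s \<le> (\<Sum>l<m. (c 0 powr (s - 1) * b l powr r / real m) * k l \<eta>)" if "\<eta> \<in> torus" for \<eta>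
      proof -
        have V: "(\<Sum>l<m. k l \<eta> / real m) = c 0"
          using ksum[OF that] m by (simp add: sum_divide_distrib[symmetric])
        have "cmod (h \<eta>) powr s \<le> (\<Sum>l<m. k l \<eta> / real m * b l powr (r - 1)) powr s"
          using h[OF that] rs by (intro powr_mono2) (auto simp: x_def mult_ac)
        also have "\<dots> \<le> (\<Sum>l<m. k l \<eta> / real m) powr (s - 1) * (\<Sum>l<m. k l \<eta> / real m * (b l powr (r - 1)) powr s)"
          using rs by (intro weighted_power_mean) (auto simp: k0 V c)
        also have "\<dots> = (\<Sum>l<m. (c 0 powr (s - 1) * b l powr r / real m) * k l \<eta>)"
          unfolding V powr_powr rs' by (simp add: sum_distrib_left mult_ac)
        finally show ?thesis .
      qed
      have km: "k l \<in> borel_measurable haar" for l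
        unfolding k_def[abs_def]
        by (rule borel_measurable_haar_continuous[OF continuous_on_norm[OF continuous_on_trig_kernel]])
      have "(\<integral>\<^sup>+\<eta>. ennreal (cmod (h \<eta>) powr s) \<partial>haar)
        \<le> (\<integral>\<^sup>+\<eta>. (\<Sum>l<m. ennreal (c 0 powr (s - 1) * b l powr r / real m) * ennreal (k l \<eta>)) \<partial>haar)"
      proof (rule nn_integral_mono)
        fix \<eta> assume "\<eta> \<in> space haar"
        then have "\<eta> \<in> torus" by (simp add: space_haar)
        then have "ennreal (cmod (h \<eta>) powr s) \<le> ennreal (\<Sum>l<m. (c 0 powr (s - 1) * b l powr r / real m) * k l \<eta>)"
          by (intro ennreal_leI pw)
        also have "\<dots> = (\<Sum>l<m. ennreal ((c 0 powr (s - 1) * b l powr r / real m) * k l \<eta>))"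
          by (rule sum_ennreal[symmetric]) (simp add: k0)
        also have "\<dots> = (\<Sum>l<m. ennreal (c 0 powr (s - 1) * b l powr r / real m) * ennreal (k l \<eta>))"
          by (intro sum.cong refl ennreal_mult) (simp_all add: k0)
        finally show "ennreal (cmod (h \<eta>) powr s)
          \<le> (\<Sum>l<m. ennreal (c 0 powr (s - 1) * b l powr r / real m) * ennreal (k l \<eta>))" .
      qed
      also have "\<dots> = (\<Sum>l<m. ennreal (c 0 powr (s - 1) * b l powr r / real m) * (\<integral>\<^sup>+\<eta>. ennreal (k l \<eta>) \<partial>haar))"
        using km by (subst nn_integral_sum) (simp_all add: nn_integral_cmult)
      also have "\<dots> = (\<Sum>l<m. ennreal (c 0 powr (s - 1) * b l powr r / real m) * ennreal (c 0))"
        unfolding k_def by (simp only: nn_integral_trig_kernel[OF c(1) S G])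
      also have "\<dots> = (\<Sum>l<m. ennreal (c 0 powr (s - 1) * b l powr r / real m * c 0))"
        using c(2) by (intro sum.cong refl ennreal_mult[symmetric]) simp_all
      also have "\<dots> = ennreal (\<Sum>l<m. c 0 powr (s - 1) * b l powr r / real m * c 0)"
        using c(2) by (intro sum_ennreal) simp
      also have "(\<Sum>l<m. c 0 powr (s - 1) * b l powr r / real m * c 0) = c 0 * c 0 powr (s - 1) * A"
        by (simp add: A_def sum_distrib_left sum_divide_distrib mult_ac)
      also have "c 0 * c 0 powr (s - 1) * A = (c 0 * A powr (1 / s)) powr s"
        using c(2) A0 rs by (simp add: powr_mult_base powr_mult powr_powr)
      finally have "Lp_le p' h (c 0 * A powr (1 / s))"
        using 3 c(2) torus_lattice_measurable(2)[OF he] by (simp add: Lp_le_def s_def)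
      from Lp_norm_le[OF p' this] show "lattice_norm (torus_lattice p') h \<le> c 0 * A powr (1 / s)"
        using 3 by (simp add: torus_lattice_finite)
    qed
    moreover have "(\<Sum>l<m. x l * b l) = A"
    proof -
      have "x l * b l = b l powr r / real m" for l
        using powr_mult_base[OF b0[of l], of "r - 1"] by (simp add: x_def mult.commute)
      then show ?thesis by (simp add: A_def sum_divide_distrib)
    qed
    ultimately have le: "A \<le> (C * c 0) * A powr (1 / s)" by simp
    have "A \<le> (C * c 0) powr r"
    proof (cases "A = 0")
      case False
      then have A: "0 < A" using A0 by simp
      have "A powr (1 / r) * A powr (1 / s) = A"
        using A rs by (simp add: powr_add[symmetric])
      then have "A powr (1 / r) * A powr (1 / s) \<le> (C * c 0) * A powr (1 / s)"
        using le by simp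
      then have "A powr (1 / r) \<le> C * c 0"
        using A by (simp add: mult_le_cancel_right)
      then have "(A powr (1 / r)) powr r \<le> (C * c 0) powr r"
        using rs by (intro powr_mono2) auto
      then show ?thesis using A rs by (simp add: powr_powr)
    qed simp
    then have "(\<Sum>l<m. b l powr r) \<le> real m * (C * c 0) powr r"
      using m by (simp add: A_def field_simps)
    then show ?thesis by (simp add: b_def r_def)
  qed
qed

lemma operator_trig_kernel:
  assumes q: "1 \<le> q" and T: "T \<in> bounded_operators (torus_lattice q)"
  shows "T (trig_kernel c S \<omega>) = (\<Sum>x\<in>S \<times> S.
    (complex_of_real (c (log_weight (fst x) - log_weight (snd x)) / real (card S)) * monomial (fst x - snd x) \<omega>)
      *\<^sub>C T (monomial (- (fst x - snd x))))"
  unfolding trig_kernel_def[abs_def]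
  by (rule bounded_operator_sum[OF q T, THEN conjunct2]) (rule monomial_in_lattice[OF q])

lemma strongly_measurable_monomial_scaleC: "strongly_measurable haar (\<lambda>\<omega>. (a * monomial \<alpha> \<omega>) *\<^sub>C (x::'x::complex_banach))"
  by (intro strongly_measurable_scaleC strongly_measurable_const)
    (simp only: strongly_measurable_iff_borel_measurable borel_measurable_times borel_measurable_const borel_measurable_monomial)

text \<open>Integrating the averaged estimate over \<open>\<omega>\<close> removes the average, by rotation invariance. For \<open>p = \<infinity>\<close> a single
  kernel of \<open>L\<^sub>1\<close> norm \<open>c 0\<close> suffices.\<close>

lemma Lp_le_operator_trig_kernel:
  fixes T :: "((nat \<Rightarrow> complex) \<Rightarrow> complex) \<Rightarrow> 'x::complex_banach"
  assumes p: "1 \<le> p" "1 / p + 1 / p' = 1"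
    and T: "T \<in> bounded_operators (torus_lattice p')" "cas_bound (torus_lattice p') T C" "0 \<le> C"
    and c: "positive_type c" "0 < c 0" and S: "finite S" "S \<noteq> {}"
  shows "Lp_le p (\<lambda>\<omega>. T (trig_kernel c S \<omega>)) (C * c 0)"
proof -
  note p' = conjugate_exponent_ge_1[OF p]
  have sm: "strongly_measurable haar (\<lambda>\<omega>. T (trig_kernel c S \<omega>))"
    unfolding operator_trig_kernel[OF p' T(1)]
    by (intro strongly_measurable_sum strongly_measurable_monomial_scaleC)
  show ?thesis
  proof (cases "p = \<infinity>")
    case True
    have p1: "p' = 1"
      using p by (rule conjugate_exponent_cases) (use True in simp_all)
    have "norm (T (trig_kernel c S \<omega>)) \<le> C * c 0" if \<omega>: "\<omega> \<in> torus" for \<omega>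
    proof -
      have "(\<Sum>l<1::nat. norm (T (trig_kernel c S \<omega>))) \<le> C * c 0"
      proof (rule cas_bound_sum_le[OF p' T(2,3)])
        show "trig_kernel c S \<omega> \<in> elements (torus_lattice p')"
          by (rule continuous_in_lattice[OF p' continuous_on_trig_kernel])
        show "trig_kernel c S \<omega> \<in> positives (torus_lattice p')"
          by (rule nonneg_continuous_in_positives[OF p' continuous_on_trig_kernel])
            (use trig_kernel_nonneg[OF c(1) S(1) \<omega>] in fastforce)
        fix h assume he: "h \<in> elements (torus_lattice p')"
          and h: "\<And>\<eta>. \<eta> \<in> torus \<Longrightarrow> cmod (h \<eta>) \<le> (\<Sum>l<1::nat. cmod (trig_kernel c S \<omega> \<eta>))"
        have "(\<integral>\<^sup>+\<eta>. ennreal (cmod (h \<eta>)) \<partial>haar) \<le> (\<integral>\<^sup>+\<eta>. ennreal (cmod (trig_kernel c S \<omega> \<eta>)) \<partial>haar)"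
          by (intro nn_integral_mono ennreal_leI) (use h in \<open>simp add: space_haar\<close>)
        then have "Lp_le 1 h (c 0)"
          using c torus_lattice_measurable(2)[OF he] nn_integral_trig_kernel[OF c(1) S \<omega>] by (simp add: Lp_le_def)
        from Lp_norm_le[OF order_refl this] show "lattice_norm (torus_lattice p') h \<le> c 0"
          by (simp add: p1 torus_lattice_finite)
      qed
      then show ?thesis by simp
    qed
    then show ?thesis
      using T(3) c(2) by (intro Lp_le_bounded[OF p(1) sm]) auto
  next
    case False
    obtain m G where G: "0 < m" "\<And>l. G l \<in> torus"
      "\<And>c \<omega> \<eta>. \<omega> \<in> torus \<Longrightarrow> \<eta> \<in> torus \<Longrightarrow>
        (\<Sum>l<m. trig_kernel c S (\<lambda>j. G l j * \<omega> j) \<eta>) = of_nat m * complex_of_real (c 0)"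
      using trig_kernel_quadrature[OF S] by blast
    define \<phi> where "\<phi> \<omega> = ennreal (norm (T (trig_kernel c S \<omega>)) powr enn2real p)" for \<omega>
    have \<phi>: "\<phi> \<in> borel_measurable haar"
      unfolding \<phi>_def[abs_def] using strongly_measurable_norm[OF sm] by measurable
    have "of_nat m * (\<integral>\<^sup>+\<omega>. \<phi> \<omega> \<partial>haar) = (\<Sum>l<m. \<integral>\<^sup>+\<omega>. \<phi> (\<lambda>j. G l j * \<omega> j) \<partial>haar)"
      by (simp add: nn_integral_haar_rotate[OF G(2) \<phi>])
    also have "\<dots> = (\<integral>\<^sup>+\<omega>. (\<Sum>l<m. \<phi> (\<lambda>j. G l j * \<omega> j)) \<partial>haar)"
      by (rule nn_integral_sum[symmetric]) (rule measurable_compose[OF measurable_haar_rotate[OF G(2)] \<phi>])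
    also have "\<dots> \<le> (\<integral>\<^sup>+\<omega>. ennreal (real m * (C * c 0) powr enn2real p) \<partial>haar)"
    proof (rule nn_integral_mono)
      fix \<omega> assume "\<omega> \<in> space haar"
      then have \<omega>: "\<omega> \<in> torus" by (simp add: space_haar)
      have "(\<Sum>l<m. norm (T (trig_kernel c S (\<lambda>j. G l j * \<omega> j))) powr enn2real p) \<le> real m * (C * c 0) powr enn2real p"
        by (rule average_norm_powr_le[OF p False T c S G(1)]) (use G \<omega> torus_mult in auto)
      then show "(\<Sum>l<m. \<phi> (\<lambda>j. G l j * \<omega> j)) \<le> ennreal (real m * (C * c 0) powr enn2real p)"
        unfolding \<phi>_def by (subst sum_ennreal) (auto intro: ennreal_leI)
    qed
    also have "\<dots> = of_nat m * ennreal ((C * c 0) powr enn2real p)"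
      by (simp add: ennreal_mult ennreal_of_nat_eq_real_of_nat)
    finally have "(\<integral>\<^sup>+\<omega>. \<phi> \<omega> \<partial>haar) \<le> ennreal ((C * c 0) powr enn2real p)"
      using G(1) by (subst (asm) ennreal_mult_le_mult_iff) auto
    then show ?thesis
      using False T(3) c(2) sm by (simp add: Lp_le_def \<phi>_def)
  qed
qed

section \<open>From operators to Dirichlet series\<close>

text \<open>The lift of the Dirichlet polynomial \<open>\<Sum>\<^sub>n c (log n) a\<^sub>n n\<^sup>-\<^sup>s\<close> over \<open>log n < M\<close>, where \<open>a\<close> is the Bohr transform
  of \<open>T\<close>.\<close>

definition dirichlet_lift ::
  "(((nat \<Rightarrow> complex) \<Rightarrow> complex) \<Rightarrow> 'x::complex_banach) \<Rightarrow> (real \<Rightarrow> real) \<Rightarrow> real \<Rightarrow> (nat \<Rightarrow> complex) \<Rightarrow> 'x"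
  where "dirichlet_lift T c M \<omega> = (\<Sum>\<alpha>\<in>small_exponents M.
    (complex_of_real (c (log_weight \<alpha>)) * monomial \<alpha> \<omega>) *\<^sub>C T (monomial (- \<alpha>)))"

text \<open>The weights of exponents of both signs are dense in the reals, so a bounded support of \<open>c\<close> alone does not
  leave a finite set of exponents that serves for all \<open>S\<close>; the vanishing of \<open>T\<close> on the nonanalytic characters does.\<close>

lemma operator_trig_kernel_analytic:
  assumes q: "1 \<le> q" and T: "T \<in> bounded_operators (torus_lattice q)"
    and van: "\<And>\<alpha>. \<alpha> \<notin> nonneg_exponents \<Longrightarrow> T (monomial (- \<alpha>)) = 0"
    and c: "\<And>u. M \<le> \<bar>u\<bar> \<Longrightarrow> c u = 0" and S: "finite S"
  shows "T (trig_kernel c S \<omega>) = (\<Sum>\<alpha>\<in>small_exponents M.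
    (complex_of_real (overlap S \<alpha> * c (log_weight \<alpha>)) * monomial \<alpha> \<omega>) *\<^sub>C T (monomial (- \<alpha>)))"
proof -
  define g where "g \<alpha> = (complex_of_real (c (log_weight \<alpha>) / real (card S)) * monomial \<alpha> \<omega>) *\<^sub>C T (monomial (- \<alpha>))" for \<alpha>
  have g0: "g \<alpha> = 0" if "\<alpha> \<notin> small_exponents M" for \<alpha>
  proof (cases "\<alpha> \<in> nonneg_exponents")
    case True
    then have "M \<le> \<bar>log_weight \<alpha>\<bar>" using that by (auto simp: small_exponents_def)
    then show ?thesis by (simp add: g_def c)
  qed (simp add: g_def van)
  have "T (trig_kernel c S \<omega>) = (\<Sum>x\<in>S \<times> S. g (fst x - snd x))"
    unfolding operator_trig_kernel[OF q T] by (simp add: g_def log_weight_diff)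
  also have "\<dots> = (\<Sum>x\<in>S \<times> S. \<Sum>\<alpha>\<in>small_exponents M. if fst x - snd x = \<alpha> then g \<alpha> else 0)"
    by (intro sum.cong refl) (simp add: finite_small_exponents g0)
  also have "\<dots> = (\<Sum>\<alpha>\<in>small_exponents M. \<Sum>x\<in>S \<times> S. if fst x - snd x = \<alpha> then g \<alpha> else 0)"
    by (rule sum.swap)
  also have "\<dots> = (\<Sum>\<alpha>\<in>small_exponents M.
    (complex_of_real (overlap S \<alpha> * c (log_weight \<alpha>)) * monomial \<alpha> \<omega>) *\<^sub>C T (monomial (- \<alpha>)))"
  proof (rule sum.cong[OF refl])
    fix \<alpha>
    have "(\<Sum>x\<in>S \<times> S. if fst x - snd x = \<alpha> then g \<alpha> else 0) = (\<Sum>x\<in>{x \<in> S \<times> S. fst x - snd x = \<alpha>}. g \<alpha>)"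
      by (rule sum.inter_filter[symmetric]) (simp add: S)
    also have "\<dots> = real (card {x \<in> S \<times> S. fst x - snd x = \<alpha>}) *\<^sub>R g \<alpha>"
      by (simp add: scaleR_conv_of_real sum_constant_scaleR)
    also have "\<dots> = (complex_of_real (overlap S \<alpha> * c (log_weight \<alpha>)) * monomial \<alpha> \<omega>) *\<^sub>C T (monomial (- \<alpha>))"
      by (simp add: g_def overlap_def scaleC_of_real[symmetric] scaleC_scaleC mult_ac)
    finally show "(\<Sum>x\<in>S \<times> S. if fst x - snd x = \<alpha> then g \<alpha> else 0)
      = (complex_of_real (overlap S \<alpha> * c (log_weight \<alpha>)) * monomial \<alpha> \<omega>) *\<^sub>C T (monomial (- \<alpha>))" .
  qed
  finally show ?thesis .
qed

text \<open>Along growing boxes the overlaps tend to \<open>1\<close>, and the norm bound for the kernels passes to the limit.\<close>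

lemma Lp_le_dirichlet_lift:
  fixes T :: "((nat \<Rightarrow> complex) \<Rightarrow> complex) \<Rightarrow> 'x::complex_banach"
  assumes p: "1 \<le> p" "1 / p + 1 / p' = 1"
    and T: "T \<in> bounded_operators (torus_lattice p')" "cas_bound (torus_lattice p') T C" "0 \<le> C"
    and van: "\<And>\<alpha>. \<alpha> \<notin> nonneg_exponents \<Longrightarrow> T (monomial (- \<alpha>)) = 0"
    and c: "positive_type c" "0 < c 0" "\<And>u. M \<le> \<bar>u\<bar> \<Longrightarrow> c u = 0"
  shows "Lp_le p (dirichlet_lift T c M) (C * c 0)"
proof -
  note p' = conjugate_exponent_ge_1[OF p]
  obtain N where "(\<Union>\<alpha>\<in>small_exponents M. Poly_Mapping.keys \<alpha>) \<subseteq> {..<N}"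
    using finite_nat_bounded[of "\<Union>\<alpha>\<in>small_exponents M. Poly_Mapping.keys \<alpha>"] finite_small_exponents by auto
  then have N: "\<And>\<alpha>. \<alpha> \<in> small_exponents M \<Longrightarrow> Poly_Mapping.keys \<alpha> \<subseteq> {..<N}" by blast
  define S where "S d = exponent_box N (Suc d)" for d
  have S: "finite (S d)" "S d \<noteq> {}" for d
    using card_exponent_box[of "Suc d" N] by (auto simp: S_def)
  show ?thesis
  proof (rule Lp_le_limit)
    show "Lp_le p (\<lambda>\<omega>. T (trig_kernel c (S d) \<omega>)) (C * c 0)" for d
      by (rule Lp_le_operator_trig_kernel[OF p T c(1,2) S])
    show "strongly_measurable haar (dirichlet_lift T c M)"
      unfolding dirichlet_lift_def[abs_def]
      by (intro strongly_measurable_sum strongly_measurable_monomial_scaleC)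
    have "(\<lambda>d. T (trig_kernel c (S d) \<omega>)) \<longlonglongrightarrow> dirichlet_lift T c M \<omega>" for \<omega>
    proof -
      have "(\<lambda>d. \<Sum>\<alpha>\<in>small_exponents M.
          (complex_of_real (overlap (S d) \<alpha> * c (log_weight \<alpha>)) * monomial \<alpha> \<omega>) *\<^sub>C T (monomial (- \<alpha>)))
        \<longlonglongrightarrow> (\<Sum>\<alpha>\<in>small_exponents M.
          (complex_of_real (1 * c (log_weight \<alpha>)) * monomial \<alpha> \<omega>) *\<^sub>C T (monomial (- \<alpha>)))"
        unfolding S_def
        by (intro tendsto_sum tendsto_scaleC tendsto_mult tendsto_of_real tendsto_const
            overlap_exponent_box_tendsto N) (simp_all add: small_exponents_def)
      then show ?thesis
        by (simp add: dirichlet_lift_def operator_trig_kernel_analytic[OF p' T(1) van c(3) S(1)])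
    qed
    then show "AE \<omega> in haar. (\<lambda>d. T (trig_kernel c (S d) \<omega>)) \<longlonglongrightarrow> dirichlet_lift T c M \<omega>"
      by simp
  qed (rule p)
qed

lemma fourier_coeff_dirichlet_lift:
  "fourier_coeff (dirichlet_lift T c M) \<alpha>
    = (if \<alpha> \<in> small_exponents M then c (log_weight \<alpha>) *\<^sub>R T (monomial (- \<alpha>)) else 0)"
proof -
  let ?t = "\<lambda>\<beta> \<omega>. complex_of_real (c (log_weight \<beta>)) *\<^sub>C (monomial (\<beta> - \<alpha>) \<omega> *\<^sub>C T (monomial (- \<beta>)))"
  have "has_strong_integral haar (\<lambda>\<omega>. \<Sum>\<beta>\<in>small_exponents M. ?t \<beta> \<omega>)
    (\<Sum>\<beta>\<in>small_exponents M. complex_of_real (c (log_weight \<beta>)) *\<^sub>C (if \<beta> - \<alpha> = 0 then T (monomial (- \<beta>)) else 0))"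
    by (intro has_strong_integral_sum has_strong_integral_bounded_linear[OF bounded_linear_scaleC_right]
        has_strong_integral_monomial_scaleC)
  also have "(\<Sum>\<beta>\<in>small_exponents M. complex_of_real (c (log_weight \<beta>)) *\<^sub>C (if \<beta> - \<alpha> = 0 then T (monomial (- \<beta>)) else 0))
    = (\<Sum>\<beta>\<in>small_exponents M. if \<alpha> = \<beta> then c (log_weight \<beta>) *\<^sub>R T (monomial (- \<beta>)) else 0)"
    by (rule sum.cong) (auto simp: scaleC_of_real)
  also have "\<dots> = (if \<alpha> \<in> small_exponents M then c (log_weight \<alpha>) *\<^sub>R T (monomial (- \<alpha>)) else 0)"
    by (simp add: finite_small_exponents)
  finally have "has_strong_integral haar (\<lambda>\<omega>. \<Sum>\<beta>\<in>small_exponents M. ?t \<beta> \<omega>)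
    (if \<alpha> \<in> small_exponents M then c (log_weight \<alpha>) *\<^sub>R T (monomial (- \<alpha>)) else 0)" .
  moreover have "monomial (- \<alpha>) \<omega> *\<^sub>C dirichlet_lift T c M \<omega> = (\<Sum>\<beta>\<in>small_exponents M. ?t \<beta> \<omega>)"
    if "\<omega> \<in> space haar" for \<omega>
    using that monomial_add[of \<omega> _ "- \<alpha>"]
    by (simp add: dirichlet_lift_def scaleC_sum_right scaleC_scaleC space_haar mult_ac)
  ultimately have "has_strong_integral haar (\<lambda>\<omega>. monomial (- \<alpha>) \<omega> *\<^sub>C dirichlet_lift T c M \<omega>)
    (if \<alpha> \<in> small_exponents M then c (log_weight \<alpha>) *\<^sub>R T (monomial (- \<alpha>)) else 0)"
    using has_strong_integral_cong[of haar "\<lambda>\<omega>. monomial (- \<alpha>) \<omega> *\<^sub>C dirichlet_lift T c M \<omega>"] by simp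
  then show ?thesis unfolding fourier_coeff_def by (rule strong_integral_eq)
qed

lemma dirichlet_lift_polya_sum:
  "(\<Sum>i<n. dirichlet_lift T (polya \<epsilon> (real i) (real (Suc i))) (real (Suc i)) \<omega>)
    = dirichlet_lift T (polya \<epsilon> 0 (real n)) (real n) \<omega>"
proof -
  let ?t = "\<lambda>c \<alpha>. (complex_of_real (c (log_weight \<alpha>)) * monomial \<alpha> \<omega>) *\<^sub>C T (monomial (- \<alpha>))"
  have "dirichlet_lift T (polya \<epsilon> (real i) (real (Suc i))) (real (Suc i)) \<omega>
    = (\<Sum>\<alpha>\<in>small_exponents (real n). ?t (polya \<epsilon> (real i) (real (Suc i))) \<alpha>)" if "i < n" for i
    unfolding dirichlet_lift_def
  proof (rule sum.mono_neutral_left[OF finite_small_exponents])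
    show "small_exponents (real (Suc i)) \<subseteq> small_exponents (real n)"
      using that by (auto simp: small_exponents_def)
    show "\<forall>\<alpha>\<in>small_exponents (real n) - small_exponents (real (Suc i)). ?t (polya \<epsilon> (real i) (real (Suc i))) \<alpha> = 0"
    proof
      fix \<alpha> assume "\<alpha> \<in> small_exponents (real n) - small_exponents (real (Suc i))"
      then have "real (Suc i) \<le> \<bar>log_weight \<alpha>\<bar>" by (auto simp: small_exponents_def)
      then show "?t (polya \<epsilon> (real i) (real (Suc i))) \<alpha> = 0" by (simp only: polya_eq_0) simp
    qed
  qed
  then have "(\<Sum>i<n. dirichlet_lift T (polya \<epsilon> (real i) (real (Suc i))) (real (Suc i)) \<omega>)
    = (\<Sum>i<n. \<Sum>\<alpha>\<in>small_exponents (real n). ?t (polya \<epsilon> (real i) (real (Suc i))) \<alpha>)"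
    by simp
  also have "\<dots> = (\<Sum>\<alpha>\<in>small_exponents (real n). \<Sum>i<n. ?t (polya \<epsilon> (real i) (real (Suc i))) \<alpha>)"
    by (rule sum.swap)
  also have "\<dots> = (\<Sum>\<alpha>\<in>small_exponents (real n). ?t (polya \<epsilon> 0 (real n)) \<alpha>)"
    by (intro sum.cong refl)
      (simp only: polya_sum[symmetric] of_real_sum sum_distrib_right scaleC_sum_left)
  finally show ?thesis by (simp add: dirichlet_lift_def)
qed

text \<open>The pieces given by the convex decomposition of \<open>exp (- \<epsilon> \<bar>u\<bar>)\<close> have norms summing to at most \<open>C\<close>, so
  their sum converges almost everywhere and in mean.\<close>

lemma operator_shift_lift:
  fixes T :: "((nat \<Rightarrow> complex) \<Rightarrow> complex) \<Rightarrow> 'x::complex_banach"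
  assumes p: "1 \<le> p" "1 / p + 1 / p' = 1"
    and T: "T \<in> cas_plus p'" "cas_bound (torus_lattice p') T C" "0 \<le> C" and \<epsilon>: "0 < \<epsilon>"
  shows "\<exists>f. is_lift p (dirichlet_shift \<epsilon> (bohr_transform T)) f \<and> Lp_le p f C"
proof -
  have Tb: "T \<in> bounded_operators (torus_lattice p')"
    and van: "\<And>\<alpha>. \<alpha> \<notin> nonneg_exponents \<Longrightarrow> T (monomial (- \<alpha>)) = 0"
    using T(1) by (auto simp: cas_plus_def cas_operators_def)
  define k where "k i = polya \<epsilon> (real i) (real (Suc i))" for i
  define g where "g i = dirichlet_lift T (k i) (real (Suc i))" for i
  define F where "F n = dirichlet_lift T (polya \<epsilon> 0 (real n)) (real n)" for n
  have gF: "(\<Sum>i<n. g i \<omega>) = F n \<omega>" for n \<omega>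
    unfolding g_def k_def F_def by (rule dirichlet_lift_polya_sum)
  have gL: "Lp_le p (g i) (C * k i 0)" for i
    unfolding g_def k_def
    by (rule Lp_le_dirichlet_lift[OF p Tb T(2,3) van positive_type_polya polya_0_pos polya_eq_0]) (use \<epsilon> in auto)
  have FL: "Lp_le p (F n) C" for n
  \<comment> \<open>for \<open>n = 0\<close> the multiplier vanishes, while \<open>Lp_le_dirichlet_lift\<close> needs a positive value at \<open>0\<close>\<close>
  proof (cases "n = 0")
    case True
    have "small_exponents 0 = {}" using log_weight_nonneg by (force simp: small_exponents_def)
    then have "F n = (\<lambda>\<omega>. 0)" by (simp add: F_def dirichlet_lift_def[abs_def] True)
    then show ?thesis using T(3) by (simp add: Lp_le_bounded[OF p(1)] strongly_measurable_const)
  next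
    case False
    have "Lp_le p (F n) (C * polya \<epsilon> 0 (real n) 0)"
      unfolding F_def
      by (rule Lp_le_dirichlet_lift[OF p Tb T(2,3) van positive_type_polya polya_0_pos polya_eq_0])
        (use \<epsilon> False in auto)
    then show ?thesis
      by (rule Lp_le_mono) (use polya_0_le_1[OF \<epsilon>, of "real n"] T(3) in \<open>simp add: mult_left_le\<close>)
  qed
  have gm: "strongly_measurable haar (g i)" and Fm: "strongly_measurable haar (F i)" for i
    by (rule Lp_le_measurable[OF gL], rule Lp_le_measurable[OF FL])
  have [measurable]: "(\<lambda>\<omega>. norm (g i \<omega>)) \<in> borel_measurable haar" for i
    by (rule strongly_measurable_norm[OF gm])
  define H where "H \<omega> = (suminf (\<lambda>i. ennreal (norm (g i \<omega>))))" for \<omega>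
  have Hm[measurable]: "H \<in> borel_measurable haar" unfolding H_def by measurable
  have "(\<integral>\<^sup>+\<omega>. H \<omega> \<partial>haar) = (suminf (\<lambda>i. \<integral>\<^sup>+\<omega>. ennreal (norm (g i \<omega>)) \<partial>haar))"
    unfolding H_def by (rule nn_integral_suminf) measurable
  also have "\<dots> \<le> ennreal C"
  proof (rule suminf_le_const)
    fix n
    have k0: "0 \<le> k i 0" for i
      unfolding k_def by (rule less_imp_le[OF polya_0_pos]) (use \<epsilon> in auto)
    have "(\<Sum>i<n. \<integral>\<^sup>+\<omega>. ennreal (norm (g i \<omega>)) \<partial>haar) \<le> (\<Sum>i<n. ennreal (C * k i 0))"
      by (rule sum_mono) (rule Lp_le_imp_L1[OF p gL])
    also have "\<dots> = ennreal (C * polya \<epsilon> 0 (real n) 0)"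
      using T(3) k0 by (subst sum_ennreal) (simp_all only: sum_distrib_left[symmetric] k_def polya_sum mult_nonneg_nonneg)
    also have "\<dots> \<le> ennreal C"
      by (intro ennreal_leI) (use polya_0_le_1[OF \<epsilon>, of "real n"] T(3) in \<open>simp add: mult_left_le\<close>)
    finally show "(\<Sum>i<n. \<integral>\<^sup>+\<omega>. ennreal (norm (g i \<omega>)) \<partial>haar) \<le> ennreal C" .
  qed simp
  finally have Hint: "(\<integral>\<^sup>+\<omega>. H \<omega> \<partial>haar) \<le> ennreal C" .
  define Good where "Good = {\<omega> \<in> space haar. H \<omega> < \<infinity>}"
  have Good[measurable]: "Good \<in> sets haar" unfolding Good_def by measurable
  have AE_Good: "AE \<omega> in haar. \<omega> \<in> Good"
  proof -
    have "(\<integral>\<^sup>+\<omega>. H \<omega> \<partial>haar) \<noteq> \<infinity>"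
      using le_less_trans[OF Hint ennreal_less_top] by simp
    then have "AE \<omega> in haar. H \<omega> \<noteq> \<infinity>" by (intro nn_integral_PInf_AE Hm)
    with AE_space show ?thesis by eventually_elim (simp add: Good_def less_top)
  qed
  have summ: "summable (\<lambda>i. norm (g i \<omega>))" if "\<omega> \<in> Good" for \<omega>
    using that by (intro summable_suminf_not_top) (auto simp: Good_def H_def less_top)
  define f where "f \<omega> = (if \<omega> \<in> Good then (suminf (\<lambda>i. g i \<omega>)) else 0)" for \<omega>
  have lim: "(\<lambda>n. F n \<omega>) \<longlonglongrightarrow> f \<omega>" if "\<omega> \<in> Good" for \<omega>
    using summable_LIMSEQ[OF summable_norm_cancel[OF summ[OF that]]] that by (simp add: f_def gF)
  have fm: "strongly_measurable haar f"
  proof (rule strongly_measurable_LIMSEQ)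
    fix n
    have "strongly_measurable haar (\<lambda>\<omega>. (indicator Good \<omega> :: complex))"
      unfolding strongly_measurable_iff_borel_measurable by measurable
    then show "strongly_measurable haar (\<lambda>\<omega>. (indicator Good \<omega> :: complex) *\<^sub>C F n \<omega>)"
      by (rule strongly_measurable_scaleC[OF _ Fm])
  next
    fix \<omega>
    show "(\<lambda>n. (indicator Good \<omega> :: complex) *\<^sub>C F n \<omega>) \<longlonglongrightarrow> f \<omega>"
      using lim[of \<omega>] by (cases "\<omega> \<in> Good") (simp_all add: f_def)
  qed
  have fL: "Lp_le p f C"
    by (rule Lp_le_limit[OF FL fm _ p(1)]) (use AE_Good lim in \<open>auto elim!: eventually_mono\<close>)
  have dist: "(\<lambda>n. \<integral>\<^sup>+\<omega>. ennreal (norm (f \<omega> - F n \<omega>)) \<partial>haar) \<longlonglongrightarrow> 0"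
  proof -
    have "(\<lambda>n. \<integral>\<^sup>+\<omega>. ennreal (norm (f \<omega> - F n \<omega>)) \<partial>haar) \<longlonglongrightarrow> (\<integral>\<^sup>+\<omega>. 0 \<partial>haar)"
    proof (rule nn_integral_dominated_convergence[where w = H])
      show "(\<lambda>\<omega>. ennreal (norm (f \<omega> - F n \<omega>))) \<in> borel_measurable haar" for n
        using strongly_measurable_norm[OF strongly_measurable_diff[OF fm Fm]] by simp
      show "(\<integral>\<^sup>+\<omega>. H \<omega> \<partial>haar) < \<infinity>"
        using le_less_trans[OF Hint ennreal_less_top] by simp
      show "AE \<omega> in haar. ennreal (norm (f \<omega> - F n \<omega>)) \<le> H \<omega>" for n
        using AE_Good
      proof eventually_elim
        case (elim \<omega>)
        note s = summ[OF elim]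
        have "f \<omega> - F n \<omega> = (suminf (\<lambda>i. g (i + n) \<omega>))"
          using suminf_minus_initial_segment[OF summable_norm_cancel[OF s], of n] elim by (simp add: f_def gF)
        then have "norm (f \<omega> - F n \<omega>) \<le> (suminf (\<lambda>i. norm (g (i + n) \<omega>)))"
          using summable_norm[OF summable_ignore_initial_segment[OF s]] by simp
        also have "\<dots> \<le> (suminf (\<lambda>i. norm (g i \<omega>)))"
          using suminf_minus_initial_segment[OF s, of n] sum_nonneg[of "{..<n}" "\<lambda>i. norm (g i \<omega>)"] by simp
        finally have "ennreal (norm (f \<omega> - F n \<omega>)) \<le> ennreal (suminf (\<lambda>i. norm (g i \<omega>)))" by (rule ennreal_leI)
        also have "\<dots> = H \<omega>" unfolding H_def by (rule suminf_ennreal2[symmetric]) (simp_all add: s)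
        finally show ?case .
      qed
      show "AE \<omega> in haar. (\<lambda>n. ennreal (norm (f \<omega> - F n \<omega>))) \<longlonglongrightarrow> 0"
        using AE_Good
      proof eventually_elim
        case (elim \<omega>)
        have "(\<lambda>n. norm (f \<omega> - F n \<omega>)) \<longlonglongrightarrow> norm (f \<omega> - f \<omega>)"
          by (intro tendsto_norm tendsto_diff tendsto_const lim elim)
        from tendsto_ennrealI[OF this] show ?case by simp
      qed
    qed measurable
    then show ?thesis by (simp only: nn_integral_const mult_zero_left)
  qed
  have intf: "strongly_integrable haar f" and intF: "strongly_integrable haar (F n)" for n
    by (rule Lp_le_imp_strongly_integrable[OF p fL], rule Lp_le_imp_strongly_integrable[OF p FL])
  have coeff_lim: "(\<lambda>n. fourier_coeff (F n) \<alpha>) \<longlonglongrightarrow> fourier_coeff f \<alpha>" for \<alpha>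
  proof (rule Lim_transform2[OF tendsto_const])
    have le: "ennreal (norm (fourier_coeff f \<alpha> - fourier_coeff (F n) \<alpha>)) \<le> (\<integral>\<^sup>+\<omega>. ennreal (norm (f \<omega> - F n \<omega>)) \<partial>haar)" for n
    proof -
      note i = strongly_integrable_monomial_mult[OF intf, of "- \<alpha>"] strongly_integrable_monomial_mult[OF intF[of n], of "- \<alpha>"]
      have "has_strong_integral haar (\<lambda>\<omega>. monomial (- \<alpha>) \<omega> *\<^sub>C f \<omega> + - (monomial (- \<alpha>) \<omega> *\<^sub>C F n \<omega>))
        (fourier_coeff f \<alpha> + - fourier_coeff (F n) \<alpha>)"
        unfolding fourier_coeff_def
        by (intro has_strong_integral_add has_strong_integral_strong_integral i
            has_strong_integral_bounded_linear[OF bounded_linear_minus[OF bounded_linear_ident]])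
      from has_strong_integral_norm_le[OF this]
      have "ennreal (norm (fourier_coeff f \<alpha> - fourier_coeff (F n) \<alpha>))
        \<le> (\<integral>\<^sup>+\<omega>. ennreal (norm (monomial (- \<alpha>) \<omega> *\<^sub>C f \<omega> - monomial (- \<alpha>) \<omega> *\<^sub>C F n \<omega>)) \<partial>haar)" by simp
      also have "\<dots> = (\<integral>\<^sup>+\<omega>. ennreal (norm (f \<omega> - F n \<omega>)) \<partial>haar)"
        by (rule nn_integral_cong) (simp add: scaleC_diff_right[symmetric] norm_scaleC norm_monomial space_haar)
      finally show ?thesis .
    qed
    have "(\<lambda>n. ennreal (norm (fourier_coeff f \<alpha> - fourier_coeff (F n) \<alpha>))) \<longlonglongrightarrow> 0"
      by (rule tendsto_sandwich[OF _ _ tendsto_const dist]) (auto intro!: always_eventually le)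
    then have "(\<lambda>n. norm (fourier_coeff f \<alpha> - fourier_coeff (F n) \<alpha>)) \<longlonglongrightarrow> 0"
      using tendsto_ennreal_iff[of "\<lambda>n. norm (fourier_coeff f \<alpha> - fourier_coeff (F n) \<alpha>)" sequentially 0] by simp
    then show "(\<lambda>n. fourier_coeff f \<alpha> - fourier_coeff (F n) \<alpha>) \<longlonglongrightarrow> 0"
      by (rule tendsto_norm_zero_cancel)
  qed
  have "fourier_coeff f \<alpha> = exp (- \<epsilon> * log_weight \<alpha>) *\<^sub>R T (monomial (- \<alpha>))" if \<alpha>: "\<alpha> \<in> nonneg_exponents" for \<alpha>
  proof (rule LIMSEQ_unique[OF coeff_lim])
    have "(\<lambda>n. polya \<epsilon> 0 (real n) (log_weight \<alpha>) *\<^sub>R T (monomial (- \<alpha>))) \<longlonglongrightarrow> exp (- \<epsilon> * log_weight \<alpha>) *\<^sub>R T (monomial (- \<alpha>))"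
      using polya_tendsto[OF \<epsilon>, of "log_weight \<alpha>"] log_weight_nonneg[OF \<alpha>] by (intro tendsto_scaleR tendsto_const) simp
    moreover have "fourier_coeff (F n) \<alpha> = polya \<epsilon> 0 (real n) (log_weight \<alpha>) *\<^sub>R T (monomial (- \<alpha>))" for n
      using \<alpha> log_weight_nonneg[OF \<alpha>] polya_eq_0[of "real n" "log_weight \<alpha>" \<epsilon> 0]
      by (auto simp: F_def fourier_coeff_dirichlet_lift small_exponents_def)
    ultimately show "(\<lambda>n. fourier_coeff (F n) \<alpha>) \<longlonglongrightarrow> exp (- \<epsilon> * log_weight \<alpha>) *\<^sub>R T (monomial (- \<alpha>))" by simp
  qed
  moreover have "exp (- \<epsilon> * log_weight \<alpha>) = 1 / real (prime_pow \<alpha>) powr \<epsilon>" if "\<alpha> \<in> nonneg_exponents" for \<alpha>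
    using prime_pow_pos[of \<alpha>] by (simp add: log_weight_eq_ln[OF that] powr_def exp_minus inverse_eq_divide)
  moreover have "fourier_coeff f \<alpha> = 0" if "\<alpha> \<notin> nonneg_exponents" for \<alpha>
  proof (rule LIMSEQ_unique[OF coeff_lim])
    show "(\<lambda>n. fourier_coeff (F n) \<alpha>) \<longlonglongrightarrow> 0"
      using that by (simp add: F_def fourier_coeff_dirichlet_lift small_exponents_def)
  qed
  ultimately have "is_lift p (dirichlet_shift \<epsilon> (bohr_transform T)) f"
    using Lp_le_imp_Lp_space[OF fL]
    by (simp add: is_lift_def hardy_torus_def dirichlet_shift_def bohr_transform_prime_pow)
  then show ?thesis using fL by blast
qed

section \<open>From Dirichlet series to operators\<close>

definition pairing_operator :: "ennreal \<Rightarrow> ((nat \<Rightarrow> complex) \<Rightarrow> 'x::complex_banach) \<Rightarrow> ((nat \<Rightarrow> complex) \<Rightarrow> complex) \<Rightarrow> 'x"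
  where "pairing_operator q f h =
    (if h \<in> elements (torus_lattice q) then strong_integral haar (\<lambda>\<omega>. h \<omega> *\<^sub>C f \<omega>) else 0)"

lemma norm_pairing_operator_le:
  assumes p: "1 \<le> p" "1 / p + 1 / p' = 1" and f: "Lp_le p f C" and h: "h \<in> elements (torus_lattice p')"
  shows "norm (pairing_operator p' f h) \<le> C * lattice_norm (torus_lattice p') h"
proof -
  have "ennreal (norm (pairing_operator p' f h)) \<le> (\<integral>\<^sup>+\<omega>. ennreal (norm (h \<omega> *\<^sub>C f \<omega>)) \<partial>haar)"
    using norm_strong_integral_le[OF strongly_integrable_pairing[OF p h f]] h by (simp add: pairing_operator_def)
  also have "\<dots> \<le> ennreal (lattice_norm (torus_lattice p') h * C)"
    using lattice_pairing[OF p h f] by (simp add: norm_scaleC)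
  finally show ?thesis
    using lattice_norm_nonneg[OF h] Lp_le_nonneg[OF f] by (simp add: mult.commute)
qed

lemma pairing_operator_bounded:
  assumes p: "1 \<le> p" "1 / p + 1 / p' = 1" and f: "Lp_le p f C"
  shows "pairing_operator p' f \<in> bounded_operators (torus_lattice p')"
proof -
  note p' = conjugate_exponent_ge_1[OF p]
  note int = strongly_integrable_pairing[OF p _ f]
  have "pairing_operator p' f (\<lambda>x. g x + h x) = pairing_operator p' f g + pairing_operator p' f h"
    if "g \<in> elements (torus_lattice p')" "h \<in> elements (torus_lattice p')" for g h
    using strong_integral_add[OF int[OF that(1)] int[OF that(2)]] torus_lattice_add[OF p' that] that
    by (simp add: pairing_operator_def scaleC_add_left)
  moreover have "pairing_operator p' f (\<lambda>x. c * h x) = c *\<^sub>C pairing_operator p' f h"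
    if "h \<in> elements (torus_lattice p')" for c h
    using strong_integral_scaleC[OF int[OF that], of c] torus_lattice_cmult[OF p' that, of c] that
    by (simp add: pairing_operator_def scaleC_scaleC)
  ultimately show ?thesis
    using norm_pairing_operator_le[OF p f]
    unfolding bounded_operators_def by (auto simp: pairing_operator_def[of p' f] intro!: exI[of _ C])
qed

lemma positives_subset_elements: "h \<in> positives (torus_lattice q) \<Longrightarrow> h \<in> elements (torus_lattice q)"
  by (cases "q = \<infinity>") (auto simp: torus_lattice_infinity torus_lattice_finite)

lemma AE_positives: "h \<in> positives (torus_lattice q) \<Longrightarrow> AE \<omega> in haar. h \<omega> \<in> \<real>\<^sub>\<ge>\<^sub>0"
  by (cases "q = \<infinity>") (auto simp: torus_lattice_infinity torus_lattice_finite space_haar intro!: AE_I2)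

lemma bdd_above_dual_ball_sums:
  assumes F: "\<And>i. i < (n::nat) \<Longrightarrow> F i \<in> elements (torus_lattice q)"
  shows "bdd_above ((\<lambda>\<xi>. \<Sum>i<n. cmod (\<xi> (F i))) ` dual_ball (torus_lattice q))"
  by (rule bdd_aboveI2[of _ _ "\<Sum>i<n. lattice_norm (torus_lattice q) (F i)"])
    (use F in \<open>auto simp: dual_ball_def intro!: sum_mono\<close>)

lemma dual_ball_sup_nonneg:
  assumes F: "\<And>i. i < (n::nat) \<Longrightarrow> F i \<in> elements (torus_lattice q)"
  shows "0 \<le> (SUP \<xi>\<in>dual_ball (torus_lattice q). \<Sum>i<n. cmod (\<xi> (F i)))"
  using cSUP_upper[OF zero_in_dual_ball bdd_above_dual_ball_sums[OF F]] by simp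

text \<open>Integration against \<open>\<parallel>f\<parallel> / C\<close> is a functional in the dual ball, and \<open>C\<close> times its value at a positive \<open>h\<close>
  bounds the norm of \<open>\<integral> h f\<close>. The same functional serves all the functions of a finite family.\<close>

lemma pairing_operator_cas_bound:
  fixes f :: "(nat \<Rightarrow> complex) \<Rightarrow> 'x::complex_banach"
  assumes p: "1 \<le> p" "1 / p + 1 / p' = 1" and f: "Lp_le p f C" and C: "0 < C"
  shows "cas_bound (torus_lattice p') (pairing_operator p' f) C"
  unfolding cas_bound_def
proof (intro allI impI)
  fix n :: nat and F assume F: "\<forall>i<n. F i \<in> positives (torus_lattice p')"
  then have Fe: "\<And>i. i < n \<Longrightarrow> F i \<in> elements (torus_lattice p')"
    using positives_subset_elements by blast
  define \<phi> where "\<phi> \<omega> = complex_of_real (norm (f \<omega>) / C)" for \<omega>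
  define \<xi> where "\<xi> = pairing_operator p' \<phi>"
  note [measurable] = strongly_measurable_norm[OF Lp_le_measurable[OF f]]
  have "Lp_le p (\<lambda>\<omega>. complex_of_real (norm (f \<omega>))) C"
    using f by (simp add: Lp_le_def strongly_measurable_iff_borel_measurable)
  from Lp_le_scaleC[OF p(1) this, of "complex_of_real (1 / C)"]
  have \<phi>: "Lp_le p \<phi> 1"
    using C by (simp add: \<phi>_def[abs_def] scaleC_complex_def norm_divide)
  have \<xi>: "\<xi> \<in> dual_ball (torus_lattice p')"
    using pairing_operator_bounded[OF p \<phi>] norm_pairing_operator_le[OF p \<phi>] by (simp add: dual_ball_def \<xi>_def)
  have "norm (pairing_operator p' f h) \<le> C * cmod (\<xi> h)" if h: "h \<in> positives (torus_lattice p')" for h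
  proof -
    have he: "h \<in> elements (torus_lattice p')" by (rule positives_subset_elements[OF h])
    note [measurable] = torus_lattice_measurable(1)[OF he]
    have \<phi>m[measurable]: "\<phi> \<in> borel_measurable haar" unfolding \<phi>_def by measurable
    have fin: "(\<integral>\<^sup>+\<omega>. ennreal (cmod (h \<omega> * \<phi> \<omega>)) \<partial>haar) < \<infinity>"
      using le_less_trans[OF lattice_pairing[OF p he \<phi>] ennreal_less_top] by (simp add: norm_mult)
    then have int: "integrable haar (\<lambda>\<omega>. h \<omega> * \<phi> \<omega>)"
      by (intro integrableI_bounded) measurable
    have "has_strong_integral haar (\<lambda>\<omega>. h \<omega> * \<phi> \<omega>) (\<integral>\<omega>. h \<omega> * \<phi> \<omega> \<partial>haar)"
      using has_strong_integral_bochner_linear[OF bounded_linear_ident has_bochner_integral_integrable[OF int]] .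
    then have "\<xi> h = (\<integral>\<omega>. h \<omega> * \<phi> \<omega> \<partial>haar)"
      using he by (simp add: \<xi>_def pairing_operator_def scaleC_complex_def strong_integral_eq)
    also have "\<dots> = (\<integral>\<omega>. complex_of_real (cmod (h \<omega> * \<phi> \<omega>)) \<partial>haar)"
    proof (rule integral_cong_AE)
      show "AE \<omega> in haar. h \<omega> * \<phi> \<omega> = complex_of_real (cmod (h \<omega> * \<phi> \<omega>))"
        using AE_positives[OF h]
      proof eventually_elim
        case (elim \<omega>)
        then obtain r where "h \<omega> = complex_of_real r" "0 \<le> r" by (elim nonneg_Reals_cases) auto
        then show ?case using C by (simp add: \<phi>_def norm_mult norm_divide)
      qed
    qed measurable
    also have "\<dots> = complex_of_real (\<integral>\<omega>. cmod (h \<omega> * \<phi> \<omega>) \<partial>haar)" by (rule integral_complex_of_real)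
    finally have "cmod (\<xi> h) = (\<integral>\<omega>. cmod (h \<omega> * \<phi> \<omega>) \<partial>haar)"
      by (simp add: Bochner_Integration.integral_nonneg)
    then have eq: "(\<integral>\<^sup>+\<omega>. ennreal (cmod (h \<omega> * \<phi> \<omega>)) \<partial>haar) = ennreal (cmod (\<xi> h))"
      using nn_integral_eq_integral[OF integrable_norm[OF int]] by simp
    have "ennreal (norm (pairing_operator p' f h)) \<le> (\<integral>\<^sup>+\<omega>. ennreal (norm (h \<omega> *\<^sub>C f \<omega>)) \<partial>haar)"
      using norm_strong_integral_le[OF strongly_integrable_pairing[OF p he f]] he by (simp add: pairing_operator_def)
    also have "\<dots> = (\<integral>\<^sup>+\<omega>. ennreal C * ennreal (cmod (h \<omega> * \<phi> \<omega>)) \<partial>haar)"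
      using C by (intro nn_integral_cong)
        (simp add: norm_scaleC \<phi>_def norm_mult norm_divide flip: ennreal_mult)
    also have "\<dots> = ennreal C * ennreal (cmod (\<xi> h))"
      unfolding eq[symmetric] by (rule nn_integral_cmult) measurable
    finally show ?thesis using C by (simp flip: ennreal_mult)
  qed
  then have "(\<Sum>i<n. norm (pairing_operator p' f (F i))) \<le> (\<Sum>i<n. C * cmod (\<xi> (F i)))"
    using F by (intro sum_mono) simp
  also have "\<dots> = C * (\<Sum>i<n. cmod (\<xi> (F i)))" by (simp add: sum_distrib_left)
  also have "\<dots> \<le> C * (SUP \<xi>\<in>dual_ball (torus_lattice p'). \<Sum>i<n. cmod (\<xi> (F i)))"
    using C by (intro mult_left_mono cSUP_upper[OF \<xi> bdd_above_dual_ball_sums[OF Fe]]) auto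
  finally show "(\<Sum>i<n. norm (pairing_operator p' f (F i)))
    \<le> C * (SUP \<xi>\<in>dual_ball (torus_lattice p'). \<Sum>i<n. cmod (\<xi> (F i)))" .
qed

lemma bounded_operator_diff:
  assumes q: "1 \<le> q" and T: "T \<in> bounded_operators (torus_lattice q)"
    and f: "f \<in> elements (torus_lattice q)" and g: "g \<in> elements (torus_lattice q)"
  shows "T (\<lambda>\<omega>. f \<omega> - g \<omega>) = T f - T g"
proof -
  have add: "\<And>f g. f \<in> elements (torus_lattice q) \<Longrightarrow> g \<in> elements (torus_lattice q) \<Longrightarrow> T (\<lambda>x. f x + g x) = T f + T g"
    and scale: "\<And>c f. f \<in> elements (torus_lattice q) \<Longrightarrow> T (\<lambda>x. c * f x) = c *\<^sub>C T f"
    using T by (auto simp: bounded_operators_def)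
  have "T (\<lambda>\<omega>. f \<omega> + - 1 * g \<omega>) = T f + T (\<lambda>\<omega>. - 1 * g \<omega>)"
    by (rule add[OF f torus_lattice_cmult[OF q g]])
  moreover have "T (\<lambda>\<omega>. - 1 * g \<omega>) = (- 1) *\<^sub>C T g"
    by (rule scale[OF g])
  ultimately show ?thesis by (simp add: scaleC_minus_one)
qed

lemma bounded_operator_trig_polynomial:
  assumes q: "1 \<le> q" and T: "T \<in> bounded_operators (torus_lattice q)"
    and P: "\<And>\<omega>. \<omega> \<in> torus \<Longrightarrow> P \<omega> = (\<Sum>\<alpha>\<in>A. c \<alpha> * monomial \<alpha> \<omega>)"
  shows "T P = (\<Sum>\<alpha>\<in>A. c \<alpha> *\<^sub>C T (monomial \<alpha>))"
proof -
  let ?Q = "\<lambda>\<omega>. \<Sum>\<alpha>\<in>A. c \<alpha> * monomial \<alpha> \<omega>"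
  have contQ: "continuous_on torus ?Q"
    by (intro continuous_on_sum continuous_on_mult continuous_on_const continuous_on_monomial)
  then have contP: "continuous_on torus P"
    by (rule continuous_on_eq) (simp add: P)
  note el = continuous_in_lattice[OF q contP] continuous_in_lattice[OF q contQ]
  have d: "lattice_norm (torus_lattice q) (\<lambda>\<omega>. P \<omega> - ?Q \<omega>) \<le> 0"
    by (rule continuous_bounded_lattice(2)[OF q continuous_on_diff[OF contP contQ]]) (simp add: P)
  have de: "(\<lambda>\<omega>. P \<omega> - ?Q \<omega>) \<in> elements (torus_lattice q)"
    by (rule torus_lattice_diff[OF q el])
  obtain K where "\<forall>f\<in>elements (torus_lattice q). norm (T f) \<le> K * lattice_norm (torus_lattice q) f"
    using T by (auto simp: bounded_operators_def)
  then have "norm (T (\<lambda>\<omega>. P \<omega> - ?Q \<omega>)) \<le> K * lattice_norm (torus_lattice q) (\<lambda>\<omega>. P \<omega> - ?Q \<omega>)"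
    using de by (rule bspec)
  moreover have "lattice_norm (torus_lattice q) (\<lambda>\<omega>. P \<omega> - ?Q \<omega>) = 0"
    by (rule antisym[OF d lattice_norm_nonneg[OF de]])
  ultimately have "T P = T ?Q"
    by (simp add: bounded_operator_diff[OF q T el])
  also have "\<dots> = (\<Sum>\<alpha>\<in>A. c \<alpha> *\<^sub>C T (monomial \<alpha>))"
    by (rule bounded_operator_sum[OF q T, THEN conjunct2]) (rule monomial_in_lattice[OF q])
  finally show ?thesis .
qed

lemma bounded_operator_eqI:
  fixes T T' :: "((nat \<Rightarrow> complex) \<Rightarrow> complex) \<Rightarrow> 'x::complex_banach"
  assumes q: "1 \<le> q" and T: "T \<in> bounded_operators (torus_lattice q)" "T' \<in> bounded_operators (torus_lattice q)"
    and eq: "\<And>\<alpha>. T (monomial \<alpha>) = T' (monomial \<alpha>)"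
  shows "T = T'"
proof (rule ext)
  fix h
  show "T h = T' h"
  proof (cases "h \<in> elements (torus_lattice q)")
    case False
    then show ?thesis using T by (simp add: bounded_operators_def)
  next
    case True
    obtain K where K: "\<forall>f\<in>elements (torus_lattice q). norm (T f) \<le> K * lattice_norm (torus_lattice q) f"
      using T(1) by (auto simp: bounded_operators_def)
    obtain K' where K': "\<forall>f\<in>elements (torus_lattice q). norm (T' f) \<le> K' * lattice_norm (torus_lattice q) f"
      using T(2) by (auto simp: bounded_operators_def)
    have "norm (T h - T' h) \<le> 0 + e" if e: "0 < e" for e
    proof -
      define L where "L = \<bar>K\<bar> + \<bar>K'\<bar> + 1"
      have L: "0 < L" by (simp add: L_def)
      obtain P where P: "trig_polynomial P" "lattice_norm (torus_lattice q) (\<lambda>\<omega>. h \<omega> - P \<omega>) \<le> e / L"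
        using trig_polynomial_dense_lattice[OF q True, of "e / L"] e L by auto
      have Pe: "P \<in> elements (torus_lattice q)" by (rule trig_polynomial_in_lattice[OF q P(1)])
      have de: "(\<lambda>\<omega>. h \<omega> - P \<omega>) \<in> elements (torus_lattice q)" by (rule torus_lattice_diff[OF q True Pe])
      let ?N = "lattice_norm (torus_lattice q) (\<lambda>\<omega>. h \<omega> - P \<omega>)"
      obtain A c where A: "\<And>\<omega>. \<omega> \<in> torus \<Longrightarrow> P \<omega> = (\<Sum>\<alpha>\<in>A. c \<alpha> * monomial \<alpha> \<omega>)"
        using P(1) by (auto simp: trig_polynomial_def)
      have "T P = T' P"
        by (simp only: bounded_operator_trig_polynomial[OF q T(1) A] bounded_operator_trig_polynomial[OF q T(2) A] eq)
      then have "T h - T' h = T (\<lambda>\<omega>. h \<omega> - P \<omega>) - T' (\<lambda>\<omega>. h \<omega> - P \<omega>)"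
        by (simp add: bounded_operator_diff[OF q T(1) True Pe] bounded_operator_diff[OF q T(2) True Pe])
      then have "norm (T h - T' h) \<le> norm (T (\<lambda>\<omega>. h \<omega> - P \<omega>)) + norm (T' (\<lambda>\<omega>. h \<omega> - P \<omega>))"
        by (simp add: norm_triangle_ineq4)
      also have "\<dots> \<le> K * ?N + K' * ?N" using K K' de by (intro add_mono) auto
      also have "\<dots> \<le> L * ?N"
        unfolding distrib_right[symmetric] by (rule mult_right_mono) (auto simp: L_def lattice_norm_nonneg[OF de])
      also have "\<dots> \<le> L * (e / L)" using P(2) L by (intro mult_left_mono) auto
      finally show ?thesis using L by simp
    qed
    then have "norm (T h - T' h) \<le> 0" by (rule field_le_epsilon)
    then show ?thesis by simp
  qed
qed

text \<open>The operators given by the lifts of \<open>D\<^sub>\<epsilon>\<close> are uniformly bounded and converge on trigonometric polynomials as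
  \<open>\<epsilon>\<close> tends to \<open>0\<close>, hence everywhere; the summing bound passes to the limit.\<close>

lemma hardy_dirichlet_plus_operator:
  fixes a :: "nat \<Rightarrow> 'x::complex_banach"
  assumes p: "1 \<le> p" "1 / p + 1 / p' = 1" and a: "a \<in> hardy_dirichlet_plus p"
    and C: "0 < C" "hardy_dirichlet_plus_norm p a \<le> C"
  shows "\<exists>T\<in>cas_plus p'. bohr_transform T = a \<and> cas_bound (torus_lattice p') T C"
proof -
  note p' = conjugate_exponent_ge_1[OF p]
  let ?E = "torus_lattice p'"
  have a0: "a 0 = 0" and lift: "\<And>\<epsilon>. 0 < \<epsilon> \<Longrightarrow> dirichlet_shift \<epsilon> a \<in> hardy_dirichlet p"
    and bdd: "bdd_above ((\<lambda>\<epsilon>. hardy_dirichlet_norm p (dirichlet_shift \<epsilon> a)) ` {0<..})"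
    using a by (auto simp: hardy_dirichlet_plus_def)
  define \<epsilon> where "\<epsilon> n = 1 / real (Suc n)" for n
  have \<epsilon>: "0 < \<epsilon> n" for n by (simp add: \<epsilon>_def)
  have "\<exists>f. is_lift p (dirichlet_shift (\<epsilon> n) a) f" for n
    using lift[OF \<epsilon>] by (auto simp: hardy_dirichlet_def)
  then obtain f where f: "\<And>n. is_lift p (dirichlet_shift (\<epsilon> n) a) (f n)" by metis
  have fL: "Lp_le p (f n) C" for n
  proof -
    have "Lp_norm haar p (f n) = hardy_dirichlet_norm p (dirichlet_shift (\<epsilon> n) a)"
      by (rule hardy_dirichlet_norm_eq[OF p f, symmetric])
    also have "\<dots> \<le> hardy_dirichlet_plus_norm p a"
      unfolding hardy_dirichlet_plus_norm_def by (rule cSUP_upper[OF _ bdd]) (simp add: \<epsilon>)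
    finally have "Lp_norm haar p (f n) \<le> C" using C(2) by simp
    moreover have "Lp_le p (f n) (Lp_norm haar p (f n))"
      using f by (intro Lp_le_Lp_norm p) (simp add: is_lift_def hardy_torus_def)
    ultimately show ?thesis by (rule Lp_le_mono[rotated])
  qed
  define S where "S n = pairing_operator p' (f n)" for n
  have Sb: "S n \<in> bounded_operators ?E" for n
    unfolding S_def by (rule pairing_operator_bounded[OF p fL])
  have S_le: "norm (S n h) \<le> C * lattice_norm ?E h" if "h \<in> elements ?E" for n h
    unfolding S_def by (rule norm_pairing_operator_le[OF p fL that])
  define L where "L \<alpha> = (if \<alpha> \<in> nonneg_exponents then a (prime_pow \<alpha>) else 0)" for \<alpha>
  have S_mono: "(\<lambda>n. S n (monomial (- \<alpha>))) \<longlonglongrightarrow> L \<alpha>" for \<alpha>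
  proof -
    have eq: "S n (monomial (- \<alpha>)) = fourier_coeff (f n) \<alpha>" for n
      by (simp add: S_def pairing_operator_def monomial_in_lattice[OF p'] fourier_coeff_def)
    show ?thesis
    proof (cases "\<alpha> \<in> nonneg_exponents")
      case True
      have "(\<lambda>n. \<epsilon> n) \<longlonglongrightarrow> 0" unfolding \<epsilon>_def by (rule LIMSEQ_Suc[OF lim_const_over_n])
      then have "(\<lambda>n. (1 / real (prime_pow \<alpha>) powr \<epsilon> n) *\<^sub>R a (prime_pow \<alpha>))
        \<longlonglongrightarrow> (1 / real (prime_pow \<alpha>) powr 0) *\<^sub>R a (prime_pow \<alpha>)"
        using prime_pow_pos[of \<alpha>] by (intro tendsto_intros) auto
      moreover have "fourier_coeff (f n) \<alpha> = (1 / real (prime_pow \<alpha>) powr \<epsilon> n) *\<^sub>R a (prime_pow \<alpha>)" for n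
        using f[of n] True by (simp add: is_lift_def dirichlet_shift_def)
      ultimately show ?thesis using True prime_pow_pos[of \<alpha>] by (simp add: eq L_def)
    next
      case False
      then have "fourier_coeff (f n) \<alpha> = 0" for n
        using f[of n] by (simp add: is_lift_def hardy_torus_def)
      then show ?thesis using False by (simp add: eq L_def)
    qed
  qed
  have conv: "convergent (\<lambda>n. S n h)" if h: "h \<in> elements ?E" for h
  proof (rule Cauchy_convergent, rule metric_CauchyI)
    fix e :: real assume e: "0 < e"
    have e': "0 < e / (4 * C)" using e C by simp
    obtain P where P: "trig_polynomial P" "lattice_norm ?E (\<lambda>\<omega>. h \<omega> - P \<omega>) \<le> e / (4 * C)"
      using trig_polynomial_dense_lattice[OF p' h e'] by blast
    have Pe: "P \<in> elements ?E" by (rule trig_polynomial_in_lattice[OF p' P(1)])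
    have de: "(\<lambda>\<omega>. h \<omega> - P \<omega>) \<in> elements ?E" by (rule torus_lattice_diff[OF p' h Pe])
    obtain A c where A: "\<And>\<omega>. \<omega> \<in> torus \<Longrightarrow> P \<omega> = (\<Sum>\<alpha>\<in>A. c \<alpha> * monomial \<alpha> \<omega>)"
      using P(1) by (auto simp: trig_polynomial_def)
    have "(\<lambda>n. \<Sum>\<alpha>\<in>A. c \<alpha> *\<^sub>C S n (monomial (- (- \<alpha>)))) \<longlonglongrightarrow> (\<Sum>\<alpha>\<in>A. c \<alpha> *\<^sub>C L (- \<alpha>))"
      by (intro tendsto_sum tendsto_scaleC tendsto_const S_mono)
    then have "(\<lambda>n. S n P) \<longlonglongrightarrow> (\<Sum>\<alpha>\<in>A. c \<alpha> *\<^sub>C L (- \<alpha>))"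
      by (simp add: bounded_operator_trig_polynomial[OF p' Sb A])
    then have "Cauchy (\<lambda>n. S n P)" by (rule LIMSEQ_imp_Cauchy)
    then obtain n0 where n0: "\<And>m n. m \<ge> n0 \<Longrightarrow> n \<ge> n0 \<Longrightarrow> dist (S m P) (S n P) < e / 2"
      using metric_CauchyD[of "\<lambda>n. S n P" "e / 2"] e by (metis half_gt_zero)
    have near: "dist (S n h) (S n P) \<le> e / 4" for n
    proof -
      have "dist (S n h) (S n P) = norm (S n (\<lambda>\<omega>. h \<omega> - P \<omega>))"
        by (simp add: dist_norm bounded_operator_diff[OF p' Sb h Pe])
      also have "\<dots> \<le> C * (e / (4 * C))"
        using S_le[OF de, of n] P(2) C(1) by (meson mult_left_mono less_imp_le order_trans)
      finally show ?thesis using C(1) by simp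
    qed
    show "\<exists>n0. \<forall>m\<ge>n0. \<forall>n\<ge>n0. dist (S m h) (S n h) < e"
    proof (intro exI allI impI)
      fix m n assume "n0 \<le> m" "n0 \<le> n"
      then have "dist (S m P) (S n P) < e / 2" by (rule n0)
      moreover have "dist (S m h) (S n h) \<le> dist (S m h) (S m P) + (dist (S m P) (S n P) + dist (S n P) (S n h))"
        by (intro order_trans[OF dist_triangle[of _ _ "S m P"]] add_left_mono dist_triangle)
      ultimately show "dist (S m h) (S n h) < e"
        using near[of m] near[of n] by (simp add: dist_commute)
    qed
  qed
  define T where "T h = (if h \<in> elements ?E then lim (\<lambda>n. S n h) else 0)" for h
  have T: "(\<lambda>n. S n h) \<longlonglongrightarrow> T h" if "h \<in> elements ?E" for h
    using conv[OF that] that by (simp add: T_def convergent_LIMSEQ_iff)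
  have "T (\<lambda>x. g x + h x) = T g + T h" if g: "g \<in> elements ?E" and h: "h \<in> elements ?E" for g h
  proof (rule LIMSEQ_unique[OF T[OF torus_lattice_add[OF p' g h]]])
    have "S n (\<lambda>x. g x + h x) = S n g + S n h" for n
      using Sb[of n] g h by (simp add: bounded_operators_def)
    then show "(\<lambda>n. S n (\<lambda>x. g x + h x)) \<longlonglongrightarrow> T g + T h"
      using tendsto_add[OF T[OF g] T[OF h]] by simp
  qed
  moreover have "T (\<lambda>x. c * h x) = c *\<^sub>C T h" if h: "h \<in> elements ?E" for c h
  proof (rule LIMSEQ_unique[OF T[OF torus_lattice_cmult[OF p' h]]])
    have "S n (\<lambda>x. c * h x) = c *\<^sub>C S n h" for n
      using Sb[of n] h by (simp add: bounded_operators_def)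
    then show "(\<lambda>n. S n (\<lambda>x. c * h x)) \<longlonglongrightarrow> c *\<^sub>C T h"
      using tendsto_scaleC[OF tendsto_const[of c] T[OF h]] by simp
  qed
  moreover have "norm (T h) \<le> C * lattice_norm ?E h" if h: "h \<in> elements ?E" for h
    by (rule LIMSEQ_le_const2[OF tendsto_norm[OF T[OF h]]]) (use S_le[OF h] in blast)
  ultimately have Tb: "T \<in> bounded_operators ?E"
    unfolding bounded_operators_def by (auto simp: T_def[of _] intro!: exI[of _ C])
  have cas: "cas_bound ?E T C"
    unfolding cas_bound_def
  proof (intro allI impI)
    fix n :: nat and F assume F: "\<forall>i<n. F i \<in> positives ?E"
    have "(\<lambda>m. \<Sum>i<n. norm (S m (F i))) \<longlonglongrightarrow> (\<Sum>i<n. norm (T (F i)))"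
      by (intro tendsto_sum tendsto_norm T positives_subset_elements) (use F in simp)
    then show "(\<Sum>i<n. norm (T (F i))) \<le> C * (SUP \<xi>\<in>dual_ball ?E. \<Sum>i<n. cmod (\<xi> (F i)))"
    proof (rule LIMSEQ_le_const2, intro exI allI impI)
      fix m
      show "(\<Sum>i<n. norm (S m (F i))) \<le> C * (SUP \<xi>\<in>dual_ball ?E. \<Sum>i<n. cmod (\<xi> (F i)))"
        using pairing_operator_cas_bound[OF p fL C(1), of m, unfolded cas_bound_def, rule_format, of n F] F
        by (simp add: S_def)
    qed
  qed
  have TL: "T (monomial (- \<alpha>)) = L \<alpha>" for \<alpha>
    by (rule LIMSEQ_unique[OF T[OF monomial_in_lattice[OF p']] S_mono])
  have "T \<in> cas_plus p'"
    using Tb cas C(1) by (auto simp: cas_plus_def cas_operators_def TL L_def)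
  moreover have "bohr_transform T = a"
  proof (rule ext)
    fix n
    show "bohr_transform T n = a n"
      by (cases "n = 0") (simp_all add: a0 bohr_transform_def TL L_def exponents_nonneg prime_pow_exponents)
  qed
  ultimately show ?thesis using cas by blast
qed

section \<open>The Bohr transform\<close>

lemma bohr_transform_inj:
  fixes T T' :: "((nat \<Rightarrow> complex) \<Rightarrow> complex) \<Rightarrow> 'x::complex_banach"
  assumes q: "1 \<le> q" and T: "T \<in> cas_plus q" "T' \<in> cas_plus q" and eq: "bohr_transform T = bohr_transform T'"
  shows "T = T'"
proof (rule bounded_operator_eqI[OF q])
  show "T \<in> bounded_operators (torus_lattice q)" "T' \<in> bounded_operators (torus_lattice q)"
    using T by (auto simp: cas_plus_def cas_operators_def)
  fix \<alpha>
  have "T (monomial (- (- \<alpha>))) = T' (monomial (- (- \<alpha>)))"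
  proof (cases "- \<alpha> \<in> nonneg_exponents")
    case True
    then show ?thesis using fun_cong[OF eq, of "prime_pow (- \<alpha>)"] by (simp only: bohr_transform_prime_pow)
  next
    case False
    then show ?thesis using T unfolding cas_plus_def by (metis (mono_tags, lifting) mem_Collect_eq)
  qed
  then show "T (monomial \<alpha>) = T' (monomial \<alpha>)" by simp
qed

lemma cas_bound_add:
  assumes T: "cas_bound E T C" and T': "cas_bound E T' C'"
  shows "cas_bound E (\<lambda>f. T f + T' f) (C + C')"
  unfolding cas_bound_def
proof (intro allI impI)
  fix n :: nat and f :: "nat \<Rightarrow> 'a \<Rightarrow> complex"
  let ?s = "SUP \<xi>\<in>dual_ball E. \<Sum>i<n. cmod (\<xi> (f i))"
  assume f: "\<forall>i<n. f i \<in> positives E"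
  have "(\<Sum>i<n. norm (T (f i) + T' (f i))) \<le> (\<Sum>i<n. norm (T (f i))) + (\<Sum>i<n. norm (T' (f i)))"
    by (simp add: sum.distrib[symmetric] sum_mono norm_triangle_ineq)
  also have "\<dots> \<le> C * ?s + C' * ?s"
    using T[unfolded cas_bound_def, rule_format, of n f] T'[unfolded cas_bound_def, rule_format, of n f] f
    by (intro add_mono) auto
  finally show "(\<Sum>i<n. norm (T (f i) + T' (f i))) \<le> (C + C') * ?s" by (simp add: distrib_right)
qed

text \<open>The summand \<open>1\<close> keeps the constant positive when \<open>c = 0\<close>.\<close>

lemma cas_bound_scaleC:
  assumes "cas_bound (torus_lattice q) T C"
  shows "cas_bound (torus_lattice q) (\<lambda>f. c *\<^sub>C T f) (cmod c * C + 1)"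
  unfolding cas_bound_def
proof (intro allI impI)
  fix n :: nat and f :: "nat \<Rightarrow> (nat \<Rightarrow> complex) \<Rightarrow> complex"
  let ?s = "SUP \<xi>\<in>dual_ball (torus_lattice q). \<Sum>i<n. cmod (\<xi> (f i))"
  assume f: "\<forall>i<n. f i \<in> positives (torus_lattice q)"
  have "0 \<le> ?s" by (rule dual_ball_sup_nonneg) (use f positives_subset_elements in blast)
  have "(\<Sum>i<n. norm (c *\<^sub>C T (f i))) = cmod c * (\<Sum>i<n. norm (T (f i)))"
    by (simp add: norm_scaleC sum_distrib_left)
  also have "\<dots> \<le> cmod c * (C * ?s)"
    using assms[unfolded cas_bound_def, rule_format, of n f] f by (intro mult_left_mono) auto
  also have "\<dots> \<le> (cmod c * C + 1) * ?s" using \<open>0 \<le> ?s\<close> by (simp add: algebra_simps)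
  finally show "(\<Sum>i<n. norm (c *\<^sub>C T (f i))) \<le> (cmod c * C + 1) * ?s" .
qed

lemma bounded_operators_subspace: "complex_subspace (bounded_operators E)"
  unfolding complex_subspace_def
proof (intro conjI ballI allI)
  show "(\<lambda>f. 0) \<in> bounded_operators E"
    by (auto simp: bounded_operators_def intro!: exI[of _ 0])
next
  fix u v :: "('a \<Rightarrow> complex) \<Rightarrow> 'b"
  assume u: "u \<in> bounded_operators E" and v: "v \<in> bounded_operators E"
  obtain K where K: "\<forall>f\<in>elements E. norm (u f) \<le> K * lattice_norm E f"
    using u by (auto simp: bounded_operators_def)
  obtain K' where K': "\<forall>f\<in>elements E. norm (v f) \<le> K' * lattice_norm E f"
    using v by (auto simp: bounded_operators_def)
  have le: "norm (u f + v f) \<le> (K + K') * lattice_norm E f" if "f \<in> elements E" for f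
    using norm_triangle_ineq[of "u f" "v f"] K[rule_format, OF that] K'[rule_format, OF that] by (simp add: distrib_right)
  then show "(\<lambda>f. u f + v f) \<in> bounded_operators E"
    using u v unfolding bounded_operators_def by (auto simp: scaleC_add_right)
next
  fix c and u :: "('a \<Rightarrow> complex) \<Rightarrow> 'b" assume u: "u \<in> bounded_operators E"
  obtain K where K: "\<forall>f\<in>elements E. norm (u f) \<le> K * lattice_norm E f"
    using u by (auto simp: bounded_operators_def)
  have "norm (c *\<^sub>C u f) \<le> (cmod c * K) * lattice_norm E f" if "f \<in> elements E" for f
    using mult_left_mono[OF K[rule_format, OF that], of "cmod c"] by (simp add: norm_scaleC mult.assoc)
  then show "(\<lambda>f. c *\<^sub>C u f) \<in> bounded_operators E"
    using u unfolding bounded_operators_def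
    by (auto simp: scaleC_add_right scaleC_scaleC mult.commute[of c] intro!: exI[of _ "cmod c * K"])
qed

lemma cas_plus_subspace:
  "complex_subspace (cas_plus q :: (((nat \<Rightarrow> complex) \<Rightarrow> complex) \<Rightarrow> 'x::complex_banach) set)"
proof -
  note B = bounded_operators_subspace[of "torus_lattice q", where 'b = 'x, unfolded complex_subspace_def]
  show ?thesis
    unfolding complex_subspace_def
  proof (intro conjI ballI allI)
    have "cas_bound (torus_lattice q) (\<lambda>f. 0 :: 'x) 1"
      unfolding cas_bound_def
    proof (intro allI impI)
      fix n :: nat and f :: "nat \<Rightarrow> (nat \<Rightarrow> complex) \<Rightarrow> complex"
      assume f: "\<forall>i<n. f i \<in> positives (torus_lattice q)"
      have "0 \<le> (SUP \<xi>\<in>dual_ball (torus_lattice q). \<Sum>i<n. cmod (\<xi> (f i)))"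
        by (rule dual_ball_sup_nonneg) (use f positives_subset_elements in blast)
      then show "(\<Sum>i<n. norm (0::'x)) \<le> 1 * (SUP \<xi>\<in>dual_ball (torus_lattice q). \<Sum>i<n. cmod (\<xi> (f i)))" by simp
    qed
    then show "(\<lambda>f. 0 :: 'x) \<in> cas_plus q"
      using B by (auto simp: cas_plus_def cas_operators_def intro!: exI[of _ 1])
  next
    fix u v :: "((nat \<Rightarrow> complex) \<Rightarrow> complex) \<Rightarrow> 'x" assume u: "u \<in> cas_plus q" and v: "v \<in> cas_plus q"
    obtain C C' where "0 < C" "cas_bound (torus_lattice q) u C" "0 < C'" "cas_bound (torus_lattice q) v C'"
      using u v by (auto simp: cas_plus_def cas_operators_def)
    then have "0 < C + C'" "cas_bound (torus_lattice q) (\<lambda>f. u f + v f) (C + C')"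
      by (simp_all add: cas_bound_add)
    then show "(\<lambda>f. u f + v f) \<in> cas_plus q"
      using B u v by (auto simp: cas_plus_def cas_operators_def)
  next
    fix c and u :: "((nat \<Rightarrow> complex) \<Rightarrow> complex) \<Rightarrow> 'x" assume u: "u \<in> cas_plus q"
    obtain C where "0 < C" "cas_bound (torus_lattice q) u C"
      using u by (auto simp: cas_plus_def cas_operators_def)
    then have "0 < cmod c * C + 1" "cas_bound (torus_lattice q) (\<lambda>f. c *\<^sub>C u f) (cmod c * C + 1)"
      by (simp_all add: cas_bound_scaleC add_nonneg_pos)
    then show "(\<lambda>f. c *\<^sub>C u f) \<in> cas_plus q"
      using B u by (auto simp: cas_plus_def cas_operators_def)
  qed
qed

lemma hardy_dirichlet_norm_bohr_transform_le:
  fixes T :: "((nat \<Rightarrow> complex) \<Rightarrow> complex) \<Rightarrow> 'x::complex_banach"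
  assumes p: "1 \<le> p" "1 / p + 1 / p' = 1"
    and T: "T \<in> cas_plus p'" "cas_bound (torus_lattice p') T C" "0 \<le> C" and \<epsilon>: "0 < \<epsilon>"
  shows "dirichlet_shift \<epsilon> (bohr_transform T) \<in> hardy_dirichlet p"
    "0 \<le> hardy_dirichlet_norm p (dirichlet_shift \<epsilon> (bohr_transform T))"
    "hardy_dirichlet_norm p (dirichlet_shift \<epsilon> (bohr_transform T)) \<le> C"
proof -
  obtain f where f: "is_lift p (dirichlet_shift \<epsilon> (bohr_transform T)) f" "Lp_le p f C"
    using operator_shift_lift[OF p T \<epsilon>] by blast
  show "dirichlet_shift \<epsilon> (bohr_transform T) \<in> hardy_dirichlet p"
    using f(1) by (auto simp: hardy_dirichlet_def dirichlet_shift_def bohr_transform_def)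
  show "0 \<le> hardy_dirichlet_norm p (dirichlet_shift \<epsilon> (bohr_transform T))"
    "hardy_dirichlet_norm p (dirichlet_shift \<epsilon> (bohr_transform T)) \<le> C"
    unfolding hardy_dirichlet_norm_eq[OF p f(1)] using Lp_norm_nonneg Lp_norm_le[OF p(1) f(2)] by auto
qed

lemma bohr_transform_in_plus:
  fixes T :: "((nat \<Rightarrow> complex) \<Rightarrow> complex) \<Rightarrow> 'x::complex_banach"
  assumes p: "1 \<le> p" "1 / p + 1 / p' = 1" and T: "T \<in> cas_plus p'"
  shows "bohr_transform T \<in> hardy_dirichlet_plus p" "0 \<le> hardy_dirichlet_plus_norm p (bohr_transform T)"
proof -
  obtain C where C: "0 < C" "cas_bound (torus_lattice p') T C"
    using T by (auto simp: cas_plus_def cas_operators_def)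
  note le = hardy_dirichlet_norm_bohr_transform_le[OF p T C(2) less_imp_le[OF C(1)]]
  have bdd: "bdd_above ((\<lambda>\<epsilon>. hardy_dirichlet_norm p (dirichlet_shift \<epsilon> (bohr_transform T))) ` {0<..})"
    by (rule bdd_aboveI2[of _ _ C]) (simp add: le)
  then show "bohr_transform T \<in> hardy_dirichlet_plus p"
    using le(1) by (simp add: hardy_dirichlet_plus_def bohr_transform_def)
  have "0 \<le> hardy_dirichlet_norm p (dirichlet_shift 1 (bohr_transform T))" by (rule le(2)) simp
  also have "\<dots> \<le> hardy_dirichlet_plus_norm p (bohr_transform T)"
    unfolding hardy_dirichlet_plus_norm_def by (rule cSUP_upper[OF _ bdd]) simp
  finally show "0 \<le> hardy_dirichlet_plus_norm p (bohr_transform T)" .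
qed

text \<open>Each summing constant bounds the norm of the series. Conversely, every positive bound on the norm of the series is a
  summing constant of an operator with the same Bohr transform, hence of \<open>T\<close> itself.\<close>

lemma bohr_transform_isometric:
  fixes T :: "((nat \<Rightarrow> complex) \<Rightarrow> complex) \<Rightarrow> 'x::complex_banach"
  assumes p: "1 \<le> p" "1 / p + 1 / p' = 1" and T: "T \<in> cas_plus p'"
  shows "hardy_dirichlet_plus_norm p (bohr_transform T) = cas_norm (torus_lattice p') T"
proof (rule antisym)
  let ?N = "hardy_dirichlet_plus_norm p (bohr_transform T)"
  note p' = conjugate_exponent_ge_1[OF p]
  show "?N \<le> cas_norm (torus_lattice p') T"
    unfolding cas_norm_def
  proof (rule cInf_greatest)
    show "{C. 0 < C \<and> cas_bound (torus_lattice p') T C} \<noteq> {}"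
      using T by (auto simp: cas_plus_def cas_operators_def)
    fix C assume "C \<in> {C. 0 < C \<and> cas_bound (torus_lattice p') T C}"
    then have C: "cas_bound (torus_lattice p') T C" "0 \<le> C" by auto
    show "?N \<le> C"
      unfolding hardy_dirichlet_plus_norm_def
      by (rule cSUP_least) (auto intro: hardy_dirichlet_norm_bohr_transform_le[OF p T C])
  qed
  show "cas_norm (torus_lattice p') T \<le> ?N"
  proof (rule field_le_epsilon)
    fix e :: real assume "0 < e"
    then have C: "0 < ?N + e" "?N \<le> ?N + e"
      using bohr_transform_in_plus(2)[OF p T] by auto
    obtain T' where T': "T' \<in> cas_plus p'" "bohr_transform T' = bohr_transform T"
      "cas_bound (torus_lattice p') T' (?N + e)"
      using hardy_dirichlet_plus_operator[OF p bohr_transform_in_plus(1)[OF p T] C] by blast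
    have "T' = T" by (rule bohr_transform_inj[OF p' T'(1) T T'(2)])
    then show "cas_norm (torus_lattice p') T \<le> ?N + e"
      unfolding cas_norm_def using T'(3) C(1)
      by (intro cInf_lower bdd_belowI[of _ 0]) auto
  qed
qed

lemma complex_subspace_image:
  assumes V: "complex_subspace V"
    and add: "\<And>u v. u \<in> V \<Longrightarrow> v \<in> V \<Longrightarrow> B (\<lambda>i. u i + v i) = (\<lambda>j. B u j + B v j)"
    and scale: "\<And>c u. u \<in> V \<Longrightarrow> B (\<lambda>i. c *\<^sub>C u i) = (\<lambda>j. c *\<^sub>C B u j)"
  shows "complex_subspace (B ` V)"
proof -
  have zero: "(\<lambda>i. 0) \<in> V" and addV: "\<And>u v. u \<in> V \<Longrightarrow> v \<in> V \<Longrightarrow> (\<lambda>i. u i + v i) \<in> V"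
    and scaleV: "\<And>c u. u \<in> V \<Longrightarrow> (\<lambda>i. c *\<^sub>C u i) \<in> V"
    using V by (auto simp: complex_subspace_def)
  have "B (\<lambda>i. 0) = (\<lambda>j. 0)" using scale[OF zero, of 0] by simp
  then have "(\<lambda>j. 0) \<in> B ` V" using zero by (metis imageI)
  then show ?thesis
    unfolding complex_subspace_def
    by (auto simp: add[symmetric] scale[symmetric] intro!: imageI addV scaleV)
qed

theorem theorem4p2:
  fixes p p' :: ennreal
  assumes "1 \<le> p" and "1 / p + 1 / p' = 1"
  shows "linear_isometry_onto
    (bohr_transform :: (((nat \<Rightarrow> complex) \<Rightarrow> complex) \<Rightarrow> 'x::complex_banach) \<Rightarrow> (nat \<Rightarrow> 'x))
    (cas_plus p') (cas_norm (torus_lattice p'))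
    (hardy_dirichlet_plus p) (hardy_dirichlet_plus_norm p)"
proof -
  let ?B = "bohr_transform :: (((nat \<Rightarrow> complex) \<Rightarrow> complex) \<Rightarrow> 'x) \<Rightarrow> (nat \<Rightarrow> 'x)"
  have add: "?B (\<lambda>i. u i + v i) = (\<lambda>j. ?B u j + ?B v j)" for u v
    by (rule ext) (simp add: bohr_transform_def)
  have scale: "?B (\<lambda>i. c *\<^sub>C u i) = (\<lambda>j. c *\<^sub>C ?B u j)" for c u
    by (rule ext) (simp add: bohr_transform_def)
  have surj: "a \<in> ?B ` cas_plus p'" if a: "a \<in> hardy_dirichlet_plus p" for a :: "nat \<Rightarrow> 'x"
  proof -
    have "0 < max 1 (hardy_dirichlet_plus_norm p a)" by simp
    from hardy_dirichlet_plus_operator[OF assms a this] show ?thesis by force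
  qed
  then have im: "?B ` cas_plus p' = hardy_dirichlet_plus p"
    using bohr_transform_in_plus(1)[OF assms] by blast
  have "bij_betw ?B (cas_plus p') (hardy_dirichlet_plus p)"
    unfolding bij_betw_def
    by (intro conjI inj_onI im bohr_transform_inj[OF conjugate_exponent_ge_1[OF assms]])
  moreover have "complex_subspace (hardy_dirichlet_plus p :: (nat \<Rightarrow> 'x) set)"
    unfolding im[symmetric] by (rule complex_subspace_image[OF cas_plus_subspace add scale])
  ultimately show ?thesis
    unfolding linear_isometry_onto_def
    using cas_plus_subspace add scale bohr_transform_isometric[OF assms] by blast
qed

end
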